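(* Up to scaling, $g\sim\mathcal{N}(0,I_D)$, $H^{(1,1)}\sim\mathrm{GOE}(D)$ and $H^{(1,2)}\sim\mathrm{GSOE}(D)$. That is, there are deterministic constants $c_1,c_2,c_3\ge 0$ such that $g$ has the distribution of $c_1X$ with $X\sim\mathcal{N}(0,I_D)$, $H^{(1,1)}$ has the distribution of $c_2M$ with $M\sim\mathrm{GOE}(D)$, and $H^{(1,2)}$ has the distribution of $c_3N$ with $N\sim\mathrm{GSOE}(D)$.
   Context: Let $D\ge 1$ and write points of $\mathbb{R}^D\times\mathbb{R}^D$ as $x=(x^{(1)},x^{(2)})$, with $x^{flip}=(x^{(2)},x^{(1)})$. A real-valued random field is Gaussian if every finite linear combination of its values is a (possibly degenerate) Gaussian random variable. Let $u$ be a mean-zero isotropic Gaussian field on $\mathbb{R}^D\times\mathbb{R}^D$ with covariance function $k_u(x,y)=h(\|x-y\|_2^2)$, where $h:[0,\infty)\to\mathbb{R}$. The field $f(x)=u(x)-u(x^{flip})$ is called a block isotropic Gaussian field with base field $u$; its covariance function is denoted $k_f$. Standing smoothness assumption: $k_u$ (hence $k_f$) is four times continuously differentiable, and $h$ is twice continuously differentiable on $[0,\infty)$. Derivatives of $f$ are taken in the mean-square ($L^2(\Omega)$) sense. Fix $z^*\in\mathbb{R}^D$ and $z=(z^*,z^* )$. Define the random vector $g\in\mathbb{R}^D$ and random matrices $H^{(1,1)},H^{(1,2)}\in\mathbb{R}^{D\times D}$ by $$g_i=\partial_{x^{(1)}_i}f(x)\big|_{x=z},\quad H^{(1,1)}_{i,j}=\partial_{x^{(1)}_i}\partial_{x^{(1)}_j}f(x)\big|_{x=z},\quad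 H^{(1,2)}_{i,j}=\partial_{x^{(1)}_i}\partial_{x^{(2)}_j}f(x)\big|_{x=z}.$$ A random real $D\times D$ matrix $M$ follows the Gaussian Orthogonal Ensemble $\mathrm{GOE}(D)$ if it is symmetric and the entries $M_{ij}$, $1\le i\le j\le D$, are independent with $M_{ii}\sim\mathcal{N}(0,2)$ and $M_{ij}\sim\mathcal{N}(0,1)$ for $i<j$. A random real $D\times D$ matrix $N$ follows the Gaussian Skew-Symmetric Orthogonal Ensemble $\mathrm{GSOE}(D)$ if $N_{ji}=-N_{ij}$ and $N_{ii}=0$ with probability one and the entries $N_{ij}$, $1\le i<j\le D$, are i.i.d. $\mathcal{N}(0,1)$. *)

theory Defs
  imports "HOL-Probability.Probability"
begin

section \<open>Gaussian fields\<close>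

definition gaussian_rv :: "'w measure \<Rightarrow> ('w \<Rightarrow> real) \<Rightarrow> bool" where
  "gaussian_rv M X \<longleftrightarrow> X \<in> borel_measurable M \<and>
     ((\<exists>\<mu>. AE \<omega> in M. X \<omega> = \<mu>) \<or>
      (\<exists>\<mu> \<sigma>. 0 < \<sigma> \<and> distributed M lborel X (\<lambda>x. ennreal (normal_density \<mu> \<sigma> x))))"

definition gaussian_field :: "'w measure \<Rightarrow> ('a \<Rightarrow> 'w \<Rightarrow> real) \<Rightarrow> bool" where
  "gaussian_field M u \<longleftrightarrow>
     (\<forall>S a. finite S \<longrightarrow> gaussian_rv M (\<lambda>\<omega>. \<Sum>x\<in>S. a x * u x \<omega>))"

definition cov_fun :: "'w measure \<Rightarrow> ('a \<Rightarrow> 'w \<Rightarrow> real) \<Rightarrow> 'a \<Rightarrow> 'a \<Rightarrow> real" where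
  "cov_fun M u x y =
     (\<integral>\<omega>. (u x \<omega> - (\<integral>\<omega>. u x \<omega> \<partial>M)) * (u y \<omega> - (\<integral>\<omega>. u y \<omega> \<partial>M)) \<partial>M)"

definition block_field :: "('a \<times> 'a \<Rightarrow> 'w \<Rightarrow> real) \<Rightarrow> 'a \<times> 'a \<Rightarrow> 'w \<Rightarrow> real" where
  "block_field u x \<omega> = u x \<omega> - u (prod.swap x) \<omega>"


section \<open>Smoothness\<close>

primrec C_n :: "nat \<Rightarrow> ('a::euclidean_space \<Rightarrow> real) \<Rightarrow> bool" where
  "C_n 0 f \<longleftrightarrow> continuous_on UNIV f"
| "C_n (Suc n) f \<longleftrightarrow> (\<forall>x. f differentiable at x) \<and>
     (\<forall>b\<in>Basis. C_n n (\<lambda>x. frechet_derivative f (at x) b))"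

text \<open>Derivatives at the endpoint 0 are one-sided; values of the function on the negative
  half-line are irrelevant.\<close>

definition C2_half_line :: "(real \<Rightarrow> real) \<Rightarrow> bool" where
  "C2_half_line h \<longleftrightarrow> (\<exists>h' h''.
     (\<forall>t\<ge>0. (h has_real_derivative h' t) (at t within {0..})) \<and>
     (\<forall>t\<ge>0. (h' has_real_derivative h'' t) (at t within {0..})) \<and>
     continuous_on {0..} h'')"


section \<open>Mean-square derivatives\<close>

definition sq_integrable :: "'w measure \<Rightarrow> ('w \<Rightarrow> real) \<Rightarrow> bool" where
  "sq_integrable M X \<longleftrightarrow> X \<in> borel_measurable M \<and> integrable M (\<lambda>\<omega>. (X \<omega>)\<^sup>2)"

text \<open>Square integrability of the field along the line through \<open>x\<close> makes the Bochner integral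
  below the genuine squared \<open>L\<^sup>2\<close> distance (it would be 0 for a non-integrable function).\<close>

definition has_ms_deriv ::
    "'w measure \<Rightarrow> ('a::real_vector \<Rightarrow> 'w \<Rightarrow> real) \<Rightarrow> 'a \<Rightarrow> 'a \<Rightarrow> ('w \<Rightarrow> real) \<Rightarrow> bool" where
  "has_ms_deriv M f v x Y \<longleftrightarrow> sq_integrable M Y \<and> (\<forall>t. sq_integrable M (f (x + t *\<^sub>R v))) \<and>
     ((\<lambda>t. \<integral>\<omega>. ((f (x + t *\<^sub>R v) \<omega> - f x \<omega>) / t - Y \<omega>)\<^sup>2 \<partial>M) \<longlongrightarrow> 0) (at 0)"

text \<open>A mean-square derivative is unique only up to almost sure equality; \<open>ms_deriv M f v\<close> picks
  some version of the derivative of \<open>f\<close> in direction \<open>v\<close> at every point where one exists.\<close>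

definition ms_deriv ::
    "'w measure \<Rightarrow> ('a::real_vector \<Rightarrow> 'w \<Rightarrow> real) \<Rightarrow> 'a \<Rightarrow> 'a \<Rightarrow> 'w \<Rightarrow> real" where
  "ms_deriv M f v x = (SOME Y. has_ms_deriv M f v x Y)"

definition dir1 :: "'n::finite \<Rightarrow> (real^'n) \<times> (real^'n)" where
  "dir1 i = (axis i 1, 0)"

definition dir2 :: "'n::finite \<Rightarrow> (real^'n) \<times> (real^'n)" where
  "dir2 i = (0, axis i 1)"

definition grad1 :: "'w measure \<Rightarrow> ((real^'n) \<times> (real^'n) \<Rightarrow> 'w \<Rightarrow> real) \<Rightarrow>
    (real^'n) \<times> (real^'n) \<Rightarrow> 'w \<Rightarrow> real^'n" where
  "grad1 M f z \<omega> = (\<chi> i. ms_deriv M f (dir1 i) z \<omega>)"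

definition hess11 :: "'w measure \<Rightarrow> ((real^'n) \<times> (real^'n) \<Rightarrow> 'w \<Rightarrow> real) \<Rightarrow>
    (real^'n) \<times> (real^'n) \<Rightarrow> 'w \<Rightarrow> real^'n^'n" where
  "hess11 M f z \<omega> = (\<chi> i j. ms_deriv M (ms_deriv M f (dir1 j)) (dir1 i) z \<omega>)"

definition hess12 :: "'w measure \<Rightarrow> ((real^'n) \<times> (real^'n) \<Rightarrow> 'w \<Rightarrow> real) \<Rightarrow>
    (real^'n) \<times> (real^'n) \<Rightarrow> 'w \<Rightarrow> real^'n^'n" where
  "hess12 M f z \<omega> = (\<chi> i j. ms_deriv M (ms_deriv M f (dir2 j)) (dir1 i) z \<omega>)"


section \<open>Reference distributions\<close>

text \<open>The linear order on the index type only serves to single out the entries on and above the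
  diagonal.  Note that \<open>normal_density\<close> takes the standard deviation as its second argument.\<close>

definition std_gaussian_vector :: "'v measure \<Rightarrow> ('v \<Rightarrow> real^'n) \<Rightarrow> bool" where
  "std_gaussian_vector N X \<longleftrightarrow> prob_space N \<and> X \<in> borel_measurable N \<and>
     prob_space.indep_vars N (\<lambda>_. borel) (\<lambda>i \<omega>. X \<omega> $ i) UNIV \<and>
     (\<forall>i. distributed N lborel (\<lambda>\<omega>. X \<omega> $ i) (\<lambda>x. ennreal (std_normal_density x)))"

definition GOE :: "'v measure \<Rightarrow> ('v \<Rightarrow> real^'n::{finite,linorder}^'n::{finite,linorder}) \<Rightarrow> bool" where
  "GOE N X \<longleftrightarrow> prob_space N \<and> X \<in> borel_measurable N \<and>
     (AE \<omega> in N. transpose (X \<omega>) = X \<omega>) \<and>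
     prob_space.indep_vars N (\<lambda>_. borel) (\<lambda>(i, j) \<omega>. X \<omega> $ i $ j) {(i, j). i \<le> j} \<and>
     (\<forall>i. distributed N lborel (\<lambda>\<omega>. X \<omega> $ i $ i) (\<lambda>x. ennreal (normal_density 0 (sqrt 2) x))) \<and>
     (\<forall>i j. i < j \<longrightarrow>
        distributed N lborel (\<lambda>\<omega>. X \<omega> $ i $ j) (\<lambda>x. ennreal (std_normal_density x)))"

definition GSOE :: "'v measure \<Rightarrow> ('v \<Rightarrow> real^'n::{finite,linorder}^'n::{finite,linorder}) \<Rightarrow> bool" where
  "GSOE N X \<longleftrightarrow> prob_space N \<and> X \<in> borel_measurable N \<and>
     (AE \<omega> in N. (\<forall>i j. X \<omega> $ j $ i = - X \<omega> $ i $ j) \<and> (\<forall>i. X \<omega> $ i $ i = 0)) \<and>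
     prob_space.indep_vars N (\<lambda>_. borel) (\<lambda>(i, j) \<omega>. X \<omega> $ i $ j) {(i, j). i < j} \<and>
     (\<forall>i j. i < j \<longrightarrow>
        distributed N lborel (\<lambda>\<omega>. X \<omega> $ i $ j) (\<lambda>x. ennreal (std_normal_density x)))"

definition same_distr ::
    "'w measure \<Rightarrow> ('w \<Rightarrow> 'b::topological_space) \<Rightarrow> 'v measure \<Rightarrow> ('v \<Rightarrow> 'b) \<Rightarrow> bool" where
  "same_distr M X N Y \<longleftrightarrow> X \<in> borel_measurable M \<and> Y \<in> borel_measurable N \<and>
     distr M borel X = distr N borel Y"

end

theory Submission
  imports Defs
begin

text \<open>
  Everything happens at a diagonal point \<open>z\<close>, and everything is Gaussian and centered.  Mean-square
  derivatives of the field are limits of linear combinations of its values, so the entries of the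
  gradient and of the Hessian blocks lie in the Gaussian space of \<open>u\<close>
  (\<open>ms_gaussian_space_ms_deriv\<close>).  Such vectors are determined in law by their covariances
  (\<open>centered_gaussian_vector_distr_eq\<close>).  It remains to compute three covariances and to see that they
  are multiples of those of the reference ensembles.

  The covariance of \<open>u\<close> is \<open>\<phi> (x - y)\<close> with \<open>\<phi> w = h (\<bar>w\<bar>\<^sup>2)\<close>.  Covariances of first derivatives of \<open>u\<close> at
  one point are second derivatives \<open>- \<partial>\<^sub>a \<partial>\<^sub>b \<phi> 0 = - 2 h' 0 (a \<bullet> b)\<close>, and covariances of second derivatives are
  fourth derivatives of \<open>\<phi>\<close> at 0, which by isotropy are
  \<open>4 h'' 0\<close> times \<open>(a \<bullet> b) (c \<bullet> d) + (a \<bullet> c) (b \<bullet> d) + (a \<bullet> d) (b \<bullet> c)\<close>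
  (\<open>radial_partial2\<close>, \<open>radial_partial4\<close>).

  At \<open>z\<close> the derivatives of the block field are \<open>u\<^sub>b - u\<^sub>b\<^sub>'\<close> and \<open>u\<^sub>a\<^sub>b - u\<^sub>a\<^sub>'\<^sub>b\<^sub>'\<close>, where the prime exchanges the
  blocks.  In the covariance of two such differences the first of the three pairings cancels.  For two
  directions in the first block the other two pairings give
  \<open>8 h'' 0 (\<delta>\<^sub>i\<^sub>k \<delta>\<^sub>j\<^sub>l + \<delta>\<^sub>i\<^sub>l \<delta>\<^sub>j\<^sub>k)\<close>, which is the covariance of the Gaussian orthogonal ensemble scaled by
  \<open>sqrt (8 h'' 0)\<close>.  For mixed directions the swap exchanges the roles of the indices in one of the pairings, which
  enters with a minus sign: \<open>8 h'' 0 (\<delta>\<^sub>i\<^sub>k \<delta>\<^sub>j\<^sub>l - \<delta>\<^sub>i\<^sub>l \<delta>\<^sub>j\<^sub>k)\<close>, the skew-symmetric ensemble with the same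
  scale.  The gradient has covariance \<open>- 4 h' 0 \<delta>\<^sub>i\<^sub>j\<close>.  The signs \<open>h' 0 \<le> 0 \<le> h'' 0\<close> hold because these are
  variances on the diagonal.

  Two analytic points carry the argument.  The mean-square derivatives exist because the covariances of
  the difference quotients converge (\<open>mean_square_limit_exists\<close>, \<open>stationary_ms_differentiable\<close>).  And since
  \<open>h\<close> is only twice differentiable, the fourth derivatives of \<open>\<phi>\<close> are found by comparing
  \<open>\<partial>\<^sub>a \<partial>\<^sub>b \<phi>\<close> with its quadratic Taylor polynomial.
\<close>

section \<open>Directional derivatives\<close>

definition has_dir_deriv :: "('a::real_vector \<Rightarrow> real) \<Rightarrow> 'a \<Rightarrow> 'a \<Rightarrow> real \<Rightarrow> bool" where
  "has_dir_deriv f v x D \<longleftrightarrow> ((\<lambda>t. f (x + t *\<^sub>R v)) has_real_derivative D) (at 0)"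

text \<open>Iterating \<open>partial\<close> unfolds the recursion of \<^const>\<open>C_n\<close>, which asks for
  partial derivatives along basis vectors only.\<close>

definition partial :: "('a::euclidean_space \<Rightarrow> real) \<Rightarrow> 'a \<Rightarrow> 'a \<Rightarrow> real" where
  "partial f b x = frechet_derivative f (at x) b"

lemma has_dir_deriv_along_line:
  assumes "has_dir_deriv f v (x + t *\<^sub>R v) D"
  shows "((\<lambda>s. f (x + s *\<^sub>R v)) has_real_derivative D) (at t)"
proof -
  have "((\<lambda>s. f (x + (s + t) *\<^sub>R v)) has_real_derivative D) (at 0)"
    using assms by (simp add: has_dir_deriv_def algebra_simps)
  then show ?thesis
    using DERIV_shift[of "\<lambda>s. f (x + s *\<^sub>R v)" D 0 t] by simp
qed

lemma has_dir_deriv_unique: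
  "has_dir_deriv f v x D \<Longrightarrow> has_dir_deriv f v x D' \<Longrightarrow> D = D'"
  unfolding has_dir_deriv_def by (rule DERIV_unique)

lemma has_dir_deriv_frechet:
  fixes f :: "'a::euclidean_space \<Rightarrow> real"
  assumes "f differentiable at x"
  shows "has_dir_deriv f v x (frechet_derivative f (at x) v)"
proof -
  have f: "(f has_derivative frechet_derivative f (at x)) (at x)"
    using assms frechet_derivative_works by blast
  have "((\<lambda>t. x + t *\<^sub>R v) has_derivative (\<lambda>t. t *\<^sub>R v)) (at 0)"
    by (auto intro!: derivative_eq_intros)
  then have "((f \<circ> (\<lambda>t. x + t *\<^sub>R v)) has_derivative
      (frechet_derivative f (at x) \<circ> (\<lambda>t. t *\<^sub>R v))) (at 0)"
    by (rule diff_chain_at) (simp add: f)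
  moreover have "frechet_derivative f (at x) \<circ> (\<lambda>t. t *\<^sub>R v)
      = (*) (frechet_derivative f (at x) v)"
    using linear_frechet_derivative[OF assms] by (auto simp: o_def linear_cmul)
  ultimately show ?thesis
    by (simp add: has_dir_deriv_def has_field_derivative_def o_def)
qed

text \<open>Moving the second argument of a stationary covariance changes the sign of the derivative; this is
  where the signs in the covariances of the derivative fields come from.\<close>

lemma has_dir_deriv_reflect:
  assumes "has_dir_deriv f v (x - y) D"
  shows "has_dir_deriv (\<lambda>y. f (x - y)) v y (- D)"
proof -
  have "((\<lambda>t. f (x - y + t *\<^sub>R v)) has_real_derivative D) (at (- 0))"
    using assms by (simp add: has_dir_deriv_def)
  then have "((\<lambda>t. f (x - y + (- t) *\<^sub>R v)) has_real_derivative - D) (at 0)"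
    by (subst (asm) DERIV_mirror)
  then show ?thesis
    by (simp add: has_dir_deriv_def algebra_simps)
qed

lemma has_dir_deriv_uminus_dir:
  assumes "has_dir_deriv f v x D"
  shows "has_dir_deriv f (- v) x (- D)"
  using assms DERIV_mirror[of "\<lambda>t. f (x + t *\<^sub>R v)" D 0] by (simp add: has_dir_deriv_def)

lemma has_dir_deriv_translate:
  assumes "has_dir_deriv f v (x - y) D"
  shows "has_dir_deriv (\<lambda>x. f (x - y)) v x D"
  using assms by (simp add: has_dir_deriv_def algebra_simps)

lemma C_n_Suc_iff:
  "C_n (Suc n) f \<longleftrightarrow> (\<forall>x. f differentiable at x) \<and> (\<forall>b\<in>Basis. C_n n (partial f b))"
  by (simp add: partial_def[abs_def])

(* Partial derivatives then stay folded during simplification. *)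
declare C_n.simps(2) [simp del]

lemma C_n_partial: "C_n (Suc n) f \<Longrightarrow> b \<in> Basis \<Longrightarrow> C_n n (partial f b)"
  by (simp add: C_n_Suc_iff)

lemma C_n_has_dir_deriv:
  assumes "C_n (Suc n) f"
  shows "has_dir_deriv f b x (partial f b x)"
  using assms has_dir_deriv_frechet[of f x b] by (simp add: partial_def C_n_Suc_iff)

lemma C_n_continuous:
  assumes "C_n n f" shows "continuous_on UNIV f"
  using assms
  by (cases n) (auto intro!: differentiable_imp_continuous_on
      simp: differentiable_on_def C_n_Suc_iff differentiable_at_withinI)

lemma C_n_SucD: "C_n (Suc n) f \<Longrightarrow> C_n n f"
proof (induction n arbitrary: f)
  case 0
  then show ?case using C_n_continuous by auto
next
  case (Suc n)
  then show ?case unfolding C_n_Suc_iff[of "Suc n"] C_n_Suc_iff[of n f] by blast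
qed

lemma C_n_le: "m \<le> n \<Longrightarrow> C_n n f \<Longrightarrow> C_n m f"
  by (induction n rule: dec_induct) (auto dest: C_n_SucD)

lemma C_n_uminus: "C_n n f \<Longrightarrow> C_n n (\<lambda>x. - f x)"
proof (induction n arbitrary: f)
  case 0
  then show ?case by (simp add: continuous_on_minus)
next
  case (Suc n)
  have "partial (\<lambda>x. - f x) b = (\<lambda>x. - partial f b x)" for b
  proof
    fix x
    have "(f has_derivative frechet_derivative f (at x)) (at x)"
      using Suc.prems by (simp add: C_n_Suc_iff frechet_derivative_works[symmetric])
    then have "((\<lambda>x. - f x) has_derivative (\<lambda>v. - frechet_derivative f (at x) v)) (at x)"
      by (rule has_derivative_minus)
    from frechet_derivative_at[OF this] show "partial (\<lambda>x. - f x) b x = - partial f b x"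
      by (simp add: partial_def fun_eq_iff)
  qed
  with Suc show ?case by (simp add: C_n_Suc_iff)
qed

text \<open>A stationary covariance is smooth as a function of both points; only its smoothness in the first
  point, the second one being held at the origin, matters below.  The chain rule along
  \<open>x \<mapsto> (x, c)\<close> turns the partial derivative along \<open>b\<close> into the one along \<open>(b, 0)\<close>, which is
  again a basis direction.\<close>

lemma C_n_slice:
  fixes f :: "'a::euclidean_space \<times> 'b::euclidean_space \<Rightarrow> real"
  assumes "C_n n f"
  shows "C_n n (\<lambda>x. f (x, c))"
  using assms
proof (induction n arbitrary: f)
  case 0
  then show ?case by (auto intro!: continuous_on_compose2[of UNIV f] continuous_intros)
next
  case (Suc n)
  have der: "((\<lambda>x. f (x, c)) has_derivative (\<lambda>v. frechet_derivative f (at (x, c)) (v, 0))) (at x)" for x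
  proof -
    have "((\<lambda>x. (x, c)) has_derivative (\<lambda>v. (v, 0))) (at x)"
      by (auto intro!: derivative_eq_intros)
    moreover have "(f has_derivative frechet_derivative f (at (x, c))) (at (x, c))"
      using Suc.prems frechet_derivative_works by (auto simp: C_n_Suc_iff)
    ultimately show ?thesis
      using diff_chain_at[of "\<lambda>x. (x, c)" _ x f] by (simp add: o_def)
  qed
  have "partial (\<lambda>x. f (x, c)) b = (\<lambda>x. partial f (b, 0) (x, c))" for b
    by (rule ext) (simp add: partial_def frechet_derivative_at[OF der, symmetric])
  moreover have "C_n n (\<lambda>x. partial f (b, 0) (x, c))" if "b \<in> Basis" for b
    using Suc.prems that by (intro Suc.IH C_n_partial) (auto simp: Basis_prod_def)
  ultimately show ?case
    using der by (auto simp: C_n_Suc_iff differentiable_def)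
qed

text \<open>The mixed second difference of \<open>q\<close> over a small parallelogram with sides \<open>s c\<close> and \<open>t d\<close> is
  \<open>s t\<close> times the mixed derivative, with an error that is small relative to \<open>s t\<close> even when the
  ratio of \<open>s\<close> and \<open>t\<close> is unbounded.  This uniformity is what the existence of mean-square
  derivatives needs.  The mean value inequality is applied in the direction \<open>d\<close> and then in the direction \<open>c\<close>, each time
  after subtracting the linear function that the bound predicts.\<close>

lemma mixed_difference_bound:
  fixes q :: "'a::real_normed_vector \<Rightarrow> real"
  assumes c: "\<And>w. has_dir_deriv q c w (qc w)"
    and d: "\<And>w. has_dir_deriv qc d w (qcd w)"
    and cont: "isCont qcd x" and "0 < e"
  obtains \<delta> where "0 < \<delta>" and "\<And>s t. \<bar>s\<bar> < \<delta> \<Longrightarrow> \<bar>t\<bar> < \<delta> \<Longrightarrow>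
    \<bar>q (x + s *\<^sub>R c + t *\<^sub>R d) - q (x + s *\<^sub>R c) - q (x + t *\<^sub>R d) + q x - s * t * qcd x\<bar> \<le> e * \<bar>s * t\<bar>"
proof -
  obtain r where r: "0 < r" "\<And>w. dist w x < r \<Longrightarrow> dist (qcd w) (qcd x) < e"
    using cont \<open>0 < e\<close> by (metis continuous_at_eps_delta dist_commute)
  \<comment> \<open>The \<open>+ 1\<close> only keeps the denominator positive when both directions vanish.\<close>
  define \<delta> where "\<delta> = r / (norm c + norm d + 1)"
  have pos: "0 < norm c + norm d + 1" by (simp add: add_nonneg_pos)
  have "0 < \<delta>" unfolding \<delta>_def using r(1) pos by simp
  moreover have "\<bar>q (x + s *\<^sub>R c + t *\<^sub>R d) - q (x + s *\<^sub>R c) - q (x + t *\<^sub>R d) + q x - s * t * qcd x\<bar> \<le> e * \<bar>s * t\<bar>"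
    if st: "\<bar>s\<bar> < \<delta>" "\<bar>t\<bar> < \<delta>" for s t
  proof -
    have near: "\<bar>qcd (x + \<sigma> *\<^sub>R c + \<tau> *\<^sub>R d) - qcd x\<bar> \<le> e" if "\<bar>\<sigma>\<bar> < \<delta>" "\<bar>\<tau>\<bar> < \<delta>" for \<sigma> \<tau>
    proof -
      have "norm (\<sigma> *\<^sub>R c + \<tau> *\<^sub>R d) \<le> \<bar>\<sigma>\<bar> * norm c + \<bar>\<tau>\<bar> * norm d"
        by (rule order_trans[OF norm_triangle_ineq]) simp
      also have "\<dots> \<le> \<delta> * norm c + \<delta> * norm d"
        using that by (intro add_mono mult_right_mono) auto
      also have "\<dots> < \<delta> * (norm c + norm d + 1)"
        using \<open>0 < \<delta>\<close> by (simp add: algebra_simps)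
      also have "\<dots> = r" using pos by (simp add: \<delta>_def)
      finally have "dist (x + \<sigma> *\<^sub>R c + \<tau> *\<^sub>R d) x < r" by (simp add: dist_norm algebra_simps)
      from r(2)[OF this] show ?thesis by (simp add: dist_real_def)
    qed
    define I where "I = {- \<delta> <..< \<delta>}"
    have inner: "\<bar>qc (x + \<sigma> *\<^sub>R c + t *\<^sub>R d) - qc (x + \<sigma> *\<^sub>R c) - t * qcd x\<bar> \<le> e * \<bar>t\<bar>"
      if "\<sigma> \<in> I" for \<sigma>
    proof -
      have D: "((\<lambda>\<tau>. qc (x + \<sigma> *\<^sub>R c + \<tau> *\<^sub>R d) - \<tau> * qcd x) has_real_derivative
          (qcd (x + \<sigma> *\<^sub>R c + \<tau> *\<^sub>R d) - qcd x)) (at \<tau> within I)" for \<tau>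
      proof (rule has_field_derivative_at_within)
        show "((\<lambda>\<tau>. qc (x + \<sigma> *\<^sub>R c + \<tau> *\<^sub>R d) - \<tau> * qcd x) has_real_derivative
            (qcd (x + \<sigma> *\<^sub>R c + \<tau> *\<^sub>R d) - qcd x)) (at \<tau>)"
          by (rule has_dir_deriv_along_line[OF d] derivative_eq_intros refl | simp)+
      qed
      have "norm ((qc (x + \<sigma> *\<^sub>R c + t *\<^sub>R d) - t * qcd x) - (qc (x + \<sigma> *\<^sub>R c + 0 *\<^sub>R d) - 0 * qcd x))
          \<le> e * norm (t - 0)"
      proof (rule field_differentiable_bound[where S = I])
        show "norm (qcd (x + \<sigma> *\<^sub>R c + \<tau> *\<^sub>R d) - qcd x) \<le> e" if "\<tau> \<in> I" for \<tau>
          using near[of \<sigma> \<tau>] \<open>\<sigma> \<in> I\<close> that by (auto simp: I_def)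
      qed (use D st \<open>0 < \<delta>\<close> in \<open>auto simp: I_def\<close>)
      then show ?thesis by (simp add: algebra_simps)
    qed
    have D: "((\<lambda>\<sigma>. q (x + t *\<^sub>R d + \<sigma> *\<^sub>R c) - q (x + \<sigma> *\<^sub>R c) - \<sigma> * (t * qcd x)) has_real_derivative
        (qc (x + t *\<^sub>R d + \<sigma> *\<^sub>R c) - qc (x + \<sigma> *\<^sub>R c) - t * qcd x)) (at \<sigma> within I)" for \<sigma>
    proof (rule has_field_derivative_at_within)
      show "((\<lambda>\<sigma>. q (x + t *\<^sub>R d + \<sigma> *\<^sub>R c) - q (x + \<sigma> *\<^sub>R c) - \<sigma> * (t * qcd x)) has_real_derivative
          (qc (x + t *\<^sub>R d + \<sigma> *\<^sub>R c) - qc (x + \<sigma> *\<^sub>R c) - t * qcd x)) (at \<sigma>)"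
        by (rule has_dir_deriv_along_line[OF c] derivative_eq_intros refl | simp)+
    qed
    have "norm ((q (x + t *\<^sub>R d + s *\<^sub>R c) - q (x + s *\<^sub>R c) - s * (t * qcd x))
         - (q (x + t *\<^sub>R d + 0 *\<^sub>R c) - q (x + 0 *\<^sub>R c) - 0 * (t * qcd x))) \<le> (e * \<bar>t\<bar>) * norm (s - 0)"
    proof (rule field_differentiable_bound[where S = I])
      show "norm (qc (x + t *\<^sub>R d + \<sigma> *\<^sub>R c) - qc (x + \<sigma> *\<^sub>R c) - t * qcd x) \<le> e * \<bar>t\<bar>"
        if "\<sigma> \<in> I" for \<sigma>
        using inner[OF that] by (simp add: add_ac)
    qed (use D st \<open>0 < \<delta>\<close> in \<open>auto simp: I_def\<close>)
    then show ?thesis by (simp add: abs_mult algebra_simps)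
  qed
  ultimately show ?thesis by (rule that)
qed

section \<open>Derivatives at the origin of a radial function\<close>

text \<open>The squared norm never leaves the half-line, so a one-sided derivative of \<open>h\<close> at 0 is enough for
  the chain rule, at the origin as well.\<close>

lemma DERIV_compose_half_line:
  assumes "(h has_real_derivative D) (at (g x) within {0..})"
    and "(g has_real_derivative E) (at x)" and "\<And>y. 0 \<le> g y"
  shows "((\<lambda>y. h (g y)) has_real_derivative D * E) (at x)"
proof -
  have "(h has_real_derivative D) (at (g x) within range g)"
    using assms(1) by (rule has_field_derivative_subset) (use assms(3) in auto)
  from DERIV_image_chain[OF this assms(2)] show ?thesis by (simp add: o_def)
qed

lemma has_dir_deriv_radial:
  fixes v w :: "'a::real_inner"
  assumes h: "\<forall>t\<ge>0. (h has_real_derivative h' t) (at t within {0..})"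
  shows "has_dir_deriv (\<lambda>w. h ((norm w)\<^sup>2)) v w (2 * (w \<bullet> v) * h' ((norm w)\<^sup>2))"
proof -
  have "((\<lambda>t. (norm (w + t *\<^sub>R v))\<^sup>2) has_real_derivative 2 * (w \<bullet> v)) (at 0)"
    unfolding power2_norm_eq_inner
    by (auto intro!: derivative_eq_intros simp: inner_simps inner_commute)
  then have "((\<lambda>t. h ((norm (w + t *\<^sub>R v))\<^sup>2)) has_real_derivative
      h' ((norm (w + 0 *\<^sub>R v))\<^sup>2) * (2 * (w \<bullet> v))) (at 0)"
    by (intro DERIV_compose_half_line[where h = h] h[rule_format]) auto
  then show ?thesis by (simp add: has_dir_deriv_def mult_ac)
qed

lemma has_dir_deriv_radial2:
  fixes a b w :: "'a::real_inner"
  assumes h': "\<forall>t\<ge>0. (h' has_real_derivative h'' t) (at t within {0..})"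
  shows "has_dir_deriv (\<lambda>w. 2 * (w \<bullet> b) * h' ((norm w)\<^sup>2)) a w
    (2 * (a \<bullet> b) * h' ((norm w)\<^sup>2) + 4 * (w \<bullet> a) * (w \<bullet> b) * h'' ((norm w)\<^sup>2))"
  using has_dir_deriv_radial[OF h', of a w] unfolding has_dir_deriv_def
  by (auto intro!: derivative_eq_intros simp: inner_simps algebra_simps)

text \<open>The Hessian entries \<open>q\<close> of a radial function involve \<open>h''\<close>, which is merely continuous, so they
  cannot be differentiated by the rules.  Continuity of \<open>h''\<close> and differentiability of \<open>h'\<close> at 0 still give
  their quadratic Taylor polynomial along each line through the origin.\<close>

lemma radial_hessian_expansion:
  fixes a b w :: "'a::real_inner"
  assumes h': "(h' has_real_derivative h'' 0) (at 0 within {0..})"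
    and cont: "continuous_on {0..} h''"
    and q: "\<And>w. q w = 2 * (a \<bullet> b) * h' ((norm w)\<^sup>2) + 4 * (w \<bullet> a) * (w \<bullet> b) * h'' ((norm w)\<^sup>2)"
  shows "((\<lambda>t. (q (t *\<^sub>R w) - q 0) / t\<^sup>2) \<longlongrightarrow>
    h'' 0 * (2 * (a \<bullet> b) * (w \<bullet> w) + 4 * (w \<bullet> a) * (w \<bullet> b))) (at 0)"
proof -
  define n where "n = (norm w)\<^sup>2"
  have n: "0 \<le> n" "w \<bullet> w = n" by (simp_all add: n_def power2_norm_eq_inner)
  have scaled: "(norm (t *\<^sub>R w))\<^sup>2 = t\<^sup>2 * n" for t
    by (simp add: n_def power_mult_distrib)
  have q_line: "q (t *\<^sub>R w) = 2 * (a \<bullet> b) * h' (t\<^sup>2 * n)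
      + t\<^sup>2 * (4 * (w \<bullet> a) * (w \<bullet> b) * h'' (t\<^sup>2 * n))" for t
    unfolding q scaled by (simp add: power2_eq_square)
  have q0: "q 0 = 2 * (a \<bullet> b) * h' 0"
    by (simp add: q)
  have lim: "filterlim (\<lambda>t. t\<^sup>2 * n) (at 0 within {0..}) (at 0)" if "n \<noteq> 0"
    unfolding filterlim_at using that n
    by (auto intro!: tendsto_eq_intros simp: eventually_at_filter)
  have "((\<lambda>t. (h' (t\<^sup>2 * n) - h' 0) / t\<^sup>2) \<longlongrightarrow> h'' 0 * n) (at 0)"
  proof (cases "n = 0")
    case False
    have "((\<lambda>s. (h' s - h' 0) / s) \<longlongrightarrow> h'' 0) (at 0 within {0..})"
      using h' by (simp add: has_field_derivative_iff)
    from filterlim_compose[OF this lim[OF False]]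
    have "((\<lambda>t. (h' (t\<^sup>2 * n) - h' 0) / (t\<^sup>2 * n)) \<longlongrightarrow> h'' 0) (at 0)" .
    from tendsto_mult_right[OF this, of n] show ?thesis using False by simp
  qed simp
  moreover have "((\<lambda>t. h'' (t\<^sup>2 * n)) \<longlongrightarrow> h'' 0) (at 0)"
  proof (cases "n = 0")
    case False
    have "(h'' \<longlongrightarrow> h'' 0) (at 0 within {0..})"
      using cont by (auto simp: continuous_on_def)
    from filterlim_compose[OF this lim[OF False]] show ?thesis .
  qed simp
  ultimately have "((\<lambda>t. 2 * (a \<bullet> b) * ((h' (t\<^sup>2 * n) - h' 0) / t\<^sup>2)
      + 4 * (w \<bullet> a) * (w \<bullet> b) * h'' (t\<^sup>2 * n)) \<longlongrightarrow>
      2 * (a \<bullet> b) * (h'' 0 * n) + 4 * (w \<bullet> a) * (w \<bullet> b) * h'' 0) (at 0)"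
    by (intro tendsto_intros)
  moreover have "\<forall>\<^sub>F t in at 0. 2 * (a \<bullet> b) * ((h' (t\<^sup>2 * n) - h' 0) / t\<^sup>2)
      + 4 * (w \<bullet> a) * (w \<bullet> b) * h'' (t\<^sup>2 * n) = (q (t *\<^sub>R w) - q 0) / t\<^sup>2"
    unfolding eventually_at_filter
    by (rule always_eventually)
       (simp add: q_line q0 field_simps)
  ultimately show ?thesis
    using n by (auto simp: algebra_simps elim!: Lim_transform_eventually)
qed

text \<open>The fourth derivatives exist because \<open>\<phi>\<close> is assumed to be four times differentiable, and their values
  are read off from the quadratic Taylor polynomial of the Hessian: both must give the limit of the same
  mixed second difference.  The result is the sum over the three pairings of the four directions, the
  only symmetric tensor of order four that is invariant under rotations, up to a factor.\<close>

lemma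
  fixes \<phi> :: "'a::euclidean_space \<Rightarrow> real"
  assumes \<phi>: "\<And>w. \<phi> w = h ((norm w)\<^sup>2)" and C: "C_n 4 \<phi>"
    and h: "\<forall>t\<ge>0. (h has_real_derivative h' t) (at t within {0..})"
    and h': "\<forall>t\<ge>0. (h' has_real_derivative h'' t) (at t within {0..})"
    and cont: "continuous_on {0..} h''"
    and basis: "a \<in> Basis" "b \<in> Basis"
  shows radial_partial2: "partial (partial \<phi> a) b 0 = 2 * (a \<bullet> b) * h' 0"
    and radial_partial4: "c \<in> Basis \<Longrightarrow> d \<in> Basis \<Longrightarrow> partial (partial (partial (partial \<phi> a) b) c) d 0 =
      4 * h'' 0 * ((a \<bullet> b) * (c \<bullet> d) + (a \<bullet> c) * (b \<bullet> d) + (a \<bullet> d) * (b \<bullet> c))"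
proof -
  have C4: "C_n (Suc (Suc (Suc (Suc 0)))) \<phi>" using C by (simp add: eval_nat_numeral)
  note C3 = C_n_partial[OF C4 basis(1)]
  note C2 = C_n_partial[OF C3 basis(2)]
  have \<phi>': "\<phi> = (\<lambda>w. h ((norm w)\<^sup>2))" using \<phi> by auto
  have 1: "partial \<phi> a = (\<lambda>w. 2 * (w \<bullet> a) * h' ((norm w)\<^sup>2))"
  proof
    show "partial \<phi> a w = 2 * (w \<bullet> a) * h' ((norm w)\<^sup>2)" for w
      using C_n_has_dir_deriv[OF C4, of a w] has_dir_deriv_radial[OF h, of a w]
      unfolding \<phi>' by (rule has_dir_deriv_unique)
  qed
  define q where "q = partial (partial \<phi> a) b"
  have q: "q w = 2 * (b \<bullet> a) * h' ((norm w)\<^sup>2) + 4 * (w \<bullet> b) * (w \<bullet> a) * h'' ((norm w)\<^sup>2)" for w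
    using C_n_has_dir_deriv[OF C3, of b w] has_dir_deriv_radial2[OF h', of a b w]
    unfolding q_def 1 by (rule has_dir_deriv_unique)
  show "partial (partial \<phi> a) b 0 = 2 * (a \<bullet> b) * h' 0"
    using q[of 0] by (simp add: q_def inner_commute)
  assume basis': "c \<in> Basis" "d \<in> Basis"
  note C1 = C_n_partial[OF C2 basis'(1)]
  note C0 = C_n_partial[OF C1 basis'(2)]
  \<comment> \<open>The mixed second difference of \<open>q\<close> at scale \<open>t\<close>, split into differences along single lines.\<close>
  define L where "L = partial (partial q c) d 0"
  define f where "f t = (q (t *\<^sub>R (c + d)) - q 0) / t\<^sup>2 - (q (t *\<^sub>R c) - q 0) / t\<^sup>2
      - (q (t *\<^sub>R d) - q 0) / t\<^sup>2" for t :: real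
  define Q where "Q w = h'' 0 * (2 * (b \<bullet> a) * (w \<bullet> w) + 4 * (w \<bullet> b) * (w \<bullet> a))" for w
  have "(f \<longlongrightarrow> Q (c + d) - Q c - Q d) (at 0)"
    unfolding f_def[abs_def] Q_def
    by (intro tendsto_diff radial_hessian_expansion[where h' = h'] q h'[rule_format] cont) simp_all
  moreover have "(f \<longlongrightarrow> L) (at 0)"
  proof (rule tendstoI)
    fix e :: real assume "0 < e"
    have "isCont (partial (partial q c) d) 0"
      using C_n_continuous[OF C0] by (simp add: continuous_on_eq_continuous_at q_def)
    from mixed_difference_bound[OF C_n_has_dir_deriv[OF C2, of c]
        C_n_has_dir_deriv[OF C1, of d] this[unfolded q_def] half_gt_zero[OF \<open>0 < e\<close>]]
    obtain \<delta> where \<delta>: "0 < \<delta>" "\<And>s t. \<bar>s\<bar> < \<delta> \<Longrightarrow> \<bar>t\<bar> < \<delta> \<Longrightarrow>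
      \<bar>q (0 + s *\<^sub>R c + t *\<^sub>R d) - q (0 + s *\<^sub>R c) - q (0 + t *\<^sub>R d) + q 0 - s * t * L\<bar> \<le> e / 2 * \<bar>s * t\<bar>"
      unfolding L_def q_def by blast
    show "\<forall>\<^sub>F t in at 0. dist (f t) L < e"
      unfolding eventually_at
    proof (intro exI conjI ballI impI)
      fix t :: real assume t: "t \<noteq> 0 \<and> dist t 0 < \<delta>"
      have "f t - L = (q (0 + t *\<^sub>R c + t *\<^sub>R d) - q (0 + t *\<^sub>R c) - q (0 + t *\<^sub>R d) + q 0 - t * t * L) / (t * t)"
        using t by (simp add: f_def field_simps power2_eq_square)
      also have "\<bar>\<dots>\<bar> \<le> e / 2"
        using \<delta>(2)[of t t] t by (simp add: abs_mult divide_le_eq)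
      finally show "dist (f t) L < e" using \<open>0 < e\<close> by (simp add: dist_real_def)
    qed (rule \<delta>)
  qed
  ultimately have "L = Q (c + d) - Q c - Q d"
    by (rule tendsto_unique[OF at_neq_bot, rotated -1])
  then show "partial (partial (partial (partial \<phi> a) b) c) d 0 =
      4 * h'' 0 * ((a \<bullet> b) * (c \<bullet> d) + (a \<bullet> c) * (b \<bullet> d) + (a \<bullet> d) * (b \<bullet> c))"
    unfolding L_def q_def Q_def by (simp add: inner_simps inner_commute algebra_simps)
qed

section \<open>Square-integrable random variables\<close>

lemma sq_integrableD:
  assumes "sq_integrable M X"
  shows "X \<in> borel_measurable M" "integrable M (\<lambda>\<omega>. (X \<omega>)\<^sup>2)"
  using assms by (auto simp: sq_integrable_def)

lemma sq_integrable_mult: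
  assumes X: "sq_integrable M X" and Y: "sq_integrable M Y"
  shows "integrable M (\<lambda>\<omega>. X \<omega> * Y \<omega>)"
proof (rule Bochner_Integration.integrable_bound)
  show "integrable M (\<lambda>\<omega>. (X \<omega>)\<^sup>2 + (Y \<omega>)\<^sup>2)"
    using X Y by (simp add: sq_integrable_def)
  show "AE \<omega> in M. norm (X \<omega> * Y \<omega>) \<le> norm ((X \<omega>)\<^sup>2 + (Y \<omega>)\<^sup>2)"
  proof (rule AE_I2)
    fix \<omega>
    have "2 * (\<bar>X \<omega>\<bar> * \<bar>Y \<omega>\<bar>) \<le> (X \<omega>)\<^sup>2 + (Y \<omega>)\<^sup>2"
      using sum_squares_bound[of "\<bar>X \<omega>\<bar>" "\<bar>Y \<omega>\<bar>"] by (simp add: mult.assoc)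
    moreover have "0 \<le> \<bar>X \<omega>\<bar> * \<bar>Y \<omega>\<bar>" by simp
    ultimately have "\<bar>X \<omega>\<bar> * \<bar>Y \<omega>\<bar> \<le> (X \<omega>)\<^sup>2 + (Y \<omega>)\<^sup>2" by linarith
    then show "norm (X \<omega> * Y \<omega>) \<le> norm ((X \<omega>)\<^sup>2 + (Y \<omega>)\<^sup>2)" by (simp add: abs_mult)
  qed
qed (use X Y in \<open>auto simp: sq_integrable_def\<close>)

lemma sq_integrable_add:
  assumes X: "sq_integrable M X" and Y: "sq_integrable M Y"
  shows "sq_integrable M (\<lambda>\<omega>. X \<omega> + Y \<omega>)"
  using sq_integrable_mult[OF X Y] X Y
  by (auto simp: sq_integrable_def power2_sum mult.assoc)

lemma sq_integrable_scale: "sq_integrable M X \<Longrightarrow> sq_integrable M (\<lambda>\<omega>. c * X \<omega>)"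
  by (auto simp: sq_integrable_def power_mult_distrib)

lemma sq_integrable_diff:
  "sq_integrable M X \<Longrightarrow> sq_integrable M Y \<Longrightarrow> sq_integrable M (\<lambda>\<omega>. X \<omega> - Y \<omega>)"
  using sq_integrable_add[of M X "\<lambda>\<omega>. - 1 * Y \<omega>"] sq_integrable_scale[of M Y "-1"] by simp

lemma sq_integrable_divide: "sq_integrable M X \<Longrightarrow> sq_integrable M (\<lambda>\<omega>. X \<omega> / c)"
  using sq_integrable_scale[of M X "inverse c"] by (simp add: field_simps)

lemma sq_integrable_sum:
  "(\<And>i. i \<in> I \<Longrightarrow> sq_integrable M (X i)) \<Longrightarrow> sq_integrable M (\<lambda>\<omega>. \<Sum>i\<in>I. X i \<omega>)"
proof (induction I rule: infinite_finite_induct)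
  case (insert i I)
  then show ?case by (simp add: sq_integrable_add)
qed (auto simp: sq_integrable_def)

lemmas sq_integrable_intros = sq_integrable_add sq_integrable_diff sq_integrable_scale
  sq_integrable_divide sq_integrable_sum

lemma sq_integrable_cong_AE:
  assumes "sq_integrable M X" "AE \<omega> in M. X \<omega> = Y \<omega>" "Y \<in> borel_measurable M"
  shows "sq_integrable M Y"
proof -
  have "integrable M (\<lambda>\<omega>. (X \<omega>)\<^sup>2) \<longleftrightarrow> integrable M (\<lambda>\<omega>. (Y \<omega>)\<^sup>2)"
    using assms by (intro integrable_cong_AE) (auto simp: sq_integrable_def)
  then show ?thesis using assms by (simp add: sq_integrable_def)
qed

lemma integral_add_sq_le:
  assumes X: "sq_integrable M X" and Y: "sq_integrable M Y"
  shows "(\<integral>\<omega>. (X \<omega> + Y \<omega>)\<^sup>2 \<partial>M) \<le> 2 * (\<integral>\<omega>. (X \<omega>)\<^sup>2 \<partial>M) + 2 * (\<integral>\<omega>. (Y \<omega>)\<^sup>2 \<partial>M)"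
proof -
  have "(\<integral>\<omega>. (X \<omega> + Y \<omega>)\<^sup>2 \<partial>M) \<le> (\<integral>\<omega>. 2 * (X \<omega>)\<^sup>2 + 2 * (Y \<omega>)\<^sup>2 \<partial>M)"
  proof (rule integral_mono)
    show "integrable M (\<lambda>\<omega>. (X \<omega> + Y \<omega>)\<^sup>2)"
      using sq_integrable_add[OF X Y] by (rule sq_integrableD)
    show "(X \<omega> + Y \<omega>)\<^sup>2 \<le> 2 * (X \<omega>)\<^sup>2 + 2 * (Y \<omega>)\<^sup>2" for \<omega>
      using sum_squares_bound[of "X \<omega>" "Y \<omega>"] by (simp add: power2_sum)
  qed (use X Y in \<open>auto simp: sq_integrable_def\<close>)
  also have "\<dots> = 2 * (\<integral>\<omega>. (X \<omega>)\<^sup>2 \<partial>M) + 2 * (\<integral>\<omega>. (Y \<omega>)\<^sup>2 \<partial>M)"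
    using X Y by (simp add: sq_integrable_def)
  finally show ?thesis .
qed

lemma integral_diff_mult_diff:
  assumes W: "sq_integrable M A" "sq_integrable M A'" "sq_integrable M B" "sq_integrable M B'"
    and X: "AE \<omega> in M. X \<omega> = A \<omega> - A' \<omega>" "X \<in> borel_measurable M"
    and Y: "AE \<omega> in M. Y \<omega> = B \<omega> - B' \<omega>" "Y \<in> borel_measurable M"
  shows "(\<integral>\<omega>. X \<omega> * Y \<omega> \<partial>M) = (\<integral>\<omega>. A \<omega> * B \<omega> \<partial>M) - (\<integral>\<omega>. A \<omega> * B' \<omega> \<partial>M)
    - (\<integral>\<omega>. A' \<omega> * B \<omega> \<partial>M) + (\<integral>\<omega>. A' \<omega> * B' \<omega> \<partial>M)"
proof -
  note [measurable] = W[THEN sq_integrableD(1)] X(2) Y(2)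
  have "(\<integral>\<omega>. X \<omega> * Y \<omega> \<partial>M) = (\<integral>\<omega>. A \<omega> * B \<omega> - A \<omega> * B' \<omega> - A' \<omega> * B \<omega> + A' \<omega> * B' \<omega> \<partial>M)"
  proof (rule integral_cong_AE)
    show "AE \<omega> in M. X \<omega> * Y \<omega> = A \<omega> * B \<omega> - A \<omega> * B' \<omega> - A' \<omega> * B \<omega> + A' \<omega> * B' \<omega>"
      using X(1) Y(1) by eventually_elim (simp add: left_diff_distrib right_diff_distrib)
  qed measurable
  then show ?thesis using W by (simp add: sq_integrable_mult)
qed

text \<open>Nonnegativity of the second moment of \<open>a X + Y\<close>, used at its minimum in \<open>a\<close>.\<close>

lemma Cauchy_Schwarz_integral:
  assumes X: "sq_integrable M X" and Y: "sq_integrable M Y"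
  shows "(\<integral>\<omega>. X \<omega> * Y \<omega> \<partial>M)\<^sup>2 \<le> (\<integral>\<omega>. (X \<omega>)\<^sup>2 \<partial>M) * (\<integral>\<omega>. (Y \<omega>)\<^sup>2 \<partial>M)"
proof -
  define A B C where "A = (\<integral>\<omega>. (X \<omega>)\<^sup>2 \<partial>M)" and "B = (\<integral>\<omega>. X \<omega> * Y \<omega> \<partial>M)"
    and "C = (\<integral>\<omega>. (Y \<omega>)\<^sup>2 \<partial>M)"
  note int = sq_integrableD(2)[OF X] sq_integrableD(2)[OF Y] sq_integrable_mult[OF X Y]
  have "0 \<le> A" "0 \<le> C" unfolding A_def C_def by simp_all
  have quad: "0 \<le> a\<^sup>2 * A + 2 * a * B + C" for a
  proof -
    have "0 \<le> (\<integral>\<omega>. (a * X \<omega> + Y \<omega>)\<^sup>2 \<partial>M)" by simp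
    also have "\<dots> = (\<integral>\<omega>. a\<^sup>2 * (X \<omega>)\<^sup>2 + (2 * a) * (X \<omega> * Y \<omega>) + (Y \<omega>)\<^sup>2 \<partial>M)"
      by (simp add: power2_sum power_mult_distrib algebra_simps)
    also have "\<dots> = a\<^sup>2 * A + 2 * a * B + C"
      unfolding A_def B_def C_def using int by simp
    finally show ?thesis .
  qed
  have "B\<^sup>2 \<le> A * C"
  proof (cases "A = 0")
    case True
    have "AE \<omega> in M. X \<omega> = 0"
      using integral_nonneg_eq_0_iff_AE[OF int(1)] True by (simp add: A_def)
    then have "B = 0" unfolding B_def by (intro integral_eq_zero_AE) auto
    then show ?thesis using True by simp
  next
    case False
    with \<open>0 \<le> A\<close> have "0 < A" by simp
    have "(- B / A)\<^sup>2 * A + 2 * (- B / A) * B + C = C - B\<^sup>2 / A"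
      using \<open>0 < A\<close> by (simp add: field_simps power2_eq_square)
    with quad[of "- B / A"] have "B\<^sup>2 / A \<le> C" by linarith
    then show ?thesis using \<open>0 < A\<close> by (simp add: field_simps)
  qed
  then show ?thesis unfolding A_def B_def C_def .
qed

context prob_space
begin

lemma sq_integrable_integrable: "sq_integrable M X \<Longrightarrow> integrable M X"
  using sq_integrable_mult[of M X "\<lambda>_. 1"] by (simp add: sq_integrable_def)

lemma integral_abs_le_sqrt:
  assumes "sq_integrable M X"
  shows "(\<integral>\<omega>. \<bar>X \<omega>\<bar> \<partial>M) \<le> sqrt (\<integral>\<omega>. (X \<omega>)\<^sup>2 \<partial>M)"
proof (rule real_le_rsqrt)
  have "sq_integrable M (\<lambda>\<omega>. \<bar>X \<omega>\<bar>)" "sq_integrable M (\<lambda>_. 1)"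
    using assms by (auto simp: sq_integrable_def)
  from Cauchy_Schwarz_integral[OF this]
  show "(\<integral>\<omega>. \<bar>X \<omega>\<bar> \<partial>M)\<^sup>2 \<le> (\<integral>\<omega>. (X \<omega>)\<^sup>2 \<partial>M)" by (simp add: prob_space)
qed

text \<open>Completeness of the space of square-integrable random variables.  A Cauchy sequence in mean square is
  Cauchy in mean, so a subsequence converges almost surely; Fatou's lemma applied to that subsequence
  bounds the squared distance of the whole sequence to the limit.\<close>

lemma sq_integrable_complete:
  fixes X :: "nat \<Rightarrow> 'a \<Rightarrow> real"
  assumes X: "\<And>n. sq_integrable M (X n)"
    and Cauchy: "\<And>e. 0 < e \<Longrightarrow> \<exists>N. \<forall>m\<ge>N. \<forall>n\<ge>N. (\<integral>\<omega>. (X m \<omega> - X n \<omega>)\<^sup>2 \<partial>M) < e"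
  obtains Y where "sq_integrable M Y" "(\<lambda>n. \<integral>\<omega>. (X n \<omega> - Y \<omega>)\<^sup>2 \<partial>M) \<longlonglongrightarrow> 0"
proof -
  have [measurable]: "X n \<in> borel_measurable M" for n using X by (rule sq_integrableD)
  have "\<exists>N. \<forall>i\<ge>N. \<forall>j\<ge>N. (\<integral>\<omega>. norm (X i \<omega> - X j \<omega>) \<partial>M) < e" if "0 < e" for e
  proof -
    obtain N where N: "\<And>m n. N \<le> m \<Longrightarrow> N \<le> n \<Longrightarrow> (\<integral>\<omega>. (X m \<omega> - X n \<omega>)\<^sup>2 \<partial>M) < e\<^sup>2"
      using Cauchy[of "e\<^sup>2"] \<open>0 < e\<close> by auto
    have "(\<integral>\<omega>. norm (X i \<omega> - X j \<omega>) \<partial>M) < e" if "N \<le> i" "N \<le> j" for i j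
    proof -
      have "(\<integral>\<omega>. \<bar>X i \<omega> - X j \<omega>\<bar> \<partial>M) \<le> sqrt (\<integral>\<omega>. (X i \<omega> - X j \<omega>)\<^sup>2 \<partial>M)"
        by (intro integral_abs_le_sqrt sq_integrable_diff X)
      also have "\<dots> < sqrt (e\<^sup>2)" using N[OF that] by (rule real_sqrt_less_mono)
      finally show ?thesis using \<open>0 < e\<close> by simp
    qed
    then show ?thesis by blast
  qed
  then obtain r where r: "strict_mono r" "AE \<omega> in M. Cauchy (\<lambda>i. X (r i) \<omega>)"
    using cauchy_L1_AE_cauchy_subseq[of M X] sq_integrable_integrable[OF X] by blast
  define Y where "Y \<omega> = lim (\<lambda>i. X (r i) \<omega>)" for \<omega>
  have [measurable]: "Y \<in> borel_measurable M"
    unfolding Y_def[abs_def] by measurable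
  have lim: "AE \<omega> in M. (\<lambda>i. X (r i) \<omega>) \<longlonglongrightarrow> Y \<omega>"
    using r(2) by eventually_elim (simp add: Y_def real_Cauchy_convergent convergent_LIMSEQ_iff[symmetric])
  have bound: "(\<integral>\<^sup>+\<omega>. ennreal ((X n \<omega> - Y \<omega>)\<^sup>2) \<partial>M) \<le> ennreal e"
    if "\<And>m. N \<le> m \<Longrightarrow> (\<integral>\<omega>. (X n \<omega> - X m \<omega>)\<^sup>2 \<partial>M) < e" for n N e
  proof -
    have "(\<integral>\<^sup>+\<omega>. ennreal ((X n \<omega> - Y \<omega>)\<^sup>2) \<partial>M)
        = (\<integral>\<^sup>+\<omega>. liminf (\<lambda>i. ennreal ((X n \<omega> - X (r i) \<omega>)\<^sup>2)) \<partial>M)"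
    proof (rule nn_integral_cong_AE)
      show "AE \<omega> in M. ennreal ((X n \<omega> - Y \<omega>)\<^sup>2) = liminf (\<lambda>i. ennreal ((X n \<omega> - X (r i) \<omega>)\<^sup>2))"
        using lim
      proof eventually_elim
        case (elim \<omega>)
        have "(\<lambda>i. ennreal ((X n \<omega> - X (r i) \<omega>)\<^sup>2)) \<longlonglongrightarrow> ennreal ((X n \<omega> - Y \<omega>)\<^sup>2)"
          by (intro tendsto_intros elim)
        from lim_imp_Liminf[OF _ this] show ?case by simp
      qed
    qed
    also have "\<dots> \<le> liminf (\<lambda>i. \<integral>\<^sup>+\<omega>. ennreal ((X n \<omega> - X (r i) \<omega>)\<^sup>2) \<partial>M)"
      by (rule nn_integral_liminf) simp
    also have "\<dots> \<le> ennreal e"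
    proof (rule Liminf_le)
      show "\<forall>\<^sub>F i in sequentially. (\<integral>\<^sup>+\<omega>. ennreal ((X n \<omega> - X (r i) \<omega>)\<^sup>2) \<partial>M) \<le> ennreal e"
      proof (rule eventually_sequentiallyI[of N])
        fix i assume "N \<le> i"
        then have "N \<le> r i" using seq_suble[OF r(1), of i] by simp
        have "(\<integral>\<^sup>+\<omega>. ennreal ((X n \<omega> - X (r i) \<omega>)\<^sup>2) \<partial>M) = ennreal (\<integral>\<omega>. (X n \<omega> - X (r i) \<omega>)\<^sup>2 \<partial>M)"
          using sq_integrable_diff[OF X[of n] X[of "r i"]]
          by (intro nn_integral_eq_integral) (auto simp: sq_integrable_def)
        also have "\<dots> \<le> ennreal e" using that[OF \<open>N \<le> r i\<close>] by (intro ennreal_leI) simp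
        finally show "(\<integral>\<^sup>+\<omega>. ennreal ((X n \<omega> - X (r i) \<omega>)\<^sup>2) \<partial>M) \<le> ennreal e" .
      qed
    qed simp
    finally show ?thesis .
  qed
  obtain N where N: "\<And>m n. N \<le> m \<Longrightarrow> N \<le> n \<Longrightarrow> (\<integral>\<omega>. (X m \<omega> - X n \<omega>)\<^sup>2 \<partial>M) < 1"
    using Cauchy[of 1] by auto
  have "sq_integrable M (\<lambda>\<omega>. X N \<omega> - Y \<omega>)"
    unfolding sq_integrable_def
  proof (intro conjI integrableI_bounded)
    have "(\<integral>\<^sup>+\<omega>. ennreal ((X N \<omega> - Y \<omega>)\<^sup>2) \<partial>M) \<le> ennreal 1"
      by (rule bound) (use N in auto)
    then show "(\<integral>\<^sup>+\<omega>. ennreal (norm ((X N \<omega> - Y \<omega>)\<^sup>2)) \<partial>M) < \<infinity>"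
      using ennreal_less_top order_le_less_trans by fastforce
  qed measurable
  from sq_integrable_diff[OF X[of N] this] have Y: "sq_integrable M Y" by simp
  moreover have "(\<lambda>n. \<integral>\<omega>. (X n \<omega> - Y \<omega>)\<^sup>2 \<partial>M) \<longlonglongrightarrow> 0"
  proof (rule LIMSEQ_I)
    fix e :: real assume "0 < e"
    then obtain N where N: "\<And>m n. N \<le> m \<Longrightarrow> N \<le> n \<Longrightarrow> (\<integral>\<omega>. (X m \<omega> - X n \<omega>)\<^sup>2 \<partial>M) < e / 2"
      using Cauchy[of "e / 2"] by auto
    have "norm ((\<integral>\<omega>. (X n \<omega> - Y \<omega>)\<^sup>2 \<partial>M) - 0) < e" if "N \<le> n" for n
    proof -
      have "ennreal (\<integral>\<omega>. (X n \<omega> - Y \<omega>)\<^sup>2 \<partial>M) = (\<integral>\<^sup>+\<omega>. ennreal ((X n \<omega> - Y \<omega>)\<^sup>2) \<partial>M)"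
        using sq_integrable_diff[OF X[of n] Y]
        by (intro nn_integral_eq_integral[symmetric]) (auto simp: sq_integrable_def)
      also have "\<dots> \<le> ennreal (e / 2)" by (rule bound) (use N that in auto)
      finally have "(\<integral>\<omega>. (X n \<omega> - Y \<omega>)\<^sup>2 \<partial>M) \<le> e / 2" using \<open>0 < e\<close> by (simp add: ennreal_le_iff)
      then show ?thesis using \<open>0 < e\<close> by simp
    qed
    then show "\<exists>N. \<forall>n\<ge>N. norm ((\<integral>\<omega>. (X n \<omega> - Y \<omega>)\<^sup>2 \<partial>M) - 0) < e" by blast
  qed
  ultimately show ?thesis by (rule that)
qed

text \<open>The criterion of Loeve: a family has a mean-square limit as soon as its covariances converge, since
  the squared distance of two members is a combination of three covariances.\<close>

lemma mean_square_limit_exists: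
  fixes Z :: "real \<Rightarrow> 'a \<Rightarrow> real"
  assumes Z: "\<And>t. sq_integrable M (Z t)"
    and lim: "\<And>e. 0 < e \<Longrightarrow> \<exists>\<delta>>0. \<forall>s t. s \<noteq> 0 \<longrightarrow> t \<noteq> 0 \<longrightarrow> \<bar>s\<bar> < \<delta> \<longrightarrow> \<bar>t\<bar> < \<delta> \<longrightarrow>
      \<bar>(\<integral>\<omega>. Z s \<omega> * Z t \<omega> \<partial>M) - L\<bar> \<le> e"
  obtains Y where "sq_integrable M Y" "((\<lambda>t. \<integral>\<omega>. (Z t \<omega> - Y \<omega>)\<^sup>2 \<partial>M) \<longlongrightarrow> 0) (at 0)"
proof -
  have close: "\<exists>\<delta>>0. \<forall>s t. s \<noteq> 0 \<longrightarrow> t \<noteq> 0 \<longrightarrow> \<bar>s\<bar> < \<delta> \<longrightarrow> \<bar>t\<bar> < \<delta> \<longrightarrow>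
      (\<integral>\<omega>. (Z s \<omega> - Z t \<omega>)\<^sup>2 \<partial>M) < e" if "0 < e" for e
  proof -
    obtain \<delta> where \<delta>: "0 < \<delta>" "\<And>s t. s \<noteq> 0 \<Longrightarrow> t \<noteq> 0 \<Longrightarrow> \<bar>s\<bar> < \<delta> \<Longrightarrow> \<bar>t\<bar> < \<delta> \<Longrightarrow>
      \<bar>(\<integral>\<omega>. Z s \<omega> * Z t \<omega> \<partial>M) - L\<bar> \<le> e / 5"
      using lim[of "e / 5"] \<open>0 < e\<close> by auto
    \<comment> \<open>The squared distance combines covariances with weights \<open>1\<close>, \<open>-2\<close> and \<open>1\<close>, so it is at most \<open>4 e / 5\<close>.\<close>
    have "(\<integral>\<omega>. (Z s \<omega> - Z t \<omega>)\<^sup>2 \<partial>M) < e"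
      if "s \<noteq> 0" "t \<noteq> 0" "\<bar>s\<bar> < \<delta>" "\<bar>t\<bar> < \<delta>" for s t
    proof -
      have "(\<integral>\<omega>. (Z s \<omega> - Z t \<omega>)\<^sup>2 \<partial>M)
          = (\<integral>\<omega>. Z s \<omega> * Z s \<omega> - 2 * (Z s \<omega> * Z t \<omega>) + Z t \<omega> * Z t \<omega> \<partial>M)"
        by (simp add: power2_diff power2_eq_square algebra_simps)
      also have "\<dots> = (\<integral>\<omega>. Z s \<omega> * Z s \<omega> \<partial>M) - 2 * (\<integral>\<omega>. Z s \<omega> * Z t \<omega> \<partial>M) + (\<integral>\<omega>. Z t \<omega> * Z t \<omega> \<partial>M)"
        by (simp add: sq_integrable_mult[OF Z Z])
      finally show ?thesis
        using \<delta>(2)[of s s] \<delta>(2)[of s t] \<delta>(2)[of t t] that \<open>0 < e\<close> by linarith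
    qed
    with \<open>0 < \<delta>\<close> show ?thesis by blast
  qed
  define a where "a n = inverse (real (Suc n))" for n
  have a: "a \<longlonglongrightarrow> 0" "\<And>n. 0 < a n"
    unfolding a_def[abs_def] by (rule LIMSEQ_inverse_real_of_nat) simp
  have small: "\<exists>N. \<forall>n\<ge>N. \<bar>a n\<bar> < \<delta>" if "0 < \<delta>" for \<delta>
    using LIMSEQ_D[OF a(1) that] by simp
  obtain Y where Y: "sq_integrable M Y" "(\<lambda>n. \<integral>\<omega>. (Z (a n) \<omega> - Y \<omega>)\<^sup>2 \<partial>M) \<longlonglongrightarrow> 0"
  proof (rule sq_integrable_complete[of "\<lambda>n. Z (a n)"])
    fix e :: real assume "0 < e"
    then obtain \<delta> where \<delta>: "0 < \<delta>" "\<And>s t. s \<noteq> 0 \<Longrightarrow> t \<noteq> 0 \<Longrightarrow> \<bar>s\<bar> < \<delta> \<Longrightarrow> \<bar>t\<bar> < \<delta> \<Longrightarrow>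
      (\<integral>\<omega>. (Z s \<omega> - Z t \<omega>)\<^sup>2 \<partial>M) < e"
      using close by blast
    obtain N where N: "\<And>n. N \<le> n \<Longrightarrow> \<bar>a n\<bar> < \<delta>" using small[OF \<delta>(1)] by blast
    have "a n \<noteq> 0" for n using a(2)[of n] by simp
    with \<delta>(2) N show "\<exists>N. \<forall>m\<ge>N. \<forall>n\<ge>N. (\<integral>\<omega>. (Z (a m) \<omega> - Z (a n) \<omega>)\<^sup>2 \<partial>M) < e" by blast
  qed (use Z in auto)
  have "((\<lambda>t. \<integral>\<omega>. (Z t \<omega> - Y \<omega>)\<^sup>2 \<partial>M) \<longlongrightarrow> 0) (at 0)"
  proof (rule tendstoI)
    fix e :: real assume "0 < e"
    then obtain \<delta> where \<delta>: "0 < \<delta>" "\<And>s t. s \<noteq> 0 \<Longrightarrow> t \<noteq> 0 \<Longrightarrow> \<bar>s\<bar> < \<delta> \<Longrightarrow> \<bar>t\<bar> < \<delta> \<Longrightarrow>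
      (\<integral>\<omega>. (Z s \<omega> - Z t \<omega>)\<^sup>2 \<partial>M) < e / 4"
      using close[of "e / 4"] by auto
    obtain N where N: "\<And>n. N \<le> n \<Longrightarrow> \<bar>a n\<bar> < \<delta>" using small[OF \<delta>(1)] by blast
    obtain N' where N': "\<And>n. N' \<le> n \<Longrightarrow> (\<integral>\<omega>. (Z (a n) \<omega> - Y \<omega>)\<^sup>2 \<partial>M) < e / 4"
      using LIMSEQ_D[OF Y(2), of "e / 4"] \<open>0 < e\<close> by auto
    define n where "n = max N N'"
    have n: "\<bar>a n\<bar> < \<delta>" "(\<integral>\<omega>. (Z (a n) \<omega> - Y \<omega>)\<^sup>2 \<partial>M) < e / 4" "a n \<noteq> 0"
      using N[of n] N'[of n] a(2)[of n] by (auto simp: n_def)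
    show "\<forall>\<^sub>F t in at 0. dist (\<integral>\<omega>. (Z t \<omega> - Y \<omega>)\<^sup>2 \<partial>M) 0 < e"
      unfolding eventually_at
    proof (intro exI conjI ballI impI)
      fix t :: real assume t: "t \<noteq> 0 \<and> dist t 0 < \<delta>"
      have "(\<integral>\<omega>. (Z t \<omega> - Y \<omega>)\<^sup>2 \<partial>M) = (\<integral>\<omega>. ((Z t \<omega> - Z (a n) \<omega>) + (Z (a n) \<omega> - Y \<omega>))\<^sup>2 \<partial>M)"
        by simp
      also have "\<dots> \<le> 2 * (\<integral>\<omega>. (Z t \<omega> - Z (a n) \<omega>)\<^sup>2 \<partial>M) + 2 * (\<integral>\<omega>. (Z (a n) \<omega> - Y \<omega>)\<^sup>2 \<partial>M)"
        by (intro integral_add_sq_le sq_integrable_diff Z Y)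
      also have "\<dots> < e" using n \<delta>(2)[of t "a n"] t by simp
      finally show "dist (\<integral>\<omega>. (Z t \<omega> - Y \<omega>)\<^sup>2 \<partial>M) 0 < e" by simp
    qed (rule \<delta>)
  qed
  with Y(1) show ?thesis by (rule that)
qed

section \<open>Mean-square derivatives\<close>

lemma has_ms_deriv_ms_deriv:
  "has_ms_deriv M f v x Y \<Longrightarrow> has_ms_deriv M f v x (ms_deriv M f v x)"
  unfolding ms_deriv_def by (rule someI[where P = "has_ms_deriv M f v x"])

lemma has_ms_derivD:
  assumes "has_ms_deriv M f v x Y"
  shows "sq_integrable M Y" "sq_integrable M (f (x + t *\<^sub>R v))" "sq_integrable M (f x)"
    "((\<lambda>t. \<integral>\<omega>. ((f (x + t *\<^sub>R v) \<omega> - f x \<omega>) / t - Y \<omega>)\<^sup>2 \<partial>M) \<longlongrightarrow> 0) (at 0)"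
proof -
  have *: "\<forall>t. sq_integrable M (f (x + t *\<^sub>R v))" using assms by (simp add: has_ms_deriv_def)
  then show "sq_integrable M (f (x + t *\<^sub>R v))" by blast
  show "sq_integrable M (f x)" using *[THEN spec, of 0] by simp
qed (use assms in \<open>simp_all add: has_ms_deriv_def\<close>)

lemma has_ms_deriv_diff:
  assumes f: "has_ms_deriv M f v x Y" and g: "has_ms_deriv M g w y Z"
    and h: "\<And>t. h (x + t *\<^sub>R v) = (\<lambda>\<omega>. f (x + t *\<^sub>R v) \<omega> - g (y + t *\<^sub>R w) \<omega>)"
  shows "has_ms_deriv M h v x (\<lambda>\<omega>. Y \<omega> - Z \<omega>)"
  unfolding has_ms_deriv_def
proof (intro conjI allI)
  note f' = has_ms_derivD[OF f] and g' = has_ms_derivD[OF g]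
  show "sq_integrable M (\<lambda>\<omega>. Y \<omega> - Z \<omega>)" by (intro sq_integrable_intros f' g')
  show "sq_integrable M (h (x + t *\<^sub>R v))" for t
    unfolding h by (intro sq_integrable_intros f' g')
  have h0: "h x = (\<lambda>\<omega>. f x \<omega> - g y \<omega>)" using h[of 0] by simp
  define A where "A t \<omega> = (f (x + t *\<^sub>R v) \<omega> - f x \<omega>) / t - Y \<omega>" for t \<omega>
  define B where "B t \<omega> = -1 * ((g (y + t *\<^sub>R w) \<omega> - g y \<omega>) / t - Z \<omega>)" for t \<omega>
  have sq: "sq_integrable M (A t)" "sq_integrable M (B t)" for t
    unfolding A_def[abs_def] B_def[abs_def] by (intro sq_integrable_intros f' g')+
  have B2: "(B t \<omega>)\<^sup>2 = ((g (y + t *\<^sub>R w) \<omega> - g y \<omega>) / t - Z \<omega>)\<^sup>2" for t \<omega>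
    unfolding B_def power_mult_distrib by simp
  have eq: "(h (x + t *\<^sub>R v) \<omega> - h x \<omega>) / t - (Y \<omega> - Z \<omega>) = A t \<omega> + B t \<omega>" for t \<omega>
    by (simp add: h h0 A_def B_def diff_divide_distrib)
  show "((\<lambda>t. \<integral>\<omega>. ((h (x + t *\<^sub>R v) \<omega> - h x \<omega>) / t - (Y \<omega> - Z \<omega>))\<^sup>2 \<partial>M) \<longlongrightarrow> 0) (at 0)"
    unfolding eq
  proof (rule tendsto_sandwich[OF _ _ tendsto_const])
    have "((\<lambda>t. \<integral>\<omega>. (A t \<omega>)\<^sup>2 \<partial>M) \<longlongrightarrow> 0) (at 0)" using f'(4) by (simp add: A_def)
    moreover have "((\<lambda>t. \<integral>\<omega>. (B t \<omega>)\<^sup>2 \<partial>M) \<longlongrightarrow> 0) (at 0)" using g'(4) by (simp add: B2)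
    ultimately show "((\<lambda>t. 2 * (\<integral>\<omega>. (A t \<omega>)\<^sup>2 \<partial>M) + 2 * (\<integral>\<omega>. (B t \<omega>)\<^sup>2 \<partial>M)) \<longlongrightarrow> 0) (at 0)"
      by (auto intro!: tendsto_eq_intros)
    show "\<forall>\<^sub>F t in at 0. (\<integral>\<omega>. (A t \<omega> + B t \<omega>)\<^sup>2 \<partial>M) \<le> 2 * (\<integral>\<omega>. (A t \<omega>)\<^sup>2 \<partial>M) + 2 * (\<integral>\<omega>. (B t \<omega>)\<^sup>2 \<partial>M)"
      by (intro always_eventually allI integral_add_sq_le sq)
  qed simp
qed

text \<open>The difference of two derivatives is the derivative of the zero field, hence has second moment 0.\<close>

lemma has_ms_deriv_unique:
  assumes Y: "has_ms_deriv M f v x Y" and Z: "has_ms_deriv M f v x Z"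
  shows "AE \<omega> in M. Y \<omega> = Z \<omega>"
proof -
  have D: "has_ms_deriv M (\<lambda>_ _. 0) v x (\<lambda>\<omega>. Y \<omega> - Z \<omega>)"
    by (rule has_ms_deriv_diff[OF Y Z]) simp
  then have "((\<lambda>t::real. \<integral>\<omega>. (Y \<omega> - Z \<omega>)\<^sup>2 \<partial>M) \<longlongrightarrow> 0) (at 0)"
    using has_ms_derivD(4)[OF D] by (simp add: power2_commute)
  then have 0: "(\<integral>\<omega>. (Y \<omega> - Z \<omega>)\<^sup>2 \<partial>M) = 0"
    by (simp add: tendsto_const_iff)
  have "AE \<omega> in M. (Y \<omega> - Z \<omega>)\<^sup>2 = 0"
    using 0 integral_nonneg_eq_0_iff_AE[OF sq_integrableD(2)[OF has_ms_derivD(1)[OF D]]] by simp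
  then show ?thesis by eventually_elim simp
qed

text \<open>A mean-square derivative is chosen only up to null sets, and these null sets depend on the point.
  Differentiating it once more must therefore not depend on the version.\<close>

lemma has_ms_deriv_cong_AE:
  assumes f: "has_ms_deriv M f v x Y"
    and eq: "\<And>x. AE \<omega> in M. f x \<omega> = g x \<omega>" and g: "\<And>x. g x \<in> borel_measurable M"
  shows "has_ms_deriv M g v x Y"
  unfolding has_ms_deriv_def
proof (intro conjI allI)
  note f' = has_ms_derivD[OF f]
  have [measurable]: "f (x + t *\<^sub>R v) \<in> borel_measurable M" "f x \<in> borel_measurable M"
     "Y \<in> borel_measurable M" for t using f' by (auto dest: sq_integrableD)
  note [measurable] = g
  show "sq_integrable M Y" by fact
  show "sq_integrable M (g (x + t *\<^sub>R v))" for t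
    by (rule sq_integrable_cong_AE[OF f'(2) eq g])
  have "(\<integral>\<omega>. ((g (x + t *\<^sub>R v) \<omega> - g x \<omega>) / t - Y \<omega>)\<^sup>2 \<partial>M) =
      (\<integral>\<omega>. ((f (x + t *\<^sub>R v) \<omega> - f x \<omega>) / t - Y \<omega>)\<^sup>2 \<partial>M)" for t
  proof (rule integral_cong_AE)
    show "AE \<omega> in M. ((g (x + t *\<^sub>R v) \<omega> - g x \<omega>) / t - Y \<omega>)\<^sup>2
        = ((f (x + t *\<^sub>R v) \<omega> - f x \<omega>) / t - Y \<omega>)\<^sup>2"
      using eq[of "x + t *\<^sub>R v"] eq[of x] by eventually_elim simp
  qed measurable
  with f'(4) show "((\<lambda>t. \<integral>\<omega>. ((g (x + t *\<^sub>R v) \<omega> - g x \<omega>) / t - Y \<omega>)\<^sup>2 \<partial>M) \<longlongrightarrow> 0) (at 0)"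
    by simp
qed

text \<open>Covariance and differentiation commute: mean-square convergence implies convergence of the inner
  products with a fixed square-integrable \<open>W\<close>, by the Cauchy-Schwarz inequality.\<close>

lemma has_dir_deriv_ms_deriv:
  assumes v: "has_ms_deriv M v b x Y" and W: "sq_integrable M W"
  shows "has_dir_deriv (\<lambda>x. \<integral>\<omega>. v x \<omega> * W \<omega> \<partial>M) b x (\<integral>\<omega>. Y \<omega> * W \<omega> \<partial>M)"
proof -
  note v' = has_ms_derivD[OF v]
  define D where "D t \<omega> = (v (x + t *\<^sub>R b) \<omega> - v x \<omega>) / t - Y \<omega>" for t \<omega>
  have D: "sq_integrable M (D t)" for t
    unfolding D_def[abs_def] by (intro sq_integrable_intros v')
  have "((\<lambda>t. sqrt ((\<integral>\<omega>. (D t \<omega>)\<^sup>2 \<partial>M) * (\<integral>\<omega>. (W \<omega>)\<^sup>2 \<partial>M))) \<longlongrightarrow> 0) (at 0)"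
    using v'(4) by (auto intro!: tendsto_eq_intros simp: D_def)
  then have lim: "((\<lambda>t. \<integral>\<omega>. D t \<omega> * W \<omega> \<partial>M) \<longlongrightarrow> 0) (at 0)"
  proof (rule Lim_null_comparison[rotated])
    show "\<forall>\<^sub>F t in at 0. norm (\<integral>\<omega>. D t \<omega> * W \<omega> \<partial>M)
        \<le> sqrt ((\<integral>\<omega>. (D t \<omega>)\<^sup>2 \<partial>M) * (\<integral>\<omega>. (W \<omega>)\<^sup>2 \<partial>M))"
      by (intro always_eventually allI) (auto intro!: real_le_rsqrt Cauchy_Schwarz_integral D W)
  qed
  have eq: "(\<integral>\<omega>. D t \<omega> * W \<omega> \<partial>M) = ((\<integral>\<omega>. v (x + t *\<^sub>R b) \<omega> * W \<omega> \<partial>M)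
      - (\<integral>\<omega>. v x \<omega> * W \<omega> \<partial>M)) / t - (\<integral>\<omega>. Y \<omega> * W \<omega> \<partial>M)" for t
  proof -
    have "(\<integral>\<omega>. D t \<omega> * W \<omega> \<partial>M) = (\<integral>\<omega>. (v (x + t *\<^sub>R b) \<omega> * W \<omega> - v x \<omega> * W \<omega>) / t - Y \<omega> * W \<omega> \<partial>M)"
      by (simp add: D_def algebra_simps diff_divide_distrib)
    also have "\<dots> = ((\<integral>\<omega>. v (x + t *\<^sub>R b) \<omega> * W \<omega> \<partial>M)
      - (\<integral>\<omega>. v x \<omega> * W \<omega> \<partial>M)) / t - (\<integral>\<omega>. Y \<omega> * W \<omega> \<partial>M)"
      using v' W by (simp add: sq_integrable_mult)
    finally show ?thesis .
  qed
  show ?thesis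
    unfolding has_dir_deriv_def has_field_derivative_iff
    using lim[unfolded eq] by (simp add: LIM_zero_iff)
qed

section \<open>Derivatives of stationary fields\<close>

text \<open>The covariance of two difference quotients of a stationary field is a mixed second difference of
  \<open>\<rho>\<close> with sides \<open>s b\<close> and \<open>- t b\<close>, divided by \<open>s t\<close>.  It converges by the bound on mixed differences,
  and the criterion of Loeve applies.\<close>

lemma stationary_ms_differentiable:
  fixes v :: "'b::euclidean_space \<Rightarrow> 'a \<Rightarrow> real"
  assumes v: "\<And>x. sq_integrable M (v x)"
    and cov: "\<And>x y. (\<integral>\<omega>. v x \<omega> * v y \<omega> \<partial>M) = \<rho> (x - y)"
    and C: "C_n 2 \<rho>" and b: "b \<in> Basis"
  shows "has_ms_deriv M v b x (ms_deriv M v b x)"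
proof -
  have C2: "C_n (Suc (Suc 0)) \<rho>" using C by (simp add: eval_nat_numeral)
  note C1 = C_n_partial[OF C2 b]
  note C0 = C_n_partial[OF C1 b]
  define Z where "Z t \<omega> = (v (x + t *\<^sub>R b) \<omega> - v x \<omega>) / t" for t \<omega>
  have Z: "sq_integrable M (Z t)" for t
    unfolding Z_def[abs_def] by (intro sq_integrable_intros v)
  have cont: "isCont (\<lambda>w. - partial (partial \<rho> b) b w) 0"
    using C_n_continuous[OF C0] by (simp add: continuous_on_eq_continuous_at)
  have ZZ: "(\<integral>\<omega>. Z s \<omega> * Z t \<omega> \<partial>M) =
      (\<rho> (0 + s *\<^sub>R b + t *\<^sub>R (- b)) - \<rho> (0 + s *\<^sub>R b) - \<rho> (0 + t *\<^sub>R (- b)) + \<rho> 0) / (s * t)" for s t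
  proof -
    have "(\<integral>\<omega>. Z s \<omega> * Z t \<omega> \<partial>M) = (\<integral>\<omega>. (v (x + s *\<^sub>R b) \<omega> * v (x + t *\<^sub>R b) \<omega>
      - v (x + s *\<^sub>R b) \<omega> * v x \<omega> - v x \<omega> * v (x + t *\<^sub>R b) \<omega> + v x \<omega> * v x \<omega>) / (s * t) \<partial>M)"
      by (simp add: Z_def algebra_simps)
    also have "\<dots> = (\<rho> ((x + s *\<^sub>R b) - (x + t *\<^sub>R b)) - \<rho> ((x + s *\<^sub>R b) - x)
       - \<rho> (x - (x + t *\<^sub>R b)) + \<rho> (x - x)) / (s * t)"
      by (simp add: sq_integrable_mult[OF v v] cov)
    finally show ?thesis by (simp add: algebra_simps)
  qed
  obtain Y where "sq_integrable M Y" "((\<lambda>t. \<integral>\<omega>. (Z t \<omega> - Y \<omega>)\<^sup>2 \<partial>M) \<longlongrightarrow> 0) (at 0)"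
  proof (rule mean_square_limit_exists[of Z])
    fix e :: real assume "0 < e"
    from mixed_difference_bound[OF C_n_has_dir_deriv[OF C2, of b]
        has_dir_deriv_uminus_dir[OF C_n_has_dir_deriv[OF C1, of b]] cont \<open>0 < e\<close>]
    obtain \<delta> where \<delta>: "0 < \<delta>" "\<And>s t. \<bar>s\<bar> < \<delta> \<Longrightarrow> \<bar>t\<bar> < \<delta> \<Longrightarrow>
      \<bar>\<rho> (0 + s *\<^sub>R b + t *\<^sub>R (- b)) - \<rho> (0 + s *\<^sub>R b) - \<rho> (0 + t *\<^sub>R (- b)) + \<rho> 0
         - s * t * (- partial (partial \<rho> b) b 0)\<bar> \<le> e * \<bar>s * t\<bar>" by blast
    show "\<exists>\<delta>>0. \<forall>s t. s \<noteq> 0 \<longrightarrow> t \<noteq> 0 \<longrightarrow> \<bar>s\<bar> < \<delta> \<longrightarrow> \<bar>t\<bar> < \<delta> \<longrightarrow>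
      \<bar>(\<integral>\<omega>. Z s \<omega> * Z t \<omega> \<partial>M) - (- partial (partial \<rho> b) b 0)\<bar> \<le> e"
    proof (intro exI[of _ \<delta>] conjI allI impI \<delta>(1))
      fix s t :: real
      assume st: "s \<noteq> 0" "t \<noteq> 0" and small: "\<bar>s\<bar> < \<delta>" "\<bar>t\<bar> < \<delta>"
      define N where "N = \<rho> (0 + s *\<^sub>R b + t *\<^sub>R (- b)) - \<rho> (0 + s *\<^sub>R b) - \<rho> (0 + t *\<^sub>R (- b)) + \<rho> 0"
      have "(\<integral>\<omega>. Z s \<omega> * Z t \<omega> \<partial>M) - (- partial (partial \<rho> b) b 0)
          = (N - s * t * (- partial (partial \<rho> b) b 0)) / (s * t)"
        unfolding ZZ N_def[symmetric] using st by (simp add: field_simps)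
      also have "\<bar>\<dots>\<bar> = \<bar>N - s * t * (- partial (partial \<rho> b) b 0)\<bar> / \<bar>s * t\<bar>"
        by (simp only: abs_divide)
      also have "\<dots> \<le> e"
        using \<delta>(2)[OF small, folded N_def] st by (simp add: divide_le_eq)
      finally show "\<bar>(\<integral>\<omega>. Z s \<omega> * Z t \<omega> \<partial>M) - (- partial (partial \<rho> b) b 0)\<bar> \<le> e" .
    qed
  qed (rule Z)
  then have "has_ms_deriv M v b x Y"
    using v by (simp add: has_ms_deriv_def Z_def)
  then show ?thesis by (rule has_ms_deriv_ms_deriv)
qed

text \<open>The first derivative of a stationary field is again stationary, with a covariance that has two
  derivatives fewer, so the previous lemma can be applied to it.  The covariances follow by moving one
  derivative at a time out of the expectation and using that directional derivatives are unique.\<close>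

lemma stationary_derivatives:
  fixes u :: "'b::euclidean_space \<Rightarrow> 'a \<Rightarrow> real"
  assumes u: "\<And>x. sq_integrable M (u x)"
    and cov: "\<And>x y. (\<integral>\<omega>. u x \<omega> * u y \<omega> \<partial>M) = \<phi> (x - y)"
    and C: "C_n 4 \<phi>"
    and basis: "a \<in> Basis" "b \<in> Basis"
  shows "has_ms_deriv M u b x (ms_deriv M u b x)"
    and "has_ms_deriv M (ms_deriv M u b) a x (ms_deriv M (ms_deriv M u b) a x)"
    and "(\<integral>\<omega>. ms_deriv M u a x \<omega> * ms_deriv M u b y \<omega> \<partial>M) = - partial (partial \<phi> a) b (x - y)"
    and "c \<in> Basis \<Longrightarrow> d \<in> Basis \<Longrightarrow>
      (\<integral>\<omega>. ms_deriv M (ms_deriv M u b) a x \<omega> * ms_deriv M (ms_deriv M u d) c y \<omega> \<partial>M) =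
        partial (partial (partial (partial \<phi> b) a) d) c (x - y)"
proof -
  have C4: "C_n (Suc (Suc (Suc (Suc 0)))) \<phi>" using C by (simp add: eval_nat_numeral)
  have D1: "has_ms_deriv M u b x (ms_deriv M u b x)" if "b \<in> Basis" for b x
    by (rule stationary_ms_differentiable[OF u cov C_n_le[OF _ C] that]) simp
  have sq1: "sq_integrable M (ms_deriv M u b x)" if "b \<in> Basis" for b x
    using D1[OF that] by (rule has_ms_derivD)
  have cov1: "(\<integral>\<omega>. ms_deriv M u b x \<omega> * u y \<omega> \<partial>M) = partial \<phi> b (x - y)" if "b \<in> Basis" for b x y
  proof (rule has_dir_deriv_unique)
    show "has_dir_deriv (\<lambda>x. \<integral>\<omega>. u x \<omega> * u y \<omega> \<partial>M) b x (\<integral>\<omega>. ms_deriv M u b x \<omega> * u y \<omega> \<partial>M)"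
      by (rule has_dir_deriv_ms_deriv[OF D1[OF that] u])
    show "has_dir_deriv (\<lambda>x. \<integral>\<omega>. u x \<omega> * u y \<omega> \<partial>M) b x (partial \<phi> b (x - y))"
      unfolding cov by (rule has_dir_deriv_translate[OF C_n_has_dir_deriv[OF C4]])
  qed
  have cov11: "(\<integral>\<omega>. ms_deriv M u a x \<omega> * ms_deriv M u b y \<omega> \<partial>M) = - partial (partial \<phi> a) b (x - y)"
    if "a \<in> Basis" "b \<in> Basis" for a b x y
  proof (rule has_dir_deriv_unique)
    show "has_dir_deriv (\<lambda>y. \<integral>\<omega>. u y \<omega> * ms_deriv M u a x \<omega> \<partial>M) b y
        (\<integral>\<omega>. ms_deriv M u a x \<omega> * ms_deriv M u b y \<omega> \<partial>M)"
      using has_dir_deriv_ms_deriv[OF D1[OF that(2)] sq1[OF that(1), of x]] by (simp add: mult.commute)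
    show "has_dir_deriv (\<lambda>y. \<integral>\<omega>. u y \<omega> * ms_deriv M u a x \<omega> \<partial>M) b y (- partial (partial \<phi> a) b (x - y))"
      using has_dir_deriv_reflect[OF C_n_has_dir_deriv[OF C_n_partial[OF C4 that(1)], of b "x - y"]]
      by (simp add: mult.commute[of "u _ _"] cov1[OF that(1)])
  qed
  have D2: "has_ms_deriv M (ms_deriv M u b) a x (ms_deriv M (ms_deriv M u b) a x)"
    if "a \<in> Basis" "b \<in> Basis" for a b x
  proof (rule stationary_ms_differentiable[where v = "ms_deriv M u b"
        and \<rho> = "\<lambda>w. - partial (partial \<phi> b) b w"])
    have "C_n (Suc (Suc 0)) (partial (partial \<phi> b) b)"
      by (intro C_n_partial C4 that)
    then show "C_n 2 (\<lambda>x. - partial (partial \<phi> b) b x)"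
      by (simp add: C_n_uminus eval_nat_numeral)
  qed (use that sq1 cov11 in auto)
  have sq2: "sq_integrable M (ms_deriv M (ms_deriv M u b) a x)" if "a \<in> Basis" "b \<in> Basis" for a b x
    using D2[OF that] by (rule has_ms_derivD)
  have cov2: "(\<integral>\<omega>. ms_deriv M (ms_deriv M u b) a x \<omega> * u y \<omega> \<partial>M) = partial (partial \<phi> b) a (x - y)"
    if "a \<in> Basis" "b \<in> Basis" for a b x y
  proof (rule has_dir_deriv_unique)
    show "has_dir_deriv (\<lambda>x. \<integral>\<omega>. ms_deriv M u b x \<omega> * u y \<omega> \<partial>M) a x
        (\<integral>\<omega>. ms_deriv M (ms_deriv M u b) a x \<omega> * u y \<omega> \<partial>M)"
      by (rule has_dir_deriv_ms_deriv[OF D2[OF that] u])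
    show "has_dir_deriv (\<lambda>x. \<integral>\<omega>. ms_deriv M u b x \<omega> * u y \<omega> \<partial>M) a x (partial (partial \<phi> b) a (x - y))"
      unfolding cov1[OF that(2)]
      by (rule has_dir_deriv_translate[OF C_n_has_dir_deriv[OF C_n_partial[OF C4 that(2)]]])
  qed
  have cov21: "(\<integral>\<omega>. ms_deriv M u d y \<omega> * ms_deriv M (ms_deriv M u b) a x \<omega> \<partial>M)
      = - partial (partial (partial \<phi> b) a) d (x - y)"
    if "a \<in> Basis" "b \<in> Basis" "d \<in> Basis" for a b d x y
  proof (rule has_dir_deriv_unique)
    show "has_dir_deriv (\<lambda>y. \<integral>\<omega>. u y \<omega> * ms_deriv M (ms_deriv M u b) a x \<omega> \<partial>M) d y
        (\<integral>\<omega>. ms_deriv M u d y \<omega> * ms_deriv M (ms_deriv M u b) a x \<omega> \<partial>M)"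
      by (rule has_dir_deriv_ms_deriv[OF D1[OF that(3)] sq2[OF that(1,2)]])
    show "has_dir_deriv (\<lambda>y. \<integral>\<omega>. u y \<omega> * ms_deriv M (ms_deriv M u b) a x \<omega> \<partial>M) d y
        (- partial (partial (partial \<phi> b) a) d (x - y))"
      using has_dir_deriv_reflect[OF C_n_has_dir_deriv[OF C_n_partial[OF C_n_partial[OF C4 that(2)] that(1)], of d "x - y"]]
      by (simp add: mult.commute[of "u _ _"] cov2[OF that(1,2)])
  qed
  have cov22: "(\<integral>\<omega>. ms_deriv M (ms_deriv M u b) a x \<omega> * ms_deriv M (ms_deriv M u d) c y \<omega> \<partial>M) =
        partial (partial (partial (partial \<phi> b) a) d) c (x - y)"
    if "a \<in> Basis" "b \<in> Basis" "c \<in> Basis" "d \<in> Basis" for a b c d x y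
  proof (rule has_dir_deriv_unique)
    show "has_dir_deriv (\<lambda>y. \<integral>\<omega>. ms_deriv M u d y \<omega> * ms_deriv M (ms_deriv M u b) a x \<omega> \<partial>M) c y
        (\<integral>\<omega>. ms_deriv M (ms_deriv M u b) a x \<omega> * ms_deriv M (ms_deriv M u d) c y \<omega> \<partial>M)"
      using has_dir_deriv_ms_deriv[OF D2[OF that(3,4)] sq2[OF that(1,2)]]
      by (simp add: mult.commute)
    have "C_n (Suc 0) (partial (partial (partial \<phi> b) a) d)"
      by (intro C_n_partial C4 that)
    from has_dir_deriv_reflect[OF C_n_has_dir_deriv[OF this, of c "x - y"]]
    show "has_dir_deriv (\<lambda>y. \<integral>\<omega>. ms_deriv M u d y \<omega> * ms_deriv M (ms_deriv M u b) a x \<omega> \<partial>M) c y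
        (partial (partial (partial (partial \<phi> b) a) d) c (x - y))"
      unfolding cov21[OF that(1,2,4)] has_dir_deriv_def by (auto dest: DERIV_minus)
  qed
  show "has_ms_deriv M u b x (ms_deriv M u b x)"
    and "has_ms_deriv M (ms_deriv M u b) a x (ms_deriv M (ms_deriv M u b) a x)"
    and "(\<integral>\<omega>. ms_deriv M u a x \<omega> * ms_deriv M u b y \<omega> \<partial>M) = - partial (partial \<phi> a) b (x - y)"
    and "c \<in> Basis \<Longrightarrow> d \<in> Basis \<Longrightarrow>
      (\<integral>\<omega>. ms_deriv M (ms_deriv M u b) a x \<omega> * ms_deriv M (ms_deriv M u d) c y \<omega> \<partial>M) =
        partial (partial (partial (partial \<phi> b) a) d) c (x - y)"
    using D1 D2 cov11 cov22 basis by blast+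
qed

end

section \<open>Characteristic functions determine laws in Euclidean space\<close>

text \<open>Uniqueness of characteristic functions on the line, for the laws of \<open>X\<close> and \<open>Y\<close> under weights: a
  nonnegative weight of positive total mass becomes a change of measure after normalisation.\<close>

lemma expectation_indicator_eq_of_char_eq:
  fixes X :: "'p \<Rightarrow> real" and Y :: "'q \<Rightarrow> real"
  assumes [measurable]: "X \<in> borel_measurable P" "Y \<in> borel_measurable Q"
    and v: "integrable P v" "\<And>\<omega>. 0 \<le> v \<omega>" and w: "integrable Q w" "\<And>\<omega>. 0 \<le> w \<omega>"
    and eq: "\<And>s. (\<integral>\<omega>. v \<omega> *\<^sub>R iexp (s * X \<omega>) \<partial>P) = (\<integral>\<omega>. w \<omega> *\<^sub>R iexp (s * Y \<omega>) \<partial>Q)"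
    and [measurable]: "A \<in> sets borel"
  shows "(\<integral>\<omega>. v \<omega> * indicator A (X \<omega>) \<partial>P) = (\<integral>\<omega>. w \<omega> * indicator A (Y \<omega>) \<partial>Q)"
proof -
  define c where "c = (\<integral>\<omega>. v \<omega> \<partial>P)"
  have "complex_of_real c = complex_of_real (\<integral>\<omega>. w \<omega> \<partial>Q)"
    using eq[of 0] unfolding c_def by (simp add: scaleR_conv_of_real)
  then have c: "c = (\<integral>\<omega>. w \<omega> \<partial>Q)" by (simp only: of_real_eq_iff)
  have "0 \<le> c" unfolding c_def using v by simp
  show ?thesis
  proof (cases "c = 0")
    case True
    have "AE \<omega> in P. v \<omega> = 0"
      using True v integral_nonneg_eq_0_iff_AE[OF v(1)] by (simp add: c_def)
    moreover have "AE \<omega> in Q. w \<omega> = 0"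
      using True w integral_nonneg_eq_0_iff_AE[OF w(1)] by (simp add: c)
    ultimately have "(\<integral>\<omega>. v \<omega> * indicator A (X \<omega>) \<partial>P) = 0" "(\<integral>\<omega>. w \<omega> * indicator A (Y \<omega>) \<partial>Q) = 0"
      by (auto intro!: integral_eq_zero_AE)
    then show ?thesis by simp
  next
    case False
    with \<open>0 \<le> c\<close> have "0 < c" by simp
    have tilt: "real_distribution (distr (density R (\<lambda>\<omega>. ennreal (f \<omega> / c))) borel Z) \<and>
       char (distr (density R (\<lambda>\<omega>. ennreal (f \<omega> / c))) borel Z) s = (\<integral>\<omega>. f \<omega> *\<^sub>R iexp (s * Z \<omega>) \<partial>R) / c \<and>
       measure (distr (density R (\<lambda>\<omega>. ennreal (f \<omega> / c))) borel Z) A = (\<integral>\<omega>. f \<omega> * indicator A (Z \<omega>) \<partial>R) / c"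
      if [measurable]: "Z \<in> borel_measurable R" and f: "integrable R f" "\<And>\<omega>. 0 \<le> f \<omega>" "(\<integral>\<omega>. f \<omega> \<partial>R) = c"
      for R :: "'r measure" and f Z s
    proof -
      let ?D = "density R (\<lambda>\<omega>. ennreal (f \<omega> / c))"
      have [measurable]: "f \<in> borel_measurable R" using f by auto
      have "emeasure ?D (space ?D) = (\<integral>\<^sup>+\<omega>. ennreal (f \<omega> / c) \<partial>R)"
        by (subst emeasure_density) (auto intro!: nn_integral_cong)
      also have "\<dots> = ennreal (\<integral>\<omega>. f \<omega> / c \<partial>R)"
        using f \<open>0 < c\<close> by (intro nn_integral_eq_integral) auto
      also have "\<dots> = 1" using f \<open>0 < c\<close> by simp
      finally have D: "prob_space ?D" by (rule prob_spaceI)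
      have 1: "real_distribution (distr ?D borel Z)"
        by (intro prob_space.real_distribution_distr[OF D]) simp
      then interpret D: real_distribution "distr ?D borel Z" .
      have "char (distr ?D borel Z) s = (\<integral>\<omega>. (f \<omega> / c) *\<^sub>R iexp (s * Z \<omega>) \<partial>R)"
        unfolding char_def using f \<open>0 < c\<close>
        by (subst integral_distr, simp, simp, subst integral_density) auto
      also have "\<dots> = (\<integral>\<omega>. (f \<omega> *\<^sub>R iexp (s * Z \<omega>)) / c \<partial>R)"
        by (simp add: scaleR_conv_of_real)
      finally have 2: "char (distr ?D borel Z) s = (\<integral>\<omega>. f \<omega> *\<^sub>R iexp (s * Z \<omega>) \<partial>R) / c"
        by simp
      have "measure (distr ?D borel Z) A = (\<integral>x. indicator A x \<partial>distr ?D borel Z)"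
        by simp
      also have "\<dots> = (\<integral>\<omega>. (f \<omega> / c) *\<^sub>R indicator A (Z \<omega>) \<partial>R)"
        using f \<open>0 < c\<close> by (subst integral_distr, simp, simp, subst integral_density) auto
      finally have 3: "measure (distr ?D borel Z) A = (\<integral>\<omega>. f \<omega> * indicator A (Z \<omega>) \<partial>R) / c"
        by simp
      show ?thesis using 1 2 3 by blast
    qed
    note tP = tilt[OF assms(1) v c_def[symmetric]] and tQ = tilt[OF assms(2) w c[symmetric]]
    have "distr (density P (\<lambda>\<omega>. ennreal (v \<omega> / c))) borel X = distr (density Q (\<lambda>\<omega>. ennreal (w \<omega> / c))) borel Y"
      using tP tQ eq by (intro Levy_uniqueness) auto
    with tP[of 0] tQ[of 0] \<open>0 < c\<close> show ?thesis by auto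
  qed
qed

lemma iexp_decompose: "iexp x = complex_of_real (cos x) + \<i> * complex_of_real (cos (x - pi / 2))"
  unfolding cis_conv_exp[symmetric] by (simp add: complex_eq_iff cos_diff)

text \<open>The weight \<open>1 + cos (y - \<theta>)\<close> is nonnegative, which the complex exponential is not, and it is a
  combination of exponentials in \<open>y\<close>.  The phases \<open>\<theta> = 0\<close> and \<open>\<theta> = \<pi> / 2\<close> recover the exponential.\<close>

lemma weighted_cos_iexp:
  "(m * (1 + cos (y - \<theta>))) *\<^sub>R iexp z =
    m *\<^sub>R iexp z + (iexp (- \<theta>) / 2) * (m *\<^sub>R iexp (z + y)) + (iexp \<theta> / 2) * (m *\<^sub>R iexp (z - y))"
  unfolding cis_conv_exp[symmetric]
  by (simp add: complex_eq_iff cos_diff cos_add sin_add sin_diff field_simps)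

text \<open>Uniqueness in several dimensions is reduced to the line by exchanging, coordinate by coordinate,
  exponentials for indicators.  The induction over the set \<open>J\<close> of treated coordinates shows that
  \<open>\<Prod>\<^sub>b\<^sub>\<in>\<^sub>J 1 (x \<bullet> b \<in> A b) exp (i t \<bullet> x)\<close> has the same expectation under both laws for all \<open>t\<close>.  To treat a
  further coordinate \<open>k\<close>, the product of the indicators and \<open>1 + cos (t \<bullet> x - \<theta>)\<close> serves as a weight for
  the law of the \<open>k\<close>-th coordinate.\<close>

theorem distr_eq_of_char_eq:
  fixes X :: "'p \<Rightarrow> 'a::euclidean_space" and Y :: "'q \<Rightarrow> 'a"
  assumes P: "prob_space P" and Q: "prob_space Q"
    and X[measurable]: "X \<in> borel_measurable P" and Y[measurable]: "Y \<in> borel_measurable Q"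
    and eq: "\<And>t. (\<integral>\<omega>. iexp (t \<bullet> X \<omega>) \<partial>P) = (\<integral>\<omega>. iexp (t \<bullet> Y \<omega>) \<partial>Q)"
  shows "distr P borel X = distr Q borel Y"
proof -
  interpret P: prob_space P by (rule P)
  interpret Q: prob_space Q by (rule Q)
  define m where "m A J x = (\<Prod>b\<in>J. indicator (A b) (x \<bullet> b) :: real)" for A J and x :: 'a
  have m01: "0 \<le> m A J x" "m A J x \<le> 1" for A J x
    unfolding m_def by (auto intro!: prod_nonneg prod_le_1 simp: indicator_def)
  have m_meas[measurable]: "m A J \<in> borel_measurable borel" if "\<And>b. A b \<in> sets borel" for A J
    using that unfolding m_def by measurable
  have int: "integrable R (\<lambda>\<omega>. m A J (Z \<omega>) *\<^sub>R iexp (t \<bullet> Z \<omega>))"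
      "integrable R (\<lambda>\<omega>. m A J (Z \<omega>) * (1 + cos (t \<bullet> Z \<omega> - \<theta>)))"
      "integrable R (\<lambda>\<omega>. m A J (Z \<omega>) * cos (t \<bullet> Z \<omega> - \<theta>))"
      "integrable R (\<lambda>\<omega>. m A J (Z \<omega>))"
    if "prob_space R" and [measurable]: "Z \<in> borel_measurable R" "\<And>b. A b \<in> sets borel"
    for R :: "'r measure" and Z A J t \<theta>
  proof -
    interpret R: prob_space R by fact
    have [measurable]: "m A J \<in> borel_measurable borel" by (intro m_meas that)
    have a: "norm (m A J (Z \<omega>) *\<^sub>R iexp (t \<bullet> Z \<omega>)) \<le> 2"
       "norm (m A J (Z \<omega>) * (1 + cos (t \<bullet> Z \<omega> - \<theta>))) \<le> 2"
       "norm (m A J (Z \<omega>) * cos (t \<bullet> Z \<omega> - \<theta>)) \<le> 2"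
       "norm (m A J (Z \<omega>)) \<le> 2" for \<omega>
    proof -
      have *: "\<bar>1 + cos (t \<bullet> Z \<omega> - \<theta>)\<bar> \<le> 2" "\<bar>cos (t \<bullet> Z \<omega> - \<theta>)\<bar> \<le> 2"
        using abs_cos_le_one[of "t \<bullet> Z \<omega> - \<theta>"] by linarith+
      have "m A J (Z \<omega>) * B \<le> 1 * 2" if "0 \<le> B" "B \<le> 2" for B
        using m01[of A J "Z \<omega>"] that by (intro mult_mono) auto
      with * m01[of A J "Z \<omega>"]
      show "norm (m A J (Z \<omega>) *\<^sub>R iexp (t \<bullet> Z \<omega>)) \<le> 2"
       "norm (m A J (Z \<omega>) * (1 + cos (t \<bullet> Z \<omega> - \<theta>))) \<le> 2"
       "norm (m A J (Z \<omega>) * cos (t \<bullet> Z \<omega> - \<theta>)) \<le> 2"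
       "norm (m A J (Z \<omega>)) \<le> 2"
        by (auto simp: abs_mult)
    qed
    show "integrable R (\<lambda>\<omega>. m A J (Z \<omega>) *\<^sub>R iexp (t \<bullet> Z \<omega>))"
      by (rule R.integrable_const_bound[where B = 2]) (use a in auto)
    show "integrable R (\<lambda>\<omega>. m A J (Z \<omega>) * (1 + cos (t \<bullet> Z \<omega> - \<theta>)))"
      by (rule R.integrable_const_bound[where B = 2]) (use a in auto)
    show "integrable R (\<lambda>\<omega>. m A J (Z \<omega>) * cos (t \<bullet> Z \<omega> - \<theta>))"
      by (rule R.integrable_const_bound[where B = 2]) (use a in auto)
    show "integrable R (\<lambda>\<omega>. m A J (Z \<omega>))"
      by (rule R.integrable_const_bound[where B = 2]) (use a in auto)
  qed
  note intP = int[OF P X] and intQ = int[OF Q Y]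
  have claim: "(\<integral>\<omega>. m A J (X \<omega>) *\<^sub>R iexp (t \<bullet> X \<omega>) \<partial>P) = (\<integral>\<omega>. m A J (Y \<omega>) *\<^sub>R iexp (t \<bullet> Y \<omega>) \<partial>Q)"
    if "finite J" and A: "\<And>b. A b \<in> sets borel" for J A t
    using \<open>finite J\<close>
  proof (induction J arbitrary: t)
    case empty
    then show ?case using eq by (simp add: m_def)
  next
    case (insert k J)
    have m_insert: "m A (insert k J) x = m A J x * indicator (A k) (x \<bullet> k)" for x
      using insert.hyps by (simp add: m_def)
    \<comment> \<open>The induction hypothesis, at \<open>s k\<close> and \<open>s k \<plusminus> t\<close>, gives equal characteristic functions under the weight.\<close>
    have shifted: "(\<integral>\<omega>. m A J (X \<omega>) * (1 + cos (t \<bullet> X \<omega> - \<theta>)) * indicator (A k) (X \<omega> \<bullet> k) \<partial>P)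
        = (\<integral>\<omega>. m A J (Y \<omega>) * (1 + cos (t \<bullet> Y \<omega> - \<theta>)) * indicator (A k) (Y \<omega> \<bullet> k) \<partial>Q)" for t \<theta>
    proof (rule expectation_indicator_eq_of_char_eq)
      fix s
      have expand: "(\<integral>\<omega>. (m A J (Z \<omega>) * (1 + cos (t \<bullet> Z \<omega> - \<theta>))) *\<^sub>R iexp (s * (Z \<omega> \<bullet> k)) \<partial>R)
        = (\<integral>\<omega>. m A J (Z \<omega>) *\<^sub>R iexp ((s *\<^sub>R k) \<bullet> Z \<omega>) \<partial>R)
         + (iexp (- \<theta>) / 2) * (\<integral>\<omega>. m A J (Z \<omega>) *\<^sub>R iexp ((s *\<^sub>R k + t) \<bullet> Z \<omega>) \<partial>R)
         + (iexp \<theta> / 2) * (\<integral>\<omega>. m A J (Z \<omega>) *\<^sub>R iexp ((s *\<^sub>R k - t) \<bullet> Z \<omega>) \<partial>R)"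
        if R: "prob_space R" "Z \<in> borel_measurable R" for R :: "'r measure" and Z
      proof -
        note i = int(1)[OF R A]
        have "(\<integral>\<omega>. (m A J (Z \<omega>) * (1 + cos (t \<bullet> Z \<omega> - \<theta>))) *\<^sub>R iexp (s * (Z \<omega> \<bullet> k)) \<partial>R)
          = (\<integral>\<omega>. m A J (Z \<omega>) *\<^sub>R iexp ((s *\<^sub>R k) \<bullet> Z \<omega>)
             + (iexp (- \<theta>) / 2) * (m A J (Z \<omega>) *\<^sub>R iexp ((s *\<^sub>R k + t) \<bullet> Z \<omega>))
             + (iexp \<theta> / 2) * (m A J (Z \<omega>) *\<^sub>R iexp ((s *\<^sub>R k - t) \<bullet> Z \<omega>)) \<partial>R)"
          unfolding weighted_cos_iexp by (simp add: inner_simps inner_commute)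
        also have "\<dots> = (\<integral>\<omega>. m A J (Z \<omega>) *\<^sub>R iexp ((s *\<^sub>R k) \<bullet> Z \<omega>) \<partial>R)
         + (\<integral>\<omega>. (iexp (- \<theta>) / 2) * (m A J (Z \<omega>) *\<^sub>R iexp ((s *\<^sub>R k + t) \<bullet> Z \<omega>)) \<partial>R)
         + (\<integral>\<omega>. (iexp \<theta> / 2) * (m A J (Z \<omega>) *\<^sub>R iexp ((s *\<^sub>R k - t) \<bullet> Z \<omega>)) \<partial>R)"
          by (subst Bochner_Integration.integral_add Bochner_Integration.integrable_add;
              (intro Bochner_Integration.integrable_add integrable_mult_right i)?)+ simp
        finally show ?thesis by (simp only: integral_mult_right_zero)
      qed
      show "(\<integral>\<omega>. (m A J (X \<omega>) * (1 + cos (t \<bullet> X \<omega> - \<theta>))) *\<^sub>R iexp (s * (X \<omega> \<bullet> k)) \<partial>P)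
        = (\<integral>\<omega>. (m A J (Y \<omega>) * (1 + cos (t \<bullet> Y \<omega> - \<theta>))) *\<^sub>R iexp (s * (Y \<omega> \<bullet> k)) \<partial>Q)"
        unfolding expand[OF P X] expand[OF Q Y] insert.IH ..
    next
      have "0 \<le> 1 + cos x" for x :: real using cos_ge_minus_one[of x] by linarith
      then show "0 \<le> m A J (X \<omega>) * (1 + cos (t \<bullet> X \<omega> - \<theta>))"
          "0 \<le> m A J (Y \<omega>') * (1 + cos (t \<bullet> Y \<omega>' - \<theta>))" for \<omega> \<omega>'
        using m01 by simp_all
    qed (use A intP(2) intQ(2) in auto)
    have sum: "(\<integral>\<omega>. m A J (Z \<omega>) * (1 + cos (t \<bullet> Z \<omega> - \<theta>)) * indicator (A k) (Z \<omega> \<bullet> k) \<partial>R)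
       = (\<integral>\<omega>. m A (insert k J) (Z \<omega>) \<partial>R) + (\<integral>\<omega>. m A (insert k J) (Z \<omega>) * cos (t \<bullet> Z \<omega> - \<theta>) \<partial>R)"
      if R: "prob_space R" "Z \<in> borel_measurable R" for R :: "'r measure" and Z t \<theta>
    proof -
      have "(\<integral>\<omega>. m A J (Z \<omega>) * (1 + cos (t \<bullet> Z \<omega> - \<theta>)) * indicator (A k) (Z \<omega> \<bullet> k) \<partial>R)
        = (\<integral>\<omega>. m A (insert k J) (Z \<omega>) + m A (insert k J) (Z \<omega>) * cos (t \<bullet> Z \<omega> - \<theta>) \<partial>R)"
        by (simp add: m_insert algebra_simps)
      also have "\<dots> = (\<integral>\<omega>. m A (insert k J) (Z \<omega>) \<partial>R) + (\<integral>\<omega>. m A (insert k J) (Z \<omega>) * cos (t \<bullet> Z \<omega> - \<theta>) \<partial>R)"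
        by (intro Bochner_Integration.integral_add int(3,4)[OF R A])
      finally show ?thesis .
    qed
    have "(\<integral>\<omega>. m A (insert k J) (X \<omega>) \<partial>P) = (\<integral>\<omega>. m A (insert k J) (Y \<omega>) \<partial>Q)"
      \<comment> \<open>For \<open>t = 0\<close> and \<open>\<theta> = 0\<close> the weight is twice the product of the indicators.\<close>
      using shifted[of 0 0] unfolding sum[OF P X] sum[OF Q Y] by simp
    then have cos_eq: "(\<integral>\<omega>. m A (insert k J) (X \<omega>) * cos (t \<bullet> X \<omega> - \<theta>) \<partial>P)
        = (\<integral>\<omega>. m A (insert k J) (Y \<omega>) * cos (t \<bullet> Y \<omega> - \<theta>) \<partial>Q)" for \<theta>
      using shifted[of t \<theta>] unfolding sum[OF P X] sum[OF Q Y] by simp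
    have re_im: "(\<integral>\<omega>. m A (insert k J) (Z \<omega>) *\<^sub>R iexp (t \<bullet> Z \<omega>) \<partial>R)
       = complex_of_real (\<integral>\<omega>. m A (insert k J) (Z \<omega>) * cos (t \<bullet> Z \<omega> - 0) \<partial>R)
        + \<i> * complex_of_real (\<integral>\<omega>. m A (insert k J) (Z \<omega>) * cos (t \<bullet> Z \<omega> - pi / 2) \<partial>R)"
      if R: "prob_space R" "Z \<in> borel_measurable R" for R :: "'r measure" and Z
    proof -
      have "(\<integral>\<omega>. m A (insert k J) (Z \<omega>) *\<^sub>R iexp (t \<bullet> Z \<omega>) \<partial>R)
       = (\<integral>\<omega>. complex_of_real (m A (insert k J) (Z \<omega>) * cos (t \<bullet> Z \<omega> - 0))
         + \<i> * complex_of_real (m A (insert k J) (Z \<omega>) * cos (t \<bullet> Z \<omega> - pi / 2)) \<partial>R)"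
        unfolding iexp_decompose by (simp add: scaleR_conv_of_real algebra_simps)
      also have "\<dots> = (\<integral>\<omega>. complex_of_real (m A (insert k J) (Z \<omega>) * cos (t \<bullet> Z \<omega> - 0)) \<partial>R)
         + (\<integral>\<omega>. \<i> * complex_of_real (m A (insert k J) (Z \<omega>) * cos (t \<bullet> Z \<omega> - pi / 2)) \<partial>R)"
        by (intro Bochner_Integration.integral_add integrable_mult_right integrable_of_real int(3)[OF R A])
      finally show ?thesis
        by (simp only: integral_mult_right_zero integral_complex_of_real)
    qed
    show ?case unfolding re_im[OF P X] re_im[OF Q Y] cos_eq ..
  qed
  have box: "emeasure (distr P borel X) (box l u) = emeasure (distr Q borel Y) (box l u)" for l u
  proof -
    define A where "A b = {l \<bullet> b <..< u \<bullet> b}" for b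
    have ind: "m A Basis x = indicator (box l u) x" for x
      by (auto simp: m_def A_def box_def indicator_def prod_zero_iff)
    have meas: "measure (distr R borel Z) (box l u) = (\<integral>\<omega>. m A Basis (Z \<omega>) \<partial>R)"
      if [measurable]: "Z \<in> borel_measurable R" for R :: "'r measure" and Z
    proof -
      have "(\<integral>x. indicator (box l u) x \<partial>distr R borel Z) = (\<integral>\<omega>. indicator (box l u) (Z \<omega>) \<partial>R :: real)"
        by (rule integral_distr) auto
      then show ?thesis unfolding ind by simp
    qed
    have "complex_of_real (\<integral>\<omega>. m A Basis (X \<omega>) \<partial>P) = complex_of_real (\<integral>\<omega>. m A Basis (Y \<omega>) \<partial>Q)"
      using claim[of Basis A 0] by (simp add: A_def scaleR_conv_of_real)
    then have eq_box: "measure (distr P borel X) (box l u) = measure (distr Q borel Y) (box l u)"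
      by (simp add: meas)
    interpret dP: prob_space "distr P borel X" by (rule P.prob_space_distr) simp
    interpret dQ: prob_space "distr Q borel Y" by (rule Q.prob_space_distr) simp
    show ?thesis using eq_box by (simp add: dP.emeasure_eq_measure dQ.emeasure_eq_measure)
  qed
  let ?E = "range (\<lambda>(a, b). box a b::'a set)"
  let ?A = "\<lambda>n::nat. box (- (real n *\<^sub>R One)) (real n *\<^sub>R One) :: 'a set"
  show ?thesis
  proof (rule measure_eqI_generator_eq)
    show "Int_stable ?E" by (auto simp: Int_stable_def box_Int_box)
    show "?E \<subseteq> Pow UNIV" "sets (distr P borel X) = sigma_sets UNIV ?E"
      "sets (distr Q borel Y) = sigma_sets UNIV ?E"
      by (simp_all add: borel_eq_box)
    show "range ?A \<subseteq> ?E" "(\<Union>i. ?A i) = UNIV"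
      unfolding UN_box_eq_UNIV by auto
    show "emeasure (distr P borel X) (?A i) \<noteq> \<infinity>" for i
      using P.prob_space_distr[OF X] prob_space.finite_measure finite_measure.emeasure_finite by auto
    show "emeasure (distr P borel X) B = emeasure (distr Q borel Y) B" if "B \<in> ?E" for B
      using that box by auto
  qed
qed

section \<open>Gaussian spaces\<close>

text \<open>Describing a centered, possibly degenerate Gaussian law by its characteristic function treats the
  constant and the non-constant case alike, and it is preserved by mean-square limits.\<close>

definition centered_gaussian_rv :: "'w measure \<Rightarrow> ('w \<Rightarrow> real) \<Rightarrow> bool" where
  "centered_gaussian_rv M X \<longleftrightarrow> sq_integrable M X \<and>
    (\<forall>s. (\<integral>\<omega>. iexp (s * X \<omega>) \<partial>M) = complex_of_real (exp (- (s\<^sup>2 * (\<integral>\<omega>. (X \<omega>)\<^sup>2 \<partial>M)) / 2)))"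

definition centered_gaussian_vector :: "'w measure \<Rightarrow> ('w \<Rightarrow> 'v::euclidean_space) \<Rightarrow> bool" where
  "centered_gaussian_vector M X \<longleftrightarrow> X \<in> borel_measurable M \<and>
    (\<forall>t. centered_gaussian_rv M (\<lambda>\<omega>. t \<bullet> X \<omega>))"

text \<open>The closure in mean square of the linear span of the values of the field.\<close>

definition ms_gaussian_space :: "'w measure \<Rightarrow> ('x \<Rightarrow> 'w \<Rightarrow> real) \<Rightarrow> ('w \<Rightarrow> real) set" where
  "ms_gaussian_space M u = {X. sq_integrable M X \<and>
    (\<forall>e>0. \<exists>S a. finite S \<and> (\<integral>\<omega>. (X \<omega> - (\<Sum>x\<in>S. a x * u x \<omega>))\<^sup>2 \<partial>M) < e)}"

lemma norm_iexp_diff_le: "norm (iexp a - iexp b) \<le> \<bar>a - b\<bar>"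
proof -
  have "iexp a - iexp b = iexp b * (iexp (a - b) - 1)"
    by (simp add: algebra_simps flip: exp_add)
  then have "norm (iexp a - iexp b) = norm (iexp (a - b) - 1)"
    by (simp add: norm_mult)
  also have "\<dots> \<le> \<bar>a - b\<bar>" using iexp_approx1[of "a - b" 0] by simp
  finally show ?thesis .
qed

lemma (in prob_space) char_normal:
  assumes \<sigma>: "0 < \<sigma>" and D: "distributed M lborel X (\<lambda>x. ennreal (normal_density 0 \<sigma> x))"
  shows "(\<integral>\<omega>. iexp (s * X \<omega>) \<partial>M) = complex_of_real (exp (- (s\<^sup>2 * \<sigma>\<^sup>2) / 2))"
proof -
  have Z: "distributed M lborel (\<lambda>\<omega>. X \<omega> / \<sigma>) (\<lambda>x. ennreal (std_normal_density x))"
    using D normal_standard_normal_convert[OF \<sigma>, of X 0] by simp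
  have [measurable]: "(\<lambda>\<omega>. X \<omega> / \<sigma>) \<in> borel_measurable M"
    using distributed_measurable[OF Z] by simp
  have "(\<integral>\<omega>. iexp ((s * \<sigma>) * (X \<omega> / \<sigma>)) \<partial>M) = char (distr M lborel (\<lambda>\<omega>. X \<omega> / \<sigma>)) (s * \<sigma>)"
    unfolding char_def by (subst integral_distr) auto
  also have "\<dots> = char std_normal_distribution (s * \<sigma>)"
    using distributed_distr_eq_density[OF Z] by simp
  also have "\<dots> = complex_of_real (exp (- ((s * \<sigma>)\<^sup>2) / 2))"
    by (simp add: char_std_normal_distribution)
  finally show ?thesis using \<sigma> by (simp add: power_mult_distrib)
qed

lemma (in prob_space) gaussian_rv_centered:
  assumes X: "gaussian_rv M X" and mean: "(\<integral>\<omega>. X \<omega> \<partial>M) = 0"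
  shows "centered_gaussian_rv M X"
proof -
  have [measurable]: "X \<in> borel_measurable M" using X by (simp add: gaussian_rv_def)
  consider \<mu> where "AE \<omega> in M. X \<omega> = \<mu>"
    | \<mu> \<sigma> where "0 < \<sigma>" "distributed M lborel X (\<lambda>x. ennreal (normal_density \<mu> \<sigma> x))"
    using X unfolding gaussian_rv_def by blast
  then show ?thesis
  proof cases
    case 1
    have "(\<integral>\<omega>. X \<omega> \<partial>M) = (\<integral>\<omega>. \<mu> \<partial>M)" using 1 by (intro integral_cong_AE) auto
    with mean have "\<mu> = 0" by (simp add: prob_space)
    with 1 have AE0: "AE \<omega> in M. X \<omega> = 0" by simp
    have sq: "integrable M (\<lambda>\<omega>. (X \<omega>)\<^sup>2) \<longleftrightarrow> integrable M (\<lambda>\<omega>. 0 :: real)"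
      using AE0 by (intro integrable_cong_AE) auto
    have 0: "(\<integral>\<omega>. (X \<omega>)\<^sup>2 \<partial>M) = 0" using AE0 by (intro integral_eq_zero_AE) auto
    have "(\<integral>\<omega>. iexp (s * X \<omega>) \<partial>M) = (\<integral>\<omega>. 1 \<partial>M)" for s
      using AE0 by (intro integral_cong_AE) auto
    with sq 0 show ?thesis by (simp add: centered_gaussian_rv_def sq_integrable_def prob_space)
  next
    case 2
    have "\<mu> = 0" using normal_distributed_expectation[OF 2] mean by simp
    note D = 2(2)[unfolded \<open>\<mu> = 0\<close>]
    have var: "(\<integral>\<omega>. (X \<omega>)\<^sup>2 \<partial>M) = \<sigma>\<^sup>2"
      using normal_distributed_variance[OF 2] mean by simp
    moreover have "integrable M (\<lambda>\<omega>. (X \<omega>)\<^sup>2)"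
      using var 2(1) not_integrable_integral_eq[of M "\<lambda>\<omega>. (X \<omega>)\<^sup>2"] by fastforce
    ultimately show ?thesis
      using char_normal[OF 2(1) D] by (simp add: centered_gaussian_rv_def sq_integrable_def)
  qed
qed

text \<open>Both sides of the formula for the characteristic function are continuous in mean square: the left
  one because the exponential is Lipschitz, the right one because the second moment is.\<close>

lemma (in prob_space) centered_gaussian_rv_limit:
  assumes X: "sq_integrable M X"
    and lim: "\<And>e. 0 < e \<Longrightarrow> \<exists>S. centered_gaussian_rv M S \<and> (\<integral>\<omega>. (X \<omega> - S \<omega>)\<^sup>2 \<partial>M) < e"
  shows "centered_gaussian_rv M X"
proof -
  have "\<exists>S. \<forall>n. centered_gaussian_rv M (S n) \<and> (\<integral>\<omega>. (X \<omega> - S n \<omega>)\<^sup>2 \<partial>M) < inverse (real (Suc n))"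
    using lim by (intro choice allI) simp
  then obtain S where S: "\<And>n. centered_gaussian_rv M (S n)"
    and close: "\<And>n. (\<integral>\<omega>. (X \<omega> - S n \<omega>)\<^sup>2 \<partial>M) < inverse (real (Suc n))" by blast
  have sqS: "sq_integrable M (S n)" for n using S by (simp add: centered_gaussian_rv_def)
  define D where "D n \<omega> = X \<omega> - S n \<omega>" for n \<omega>
  have D: "sq_integrable M (D n)" for n
    unfolding D_def[abs_def] by (intro sq_integrable_intros X sqS)
  have D0: "(\<lambda>n. \<integral>\<omega>. (D n \<omega>)\<^sup>2 \<partial>M) \<longlonglongrightarrow> 0"
  proof (rule tendsto_sandwich[OF _ _ tendsto_const LIMSEQ_inverse_real_of_nat])
    show "\<forall>\<^sub>F n in sequentially. (\<integral>\<omega>. (D n \<omega>)\<^sup>2 \<partial>M) \<le> inverse (real (Suc n))"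
      unfolding D_def using close by (intro always_eventually allI less_imp_le)
  qed simp
  have second: "(\<lambda>n. \<integral>\<omega>. (S n \<omega>)\<^sup>2 \<partial>M) \<longlonglongrightarrow> (\<integral>\<omega>. (X \<omega>)\<^sup>2 \<partial>M)"
  proof -
    have "(\<lambda>n. sqrt ((\<integral>\<omega>. (X \<omega>)\<^sup>2 \<partial>M) * (\<integral>\<omega>. (D n \<omega>)\<^sup>2 \<partial>M))) \<longlonglongrightarrow> 0"
      using D0 by (auto intro!: tendsto_eq_intros)
    then have "(\<lambda>n. \<integral>\<omega>. X \<omega> * D n \<omega> \<partial>M) \<longlonglongrightarrow> 0"
    proof (rule Lim_null_comparison[rotated])
      show "\<forall>\<^sub>F n in sequentially. norm (\<integral>\<omega>. X \<omega> * D n \<omega> \<partial>M)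
          \<le> sqrt ((\<integral>\<omega>. (X \<omega>)\<^sup>2 \<partial>M) * (\<integral>\<omega>. (D n \<omega>)\<^sup>2 \<partial>M))"
        by (intro always_eventually allI) (auto intro!: real_le_rsqrt Cauchy_Schwarz_integral D X)
    qed
    then have "(\<lambda>n. (\<integral>\<omega>. (X \<omega>)\<^sup>2 \<partial>M) - 2 * (\<integral>\<omega>. X \<omega> * D n \<omega> \<partial>M) + (\<integral>\<omega>. (D n \<omega>)\<^sup>2 \<partial>M))
        \<longlonglongrightarrow> (\<integral>\<omega>. (X \<omega>)\<^sup>2 \<partial>M)"
      using D0 by (auto intro!: tendsto_eq_intros)
    moreover have "(\<integral>\<omega>. (S n \<omega>)\<^sup>2 \<partial>M)
        = (\<integral>\<omega>. (X \<omega>)\<^sup>2 \<partial>M) - 2 * (\<integral>\<omega>. X \<omega> * D n \<omega> \<partial>M) + (\<integral>\<omega>. (D n \<omega>)\<^sup>2 \<partial>M)" for n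
    proof -
      have "(\<integral>\<omega>. (S n \<omega>)\<^sup>2 \<partial>M) = (\<integral>\<omega>. (X \<omega>)\<^sup>2 - 2 * (X \<omega> * D n \<omega>) + (D n \<omega>)\<^sup>2 \<partial>M)"
        by (intro Bochner_Integration.integral_cong) (simp_all add: D_def power2_eq_square algebra_simps)
      then show ?thesis
        using X D by (simp add: sq_integrable_mult sq_integrableD(2))
    qed
    ultimately show ?thesis by simp
  qed
  have "(\<integral>\<omega>. iexp (s * X \<omega>) \<partial>M) = complex_of_real (exp (- (s\<^sup>2 * (\<integral>\<omega>. (X \<omega>)\<^sup>2 \<partial>M)) / 2))" for s
  proof (rule LIMSEQ_unique)
    have meas: "X \<in> borel_measurable M" "S n \<in> borel_measurable M" for n
      using X sqS by (auto dest: sq_integrableD)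
    have int: "integrable M (\<lambda>\<omega>. iexp (s * X \<omega>))" "integrable M (\<lambda>\<omega>. iexp (s * S n \<omega>))" for n
      using meas by (auto intro!: integrable_iexp)
    have "(\<lambda>n. \<bar>s\<bar> * sqrt (\<integral>\<omega>. (D n \<omega>)\<^sup>2 \<partial>M)) \<longlonglongrightarrow> 0"
      using D0 by (auto intro!: tendsto_eq_intros)
    then have "(\<lambda>n. (\<integral>\<omega>. iexp (s * S n \<omega>) \<partial>M) - (\<integral>\<omega>. iexp (s * X \<omega>) \<partial>M)) \<longlonglongrightarrow> 0"
    proof (rule Lim_null_comparison[rotated])
      have "norm ((\<integral>\<omega>. iexp (s * S n \<omega>) \<partial>M) - (\<integral>\<omega>. iexp (s * X \<omega>) \<partial>M))
          \<le> \<bar>s\<bar> * sqrt (\<integral>\<omega>. (D n \<omega>)\<^sup>2 \<partial>M)" for n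
      proof -
        have "(\<integral>\<omega>. iexp (s * S n \<omega>) \<partial>M) - (\<integral>\<omega>. iexp (s * X \<omega>) \<partial>M)
            = (\<integral>\<omega>. iexp (s * S n \<omega>) - iexp (s * X \<omega>) \<partial>M)"
          by (rule Bochner_Integration.integral_diff[symmetric, OF int(2) int(1)])
        then have "norm ((\<integral>\<omega>. iexp (s * S n \<omega>) \<partial>M) - (\<integral>\<omega>. iexp (s * X \<omega>) \<partial>M))
            \<le> (\<integral>\<omega>. norm (iexp (s * S n \<omega>) - iexp (s * X \<omega>)) \<partial>M)"
          by (simp only: integral_norm_bound)
        also have "\<dots> \<le> (\<integral>\<omega>. \<bar>s\<bar> * \<bar>D n \<omega>\<bar> \<partial>M)"
        proof (rule integral_mono)
          show "integrable M (\<lambda>\<omega>. norm (iexp (s * S n \<omega>) - iexp (s * X \<omega>)))"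
            by (rule integrable_norm[OF Bochner_Integration.integrable_diff[OF int(2) int(1)]])
          show "integrable M (\<lambda>\<omega>. \<bar>s\<bar> * \<bar>D n \<omega>\<bar>)"
            using sq_integrable_integrable[OF D] by simp
          show "norm (iexp (s * S n \<omega>) - iexp (s * X \<omega>)) \<le> \<bar>s\<bar> * \<bar>D n \<omega>\<bar>" for \<omega>
          proof -
            have "norm (iexp (s * S n \<omega>) - iexp (s * X \<omega>)) \<le> \<bar>s * S n \<omega> - s * X \<omega>\<bar>"
              by (rule norm_iexp_diff_le)
            also have "\<dots> = \<bar>s\<bar> * \<bar>D n \<omega>\<bar>"
              unfolding D_def abs_mult[symmetric] right_diff_distrib by (rule abs_minus_commute)
            finally show ?thesis .
          qed
        qed
        also have "\<dots> \<le> \<bar>s\<bar> * sqrt (\<integral>\<omega>. (D n \<omega>)\<^sup>2 \<partial>M)"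
          using integral_abs_le_sqrt[OF D] by (simp add: mult_left_mono)
        finally show ?thesis .
      qed
      then show "\<forall>\<^sub>F n in sequentially. norm ((\<integral>\<omega>. iexp (s * S n \<omega>) \<partial>M) - (\<integral>\<omega>. iexp (s * X \<omega>) \<partial>M))
          \<le> \<bar>s\<bar> * sqrt (\<integral>\<omega>. (D n \<omega>)\<^sup>2 \<partial>M)" by simp
    qed
    then show "(\<lambda>n. \<integral>\<omega>. iexp (s * S n \<omega>) \<partial>M) \<longlonglongrightarrow> (\<integral>\<omega>. iexp (s * X \<omega>) \<partial>M)"
      by (simp only: LIM_zero_iff)
    have "(\<integral>\<omega>. iexp (s * S n \<omega>) \<partial>M) = complex_of_real (exp (- (s\<^sup>2 * (\<integral>\<omega>. (S n \<omega>)\<^sup>2 \<partial>M)) / 2))" for n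
      using S by (simp add: centered_gaussian_rv_def)
    then show "(\<lambda>n. \<integral>\<omega>. iexp (s * S n \<omega>) \<partial>M) \<longlonglongrightarrow>
        complex_of_real (exp (- (s\<^sup>2 * (\<integral>\<omega>. (X \<omega>)\<^sup>2 \<partial>M)) / 2))"
      using second by (simp only:) (intro tendsto_intros; simp)
  qed
  with X show ?thesis by (simp add: centered_gaussian_rv_def)
qed

lemma (in prob_space) gaussian_field_sq_integrable:
  assumes u: "gaussian_field M u" and mean: "\<And>x. (\<integral>\<omega>. u x \<omega> \<partial>M) = 0"
  shows "sq_integrable M (u x)"
proof -
  have "gaussian_rv M (\<lambda>\<omega>. \<Sum>y\<in>{x}. 1 * u y \<omega>)"
    using u unfolding gaussian_field_def by (elim allE[of _ "{x}"] allE[of _ "\<lambda>_. 1"]) simp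
  then have "gaussian_rv M (u x)" by simp
  from gaussian_rv_centered[OF this mean] show ?thesis by (simp add: centered_gaussian_rv_def)
qed

lemma (in prob_space) ms_gaussian_space_centered:
  assumes u: "gaussian_field M u" and mean: "\<And>x. (\<integral>\<omega>. u x \<omega> \<partial>M) = 0"
    and X: "X \<in> ms_gaussian_space M u"
  shows "centered_gaussian_rv M X"
proof (rule centered_gaussian_rv_limit)
  fix e :: real assume "0 < e"
  then obtain S a where S: "finite S" "(\<integral>\<omega>. (X \<omega> - (\<Sum>x\<in>S. a x * u x \<omega>))\<^sup>2 \<partial>M) < e"
    using X by (auto simp: ms_gaussian_space_def)
  have int: "integrable M (u x)" for x
    by (intro sq_integrable_integrable gaussian_field_sq_integrable[OF u mean])
  have "centered_gaussian_rv M (\<lambda>\<omega>. \<Sum>x\<in>S. a x * u x \<omega>)"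
  proof (rule gaussian_rv_centered)
    show "gaussian_rv M (\<lambda>\<omega>. \<Sum>x\<in>S. a x * u x \<omega>)" using u S(1) by (simp add: gaussian_field_def)
    show "(\<integral>\<omega>. (\<Sum>x\<in>S. a x * u x \<omega>) \<partial>M) = 0" by (simp add: int mean)
  qed
  with S(2) show "\<exists>S. centered_gaussian_rv M S \<and> (\<integral>\<omega>. (X \<omega> - S \<omega>)\<^sup>2 \<partial>M) < e" by blast
qed (use X in \<open>simp add: ms_gaussian_space_def\<close>)

lemma ms_gaussian_space_base:
  assumes "sq_integrable M (u x)"
  shows "u x \<in> ms_gaussian_space M u"
  unfolding ms_gaussian_space_def
proof (intro CollectI conjI allI impI assms)
  fix e :: real assume "0 < e"
  then show "\<exists>S a. finite S \<and> (\<integral>\<omega>. (u x \<omega> - (\<Sum>x\<in>S. a x * u x \<omega>))\<^sup>2 \<partial>M) < e"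
    by (intro exI[of _ "{x}"] exI[of _ "\<lambda>_. 1"]) simp
qed

lemma ms_gaussian_space_add_scale:
  assumes u: "\<And>x. sq_integrable M (u x)"
    and X: "X \<in> ms_gaussian_space M u" and Y: "Y \<in> ms_gaussian_space M u"
  shows "(\<lambda>\<omega>. X \<omega> + c * Y \<omega>) \<in> ms_gaussian_space M u"
  unfolding ms_gaussian_space_def
proof (intro CollectI conjI allI impI)
  have sq: "sq_integrable M X" "sq_integrable M Y" using X Y by (auto simp: ms_gaussian_space_def)
  then show "sq_integrable M (\<lambda>\<omega>. X \<omega> + c * Y \<omega>)" by (intro sq_integrable_intros)
  fix e :: real assume e: "0 < e"
  obtain S a where S: "finite S" "(\<integral>\<omega>. (X \<omega> - (\<Sum>x\<in>S. a x * u x \<omega>))\<^sup>2 \<partial>M) < e / 4"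
    using X e by (auto simp: ms_gaussian_space_def dest!: spec[of _ "e / 4"])
  define e' where "e' = e / 4 / (c\<^sup>2 + 1)"
  have c1: "0 < c\<^sup>2 + 1" by (simp add: add_nonneg_pos)
  then have "0 < e'" using e by (simp add: e'_def)
  then obtain T b where T: "finite T" "(\<integral>\<omega>. (Y \<omega> - (\<Sum>x\<in>T. b x * u x \<omega>))\<^sup>2 \<partial>M) < e'"
    using Y unfolding ms_gaussian_space_def by blast
  \<comment> \<open>The approximating combinations live on different finite sets; both are extended by 0 to the union.\<close>
  define d where "d x = (if x \<in> S then a x else 0) + c * (if x \<in> T then b x else 0)" for x
  define P where "P \<omega> = X \<omega> - (\<Sum>x\<in>S. a x * u x \<omega>)" for \<omega>
  define Q where "Q \<omega> = Y \<omega> - (\<Sum>x\<in>T. b x * u x \<omega>)" for \<omega>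
  have PQ: "sq_integrable M P" "sq_integrable M Q"
    unfolding P_def[abs_def] Q_def[abs_def] by (intro sq_integrable_intros sq u)+
  have sum: "(\<Sum>x\<in>S \<union> T. d x * u x \<omega>) = (\<Sum>x\<in>S. a x * u x \<omega>) + c * (\<Sum>x\<in>T. b x * u x \<omega>)" for \<omega>
  proof -
    have "(\<Sum>x\<in>S \<union> T. d x * u x \<omega>) = (\<Sum>x\<in>S \<union> T. (if x \<in> S then a x * u x \<omega> else 0))
        + c * (\<Sum>x\<in>S \<union> T. (if x \<in> T then b x * u x \<omega> else 0))"
      unfolding sum_distrib_left sum.distrib[symmetric]
      by (intro sum.cong) (auto simp: d_def algebra_simps)
    moreover have "(\<Sum>x\<in>S \<union> T. (if x \<in> S then a x * u x \<omega> else 0)) = (\<Sum>x\<in>S. a x * u x \<omega>)"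
      "(\<Sum>x\<in>S \<union> T. (if x \<in> T then b x * u x \<omega> else 0)) = (\<Sum>x\<in>T. b x * u x \<omega>)"
      using S(1) T(1) by (auto simp: sum.If_cases Int_absorb2 Un_upper1 Int_Un_distrib Int_absorb intro!: sum.cong)
    ultimately show ?thesis by simp
  qed
  have "(\<integral>\<omega>. (X \<omega> + c * Y \<omega> - (\<Sum>x\<in>S \<union> T. d x * u x \<omega>))\<^sup>2 \<partial>M) = (\<integral>\<omega>. (P \<omega> + c * Q \<omega>)\<^sup>2 \<partial>M)"
    unfolding sum P_def Q_def by (simp add: algebra_simps)
  also have "\<dots> \<le> 2 * (\<integral>\<omega>. (P \<omega>)\<^sup>2 \<partial>M) + 2 * (\<integral>\<omega>. (c * Q \<omega>)\<^sup>2 \<partial>M)"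
    by (intro integral_add_sq_le sq_integrable_scale PQ)
  also have "\<dots> = 2 * (\<integral>\<omega>. (P \<omega>)\<^sup>2 \<partial>M) + 2 * (c\<^sup>2 * (\<integral>\<omega>. (Q \<omega>)\<^sup>2 \<partial>M))"
    by (simp add: power_mult_distrib)
  also have "\<dots> < e"
  proof -
    have "c\<^sup>2 * (\<integral>\<omega>. (Q \<omega>)\<^sup>2 \<partial>M) \<le> (c\<^sup>2 + 1) * e'"
      using T(2) by (intro mult_mono) (auto simp: Q_def)
    also have "\<dots> = e / 4"
      unfolding e'_def using c1 by (intro nonzero_mult_div_cancel_left[of "c\<^sup>2 + 1" "e / 4", unfolded times_divide_eq_right[symmetric]]) simp
    finally show ?thesis using S(2) by (simp add: P_def)
  qed
  finally show "\<exists>S a. finite S \<and> (\<integral>\<omega>. (X \<omega> + c * Y \<omega> - (\<Sum>x\<in>S. a x * u x \<omega>))\<^sup>2 \<partial>M) < e"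
    using S(1) T(1) by blast
qed

lemma ms_gaussian_space_zero: "(\<lambda>_. 0) \<in> ms_gaussian_space M u"
  unfolding ms_gaussian_space_def
  by (auto simp: sq_integrable_def intro!: exI[of _ "{}"])

lemma ms_gaussian_space_sum:
  assumes u: "\<And>x. sq_integrable M (u x)" and X: "\<And>i. i \<in> I \<Longrightarrow> X i \<in> ms_gaussian_space M u"
  shows "(\<lambda>\<omega>. \<Sum>i\<in>I. c i * X i \<omega>) \<in> ms_gaussian_space M u"
  using X
proof (induction I rule: infinite_finite_induct)
  case (insert i I)
  then have "(\<lambda>\<omega>. (\<Sum>i\<in>I. c i * X i \<omega>) + c i * X i \<omega>) \<in> ms_gaussian_space M u"
    by (intro ms_gaussian_space_add_scale u) auto
  with insert.hyps show ?case by (simp add: add.commute)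
qed (simp_all add: ms_gaussian_space_zero)

lemma ms_gaussian_space_closed:
  assumes u: "\<And>x. sq_integrable M (u x)" and X: "sq_integrable M X"
    and lim: "\<And>e. 0 < e \<Longrightarrow> \<exists>Y\<in>ms_gaussian_space M u. (\<integral>\<omega>. (X \<omega> - Y \<omega>)\<^sup>2 \<partial>M) < e"
  shows "X \<in> ms_gaussian_space M u"
  unfolding ms_gaussian_space_def
proof (intro CollectI conjI allI impI X)
  fix e :: real assume "0 < e"
  then obtain Y where Y: "Y \<in> ms_gaussian_space M u" "(\<integral>\<omega>. (X \<omega> - Y \<omega>)\<^sup>2 \<partial>M) < e / 4"
    using lim[of "e / 4"] by auto
  then obtain S a where S: "finite S" "(\<integral>\<omega>. (Y \<omega> - (\<Sum>x\<in>S. a x * u x \<omega>))\<^sup>2 \<partial>M) < e / 4"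
    using \<open>0 < e\<close> by (auto simp: ms_gaussian_space_def dest!: spec[of _ "e / 4"])
  have sqY: "sq_integrable M Y" using Y by (simp add: ms_gaussian_space_def)
  have "(\<integral>\<omega>. (X \<omega> - (\<Sum>x\<in>S. a x * u x \<omega>))\<^sup>2 \<partial>M)
      = (\<integral>\<omega>. ((X \<omega> - Y \<omega>) + (Y \<omega> - (\<Sum>x\<in>S. a x * u x \<omega>)))\<^sup>2 \<partial>M)" by simp
  also have "\<dots> \<le> 2 * (\<integral>\<omega>. (X \<omega> - Y \<omega>)\<^sup>2 \<partial>M) + 2 * (\<integral>\<omega>. (Y \<omega> - (\<Sum>x\<in>S. a x * u x \<omega>))\<^sup>2 \<partial>M)"
    by (intro integral_add_sq_le sq_integrable_intros X sqY u)
  also have "\<dots> < e" using Y(2) S(2) by simp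
  finally show "\<exists>S a. finite S \<and> (\<integral>\<omega>. (X \<omega> - (\<Sum>x\<in>S. a x * u x \<omega>))\<^sup>2 \<partial>M) < e"
    using S(1) by blast
qed

text \<open>Difference quotients stay in the span, so their mean-square limits stay in its closure.  This is why
  all derivatives of a Gaussian field are jointly Gaussian.\<close>

lemma (in prob_space) ms_gaussian_space_ms_deriv:
  assumes u: "\<And>x. sq_integrable M (u x)" and v: "\<And>x. v x \<in> ms_gaussian_space M u"
    and Y: "has_ms_deriv M v b x Y"
  shows "Y \<in> ms_gaussian_space M u"
proof (rule ms_gaussian_space_closed[OF u has_ms_derivD(1)[OF Y]])
  fix e :: real assume "0 < e"
  have "\<forall>\<^sub>F t in at 0. (\<integral>\<omega>. ((v (x + t *\<^sub>R b) \<omega> - v x \<omega>) / t - Y \<omega>)\<^sup>2 \<partial>M) < e"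
    using has_ms_derivD(4)[OF Y] \<open>0 < e\<close> by (rule order_tendstoD(2))
  then obtain t where t: "(\<integral>\<omega>. ((v (x + t *\<^sub>R b) \<omega> - v x \<omega>) / t - Y \<omega>)\<^sup>2 \<partial>M) < e"
    using eventually_happens[of _ "at (0::real)"] by auto
  have "(\<lambda>\<omega>. 0 + inverse t * (v (x + t *\<^sub>R b) \<omega> + (- 1) * v x \<omega>)) \<in> ms_gaussian_space M u"
    by (intro ms_gaussian_space_add_scale u v ms_gaussian_space_zero)
  then have "(\<lambda>\<omega>. (v (x + t *\<^sub>R b) \<omega> - v x \<omega>) / t) \<in> ms_gaussian_space M u"
    by (simp add: field_simps)
  with t show "\<exists>Z\<in>ms_gaussian_space M u. (\<integral>\<omega>. (Y \<omega> - Z \<omega>)\<^sup>2 \<partial>M) < e"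
    by (intro bexI[of _ "\<lambda>\<omega>. (v (x + t *\<^sub>R b) \<omega> - v x \<omega>) / t"]) (simp_all add: power2_commute)
qed

lemma (in prob_space) ms_gaussian_space_vector:
  fixes X :: "'a \<Rightarrow> 'v::euclidean_space"
  assumes u: "gaussian_field M u" and mean: "\<And>x. (\<integral>\<omega>. u x \<omega> \<partial>M) = 0"
    and X: "\<And>b. b \<in> Basis \<Longrightarrow> (\<lambda>\<omega>. X \<omega> \<bullet> b) \<in> ms_gaussian_space M u"
  shows "centered_gaussian_vector M X"
  unfolding centered_gaussian_vector_def
proof (intro conjI allI)
  show "X \<in> borel_measurable M"
    by (subst borel_measurable_euclidean_space)
       (use X in \<open>auto simp: ms_gaussian_space_def sq_integrable_def\<close>)
  fix t :: 'v
  have "(\<lambda>\<omega>. \<Sum>b\<in>Basis. (t \<bullet> b) * (X \<omega> \<bullet> b)) \<in> ms_gaussian_space M u"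
    by (intro ms_gaussian_space_sum gaussian_field_sq_integrable[OF u mean] X)
  then have "(\<lambda>\<omega>. t \<bullet> X \<omega>) \<in> ms_gaussian_space M u"
    by (simp only: euclidean_inner[of t "X _"])
  then show "centered_gaussian_rv M (\<lambda>\<omega>. t \<bullet> X \<omega>)"
    by (rule ms_gaussian_space_centered[OF u mean])
qed

text \<open>For centered Gaussian vectors, second moments determine all characteristic functions.\<close>

lemma centered_gaussian_vector_distr_eq:
  fixes X :: "'p \<Rightarrow> 'v::euclidean_space" and Y :: "'q \<Rightarrow> 'v"
  assumes P: "prob_space P" and Q: "prob_space Q"
    and X: "centered_gaussian_vector P X" and Y: "centered_gaussian_vector Q Y"
    and cov: "\<And>b c. b \<in> Basis \<Longrightarrow> c \<in> Basis \<Longrightarrow>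
      (\<integral>\<omega>. (X \<omega> \<bullet> b) * (X \<omega> \<bullet> c) \<partial>P) = (\<integral>\<omega>. (Y \<omega> \<bullet> b) * (Y \<omega> \<bullet> c) \<partial>Q)"
  shows "distr P borel X = distr Q borel Y"
proof (rule distr_eq_of_char_eq[OF P Q])
  fix t :: 'v
  have expand: "(\<integral>\<omega>. (t \<bullet> Z \<omega>)\<^sup>2 \<partial>R) =
      (\<Sum>b\<in>Basis. \<Sum>c\<in>Basis. (t \<bullet> b) * (t \<bullet> c) * (\<integral>\<omega>. (Z \<omega> \<bullet> b) * (Z \<omega> \<bullet> c) \<partial>R))"
    if "centered_gaussian_vector R Z" for R :: "'r measure" and Z
  proof -
    have sq: "sq_integrable R (\<lambda>\<omega>. Z \<omega> \<bullet> b)" for b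
      using that by (simp add: centered_gaussian_vector_def centered_gaussian_rv_def inner_commute)
    have "(\<integral>\<omega>. (t \<bullet> Z \<omega>)\<^sup>2 \<partial>R) = (\<integral>\<omega>. (\<Sum>b\<in>Basis. \<Sum>c\<in>Basis. (t \<bullet> b) * (t \<bullet> c) * ((Z \<omega> \<bullet> b) * (Z \<omega> \<bullet> c))) \<partial>R)"
      unfolding power2_eq_square euclidean_inner[of t "Z _"] by (simp add: sum_product mult_ac)
    then show ?thesis by (simp add: sq_integrable_mult[OF sq sq])
  qed
  have "(\<integral>\<omega>. (t \<bullet> X \<omega>)\<^sup>2 \<partial>P) = (\<integral>\<omega>. (t \<bullet> Y \<omega>)\<^sup>2 \<partial>Q)"
    unfolding expand[OF X] expand[OF Y] by (simp add: cov)
  moreover have "(\<integral>\<omega>. iexp (1 * (t \<bullet> X \<omega>)) \<partial>P) = complex_of_real (exp (- (1\<^sup>2 * (\<integral>\<omega>. (t \<bullet> X \<omega>)\<^sup>2 \<partial>P)) / 2))"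
    using X unfolding centered_gaussian_vector_def centered_gaussian_rv_def by blast
  moreover have "(\<integral>\<omega>. iexp (1 * (t \<bullet> Y \<omega>)) \<partial>Q) = complex_of_real (exp (- (1\<^sup>2 * (\<integral>\<omega>. (t \<bullet> Y \<omega>)\<^sup>2 \<partial>Q)) / 2))"
    using Y unfolding centered_gaussian_vector_def centered_gaussian_rv_def by blast
  ultimately show "(\<integral>\<omega>. iexp (t \<bullet> X \<omega>) \<partial>P) = (\<integral>\<omega>. iexp (t \<bullet> Y \<omega>) \<partial>Q)" by simp
qed (use X Y in \<open>auto simp: centered_gaussian_vector_def\<close>)

lemma centered_gaussian_vector_linear:
  fixes X :: "'p \<Rightarrow> 'v::euclidean_space" and L :: "'v \<Rightarrow> 'w::euclidean_space"
  assumes X: "centered_gaussian_vector P X" and L: "linear L"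
  shows "centered_gaussian_vector P (\<lambda>\<omega>. L (X \<omega>))"
  unfolding centered_gaussian_vector_def
proof (intro conjI allI)
  have [measurable]: "L \<in> borel_measurable borel"
    by (intro borel_measurable_continuous_onI linear_continuous_on) (use L in \<open>simp add: linear_conv_bounded_linear\<close>)
  have [measurable]: "X \<in> borel_measurable P" using X by (simp add: centered_gaussian_vector_def)
  show "(\<lambda>\<omega>. L (X \<omega>)) \<in> borel_measurable P" by measurable
  fix t :: 'w
  have "x \<bullet> adjoint L t = L x \<bullet> t" for x
    by (rule adjoint_works[OF L])
  then have "(\<lambda>\<omega>. t \<bullet> L (X \<omega>)) = (\<lambda>\<omega>. adjoint L t \<bullet> X \<omega>)"
    by (simp only: inner_commute[of t] inner_commute[of "adjoint L t"])
  then show "centered_gaussian_rv P (\<lambda>\<omega>. t \<bullet> L (X \<omega>))"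
    using X by (simp only: centered_gaussian_vector_def)
qed

section \<open>The standard Gaussian measure\<close>

definition std_gauss :: "'v::euclidean_space measure" where
  "std_gauss = distr (\<Pi>\<^sub>M b\<in>Basis. std_normal_distribution) borel (\<lambda>f. \<Sum>b\<in>Basis. f b *\<^sub>R b)"

lemma std_gauss_coordinates_measurable:
  "(\<lambda>f. \<Sum>b\<in>Basis. f b *\<^sub>R b) \<in> borel_measurable (\<Pi>\<^sub>M b\<in>(Basis :: 'v::euclidean_space set). std_normal_distribution)"
proof (intro borel_measurable_sum borel_measurable_scaleR borel_measurable_const)
  fix b :: 'v assume "b \<in> Basis"
  then have "(\<lambda>f. f b) \<in> (\<Pi>\<^sub>M b\<in>Basis. std_normal_distribution) \<rightarrow>\<^sub>M std_normal_distribution"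
    by (rule measurable_component_singleton)
  then show "(\<lambda>f. f b) \<in> borel_measurable (\<Pi>\<^sub>M b\<in>Basis. std_normal_distribution)"
    using measurable_cong_sets[OF refl, of std_normal_distribution borel] by simp
qed

lemma sets_std_gauss[simp, measurable_cong]: "sets std_gauss = sets borel"
  by (simp add: std_gauss_def)

lemma space_std_gauss[simp]: "space std_gauss = UNIV"
  by (simp add: std_gauss_def)

lemma prob_space_std_normal_PiM: "prob_space (\<Pi>\<^sub>M b\<in>I. std_normal_distribution)"
  by (intro prob_space_PiM prob_space_normal_density) simp

lemma prob_space_std_gauss: "prob_space std_gauss"
  unfolding std_gauss_def
  by (intro prob_space.prob_space_distr prob_space_std_normal_PiM std_gauss_coordinates_measurable)

text \<open>Coordinates along distinct basis vectors form a product family.  The injective index map \<open>g\<close> allows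
  index sets such as sets of matrix positions, and a single coordinate as well.\<close>

lemma std_gauss_family:
  fixes g :: "'i \<Rightarrow> 'v::euclidean_space"
  assumes "inj_on g I" "g ` I \<subseteq> Basis"
  shows "distr std_gauss (\<Pi>\<^sub>M i\<in>I. std_normal_distribution) (\<lambda>A. \<lambda>i\<in>I. A \<bullet> g i)
    = (\<Pi>\<^sub>M i\<in>I. std_normal_distribution)"
proof -
  have m: "(\<lambda>A :: 'v. \<lambda>i\<in>I. A \<bullet> g i) \<in> borel \<rightarrow>\<^sub>M (\<Pi>\<^sub>M i\<in>I. std_normal_distribution)"
    by (intro measurable_restrict) (auto simp: measurable_cong_sets[OF refl sets_density])
  have eq: "(\<lambda>i\<in>I. (\<Sum>b\<in>Basis. f b *\<^sub>R b) \<bullet> g i) = (\<lambda>i\<in>I. f (g i))" for f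
    using assms(2) by (intro restrict_ext) (auto simp: inner_sum_left_Basis image_subset_iff)
  have "distr std_gauss (\<Pi>\<^sub>M i\<in>I. std_normal_distribution) (\<lambda>A. \<lambda>i\<in>I. A \<bullet> g i)
      = distr (\<Pi>\<^sub>M b\<in>(Basis :: 'v set). std_normal_distribution) (\<Pi>\<^sub>M i\<in>I. std_normal_distribution)
        (\<lambda>f. \<lambda>i\<in>I. f (g i))"
    unfolding std_gauss_def
    by (subst distr_distr[OF m std_gauss_coordinates_measurable]) (simp add: o_def eq)
  also have "\<dots> = (\<Pi>\<^sub>M i\<in>I. std_normal_distribution)"
    using assms by (intro distr_PiM_reindex[where M = "\<lambda>_. std_normal_distribution"])
      (auto intro: prob_space_normal_density)
  finally show ?thesis .
qed

lemma std_gauss_coordinate: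
  assumes "b \<in> Basis"
  shows "distributed std_gauss lborel (\<lambda>A. A \<bullet> b) (\<lambda>x. ennreal (std_normal_density x))"
proof -
  have "distr std_gauss lborel (\<lambda>A. A \<bullet> b) = distr (distr std_gauss (\<Pi>\<^sub>M i\<in>{b}. std_normal_distribution)
      (\<lambda>A. \<lambda>i\<in>{b}. A \<bullet> i)) std_normal_distribution (\<lambda>f. f b)"
    by (subst distr_distr) (auto simp: o_def intro!: distr_cong measurable_restrict)
  also have "\<dots> = distr (\<Pi>\<^sub>M i\<in>{b}. std_normal_distribution) std_normal_distribution (\<lambda>f. f b)"
    using std_gauss_family[of "\<lambda>i. i" "{b}"] assms by simp
  also have "\<dots> = std_normal_distribution"
    by (rule distr_PiM_component) (auto intro: prob_space_normal_density)
  finally show ?thesis by (simp add: distributed_def)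
qed

lemma std_gauss_indep:
  assumes g: "inj_on g I" "g ` I \<subseteq> Basis"
  shows "prob_space.indep_vars std_gauss (\<lambda>_. borel) (\<lambda>i A. A \<bullet> g i) I"
proof (cases "I = {}")
  case True
  interpret prob_space std_gauss by (rule prob_space_std_gauss)
  show ?thesis using True by (simp add: indep_vars_def indep_sets_def)
next
  case False
  interpret prob_space std_gauss by (rule prob_space_std_gauss)
  have marg: "distr std_gauss borel (\<lambda>A. A \<bullet> g i) = std_normal_distribution" if "i \<in> I" for i
  proof -
    have "distr std_gauss borel (\<lambda>A. A \<bullet> g i) = distr std_gauss lborel (\<lambda>A. A \<bullet> g i)"
      by (intro distr_cong) auto
    also have "\<dots> = std_normal_distribution"
      using g that by (intro distributed_distr_eq_density std_gauss_coordinate) auto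
    finally show ?thesis .
  qed
  have "distr std_gauss (\<Pi>\<^sub>M i\<in>I. borel) (\<lambda>A. \<lambda>i\<in>I. A \<bullet> g i)
      = distr std_gauss (\<Pi>\<^sub>M i\<in>I. std_normal_distribution) (\<lambda>A. \<lambda>i\<in>I. A \<bullet> g i)"
    by (intro distr_cong sets_PiM_cong) auto
  also have "\<dots> = (\<Pi>\<^sub>M i\<in>I. distr std_gauss borel (\<lambda>A. A \<bullet> g i))"
    unfolding std_gauss_family[OF g] by (intro PiM_cong) (auto simp: marg)
  finally show ?thesis
    by (subst indep_vars_iff_distr_eq_PiM'[OF False]) auto
qed

lemma std_gauss_inner_sq_integrable_cov:
  fixes p q :: "'v::euclidean_space"
  shows "sq_integrable std_gauss (\<lambda>A. A \<bullet> p)"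
    and "(\<integral>A. (A \<bullet> p) * (A \<bullet> q) \<partial>std_gauss) = p \<bullet> q"
proof -
  interpret prob_space "std_gauss :: 'v measure" by (rule prob_space_std_gauss)
  have mean: "(\<integral>A. A \<bullet> b \<partial>std_gauss) = 0" if "b \<in> Basis" for b :: 'v
    by (rule standard_normal_distributed_expectation[OF std_gauss_coordinate[OF that]])
  have var: "(\<integral>A. (A \<bullet> b)\<^sup>2 \<partial>std_gauss) = 1" if "b \<in> Basis" for b :: 'v
    using standard_normal_distributed_variance[OF std_gauss_coordinate[OF that]] mean[OF that] by simp
  \<comment> \<open>A non-integrable square would have integral 0, not 1.\<close>
  have sq: "sq_integrable std_gauss (\<lambda>A. A \<bullet> b)" if "b \<in> Basis" for b :: 'v
    unfolding sq_integrable_def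
    using var[OF that] not_integrable_integral_eq[of std_gauss "\<lambda>A. (A \<bullet> b)\<^sup>2"] by fastforce
  have cov: "(\<integral>A. (A \<bullet> b) * (A \<bullet> c) \<partial>std_gauss) = (if b = c then 1 else 0)"
    if "b \<in> Basis" "c \<in> Basis" for b c :: 'v
  proof (cases "b = c")
    case True
    then show ?thesis using var[OF that(1)] by (simp add: power2_eq_square)
  next
    case False
    have "(\<integral>A. (\<Prod>d\<in>{b, c}. A \<bullet> d) \<partial>std_gauss) = (\<Prod>d\<in>{b, c}. \<integral>A. A \<bullet> d \<partial>std_gauss)"
      by (rule indep_vars_lebesgue_integral)
         (use that sq sq_integrable_integrable in \<open>auto intro!: std_gauss_indep\<close>)
    with False mean[OF that(1)] show ?thesis by simp
  qed
  have rep: "A \<bullet> p = (\<Sum>b\<in>Basis. (p \<bullet> b) * (A \<bullet> b))" for A p :: 'v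
    by (subst euclidean_inner) (simp add: mult.commute)
  show "sq_integrable std_gauss (\<lambda>A. A \<bullet> p)"
    unfolding rep[of _ p] by (intro sq_integrable_intros sq)
  have "(\<integral>A. (A \<bullet> p) * (A \<bullet> q) \<partial>std_gauss)
      = (\<integral>A. (\<Sum>b\<in>Basis. \<Sum>c\<in>Basis. (p \<bullet> b) * (q \<bullet> c) * ((A \<bullet> b) * (A \<bullet> c))) \<partial>std_gauss)"
    unfolding rep[of _ p] rep[of _ q] by (simp add: sum_product mult_ac)
  also have "\<dots> = (\<Sum>b\<in>Basis. \<Sum>c\<in>Basis. (p \<bullet> b) * (q \<bullet> c) * (if b = c then 1 else 0))"
    by (simp add: sq_integrable_mult[OF sq sq] cov)
  also have "\<dots> = p \<bullet> q"
    by (simp add: euclidean_inner[of p q] if_distrib cong: if_cong)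
  finally show "(\<integral>A. (A \<bullet> p) * (A \<bullet> q) \<partial>std_gauss) = p \<bullet> q" .
qed

lemma centered_gaussian_vector_std_gauss:
  "centered_gaussian_vector (std_gauss :: 'v::euclidean_space measure) (\<lambda>A. A)"
  unfolding centered_gaussian_vector_def centered_gaussian_rv_def
proof (intro conjI allI)
  show "sq_integrable std_gauss (\<lambda>A. t \<bullet> A)" for t :: 'v
    using std_gauss_inner_sq_integrable_cov(1)[of t] by (simp add: inner_commute)
  interpret product_sigma_finite "\<lambda>_ :: 'v. std_normal_distribution"
    by (intro product_sigma_finite.intro prob_space_imp_sigma_finite prob_space_normal_density) simp
  interpret N: prob_space std_normal_distribution by (rule prob_space_normal_density) simp
  fix t :: 'v and s
  have second: "(\<integral>A. (t \<bullet> A)\<^sup>2 \<partial>std_gauss) = t \<bullet> t"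
    using std_gauss_inner_sq_integrable_cov(2)[of t t] by (simp add: power2_eq_square inner_commute)
  have char: "(\<integral>x. iexp (r * x) \<partial>std_normal_distribution) = complex_of_real (exp (- (r\<^sup>2) / 2))" for r
    using fun_cong[OF char_std_normal_distribution, of r] unfolding char_def .
  have prod: "(\<Prod>b\<in>(Basis :: 'v set). exp (- ((s * (t \<bullet> b))\<^sup>2) / 2)) = exp (- (s\<^sup>2 * (t \<bullet> t)) / 2)"
  proof -
    have "(\<Sum>b\<in>(Basis :: 'v set). - ((s * (t \<bullet> b))\<^sup>2) / 2)
        = (- (s\<^sup>2) / 2) * (\<Sum>b\<in>(Basis :: 'v set). (t \<bullet> b) * (t \<bullet> b))"
      unfolding sum_distrib_left by (rule sum.cong) (simp_all add: power2_eq_square)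
    then have "(\<Sum>b\<in>(Basis :: 'v set). - ((s * (t \<bullet> b))\<^sup>2) / 2) = - (s\<^sup>2 * (t \<bullet> t)) / 2"
      unfolding euclidean_inner[of t t, symmetric] by simp
    then show ?thesis
      unfolding exp_sum[OF finite_Basis, symmetric] by (rule arg_cong)
  qed
  have split: "iexp (s * (t \<bullet> (\<Sum>b\<in>Basis. f b *\<^sub>R b))) = (\<Prod>b\<in>Basis. iexp (s * (t \<bullet> b) * f b))" for f
    by (simp add: inner_sum_right sum_distrib_left exp_sum[symmetric] mult_ac)
  have "(\<integral>A. iexp (s * (t \<bullet> A)) \<partial>std_gauss)
      = (\<integral>f. iexp (s * (t \<bullet> (\<Sum>b\<in>Basis. f b *\<^sub>R b))) \<partial>(\<Pi>\<^sub>M b\<in>(Basis :: 'v set). std_normal_distribution))"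
    unfolding std_gauss_def by (rule integral_distr[OF std_gauss_coordinates_measurable]) simp
  moreover have "(\<integral>f. (\<Prod>b\<in>Basis. iexp (s * (t \<bullet> b) * f b)) \<partial>(\<Pi>\<^sub>M b\<in>(Basis :: 'v set). std_normal_distribution))
      = (\<Prod>b\<in>(Basis :: 'v set). \<integral>x. iexp (s * (t \<bullet> b) * x) \<partial>std_normal_distribution)"
    by (intro product_integral_prod N.integrable_iexp) auto
  ultimately have "(\<integral>A. iexp (s * (t \<bullet> A)) \<partial>std_gauss)
      = (\<Prod>b\<in>(Basis :: 'v set). complex_of_real (exp (- ((s * (t \<bullet> b))\<^sup>2) / 2)))"
    unfolding split char by simp
  then show "(\<integral>A. iexp (s * (t \<bullet> A)) \<partial>std_gauss)
      = complex_of_real (exp (- (s\<^sup>2 * (\<integral>A. (t \<bullet> A)\<^sup>2 \<partial>std_gauss)) / 2))"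
    unfolding second prod[symmetric] of_real_prod .
qed simp

text \<open>Proportional covariances mean equal laws up to scaling, including \<open>\<kappa> = 0\<close>, where both vectors vanish
  almost surely.\<close>

lemma same_distr_scaled_gaussian:
  fixes H :: "'p \<Rightarrow> 'v::euclidean_space" and X :: "'q \<Rightarrow> 'v"
  assumes P: "prob_space P" and Q: "prob_space Q"
    and H: "centered_gaussian_vector P H" and X: "centered_gaussian_vector Q X"
    and "0 \<le> \<kappa>"
    and cov: "\<And>b c. b \<in> Basis \<Longrightarrow> c \<in> Basis \<Longrightarrow>
      (\<integral>\<omega>. (H \<omega> \<bullet> b) * (H \<omega> \<bullet> c) \<partial>P) = \<kappa> * (\<integral>\<omega>. (X \<omega> \<bullet> b) * (X \<omega> \<bullet> c) \<partial>Q)"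
  shows "same_distr P H Q (\<lambda>\<omega>. sqrt \<kappa> *\<^sub>R X \<omega>)"
proof -
  have X': "centered_gaussian_vector Q (\<lambda>\<omega>. sqrt \<kappa> *\<^sub>R X \<omega>)"
    by (rule centered_gaussian_vector_linear[OF X]) (rule linear_scaleR)
  have "distr P borel H = distr Q borel (\<lambda>\<omega>. sqrt \<kappa> *\<^sub>R X \<omega>)"
  proof (rule centered_gaussian_vector_distr_eq[OF P Q H X'])
    fix b c :: 'v assume bc: "b \<in> Basis" "c \<in> Basis"
    have "(\<integral>\<omega>. (sqrt \<kappa> *\<^sub>R X \<omega> \<bullet> b) * (sqrt \<kappa> *\<^sub>R X \<omega> \<bullet> c) \<partial>Q)
        = (\<integral>\<omega>. \<kappa> * ((X \<omega> \<bullet> b) * (X \<omega> \<bullet> c)) \<partial>Q)"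
      using \<open>0 \<le> \<kappa>\<close> by (intro Bochner_Integration.integral_cong) (simp_all add: mult.assoc mult.left_commute)
    then show "(\<integral>\<omega>. (H \<omega> \<bullet> b) * (H \<omega> \<bullet> c) \<partial>P)
        = (\<integral>\<omega>. (sqrt \<kappa> *\<^sub>R X \<omega> \<bullet> b) * (sqrt \<kappa> *\<^sub>R X \<omega> \<bullet> c) \<partial>Q)"
      by (simp add: cov[OF bc])
  qed
  with H X' show ?thesis by (simp add: same_distr_def centered_gaussian_vector_def)
qed

lemma Basis_vecD: "b \<in> (Basis :: (real^'n) set) \<Longrightarrow> \<exists>i. b = axis i 1"
  by (auto simp: Basis_vec_def)

lemma Basis_matrixD: "b \<in> (Basis :: (real^'n^'m) set) \<Longrightarrow> \<exists>i j. b = axis i (axis j 1)"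
  by (auto simp: Basis_vec_def)

section \<open>The ensembles as linear images of the standard Gaussian matrix\<close>

lemma std_gaussian_vector_std_gauss:
  "std_gaussian_vector (std_gauss :: (real^'n) measure) (\<lambda>A. A)"
proof -
  have coord: "A $ i = A \<bullet> axis i 1" for A :: "real^'n" and i by (simp add: inner_axis)
  have basis: "(axis i 1 :: real^'n) \<in> Basis" for i by (simp add: axis_in_Basis_iff)
  show ?thesis
    unfolding std_gaussian_vector_def coord
    by (intro conjI allI prob_space_std_gauss std_gauss_indep std_gauss_coordinate)
       (auto simp: inj_on_def axis_eq_axis basis)
qed

abbreviation matrix_unit :: "'n \<Rightarrow> 'n \<Rightarrow> real^'n^'n" where
  "matrix_unit i j \<equiv> axis i (axis j 1)"

lemma matrix_unit_Basis: "matrix_unit i j \<in> Basis"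
  by (simp add: axis_in_Basis_iff)

lemma matrix_unit_inner: "matrix_unit i j \<bullet> matrix_unit k l = (if i = k \<and> j = l then 1 else 0)"
  by (simp add: inner_axis_axis)

lemma matrix_entry: "A $ i $ j = A \<bullet> matrix_unit i j"
  by (simp add: inner_axis)

lemma inj_on_matrix_unit: "inj_on (\<lambda>(i, j). matrix_unit i j) I"
  by (auto simp: inj_on_def axis_eq_axis)

text \<open>Every centered Gaussian matrix arises from a standard one by taking inner products with fixed
  weights, and the covariance of two entries is the inner product of their weights.  Here the reference
  ensembles are such images.\<close>

definition gaussian_matrix ::
    "('n \<Rightarrow> 'n \<Rightarrow> real^'n^'n) \<Rightarrow> real^'n^'n \<Rightarrow> real^'n^'n" where
  "gaussian_matrix B A = (\<chi> i j. A \<bullet> B i j)"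

lemma gaussian_matrix_entry: "gaussian_matrix B A $ i $ j = A \<bullet> B i j"
  by (simp add: gaussian_matrix_def)

lemma centered_gaussian_vector_gaussian_matrix:
  "centered_gaussian_vector std_gauss (gaussian_matrix B)"
proof (rule centered_gaussian_vector_linear[OF centered_gaussian_vector_std_gauss])
  show "linear (gaussian_matrix B)"
    by (rule linearI) (simp_all add: vec_eq_iff gaussian_matrix_entry inner_simps)
qed

lemma gaussian_matrix_measurable: "gaussian_matrix B \<in> borel_measurable std_gauss"
  using centered_gaussian_vector_gaussian_matrix[of B]
  unfolding centered_gaussian_vector_def by (rule conjunct1)

lemma gaussian_matrix_cov:
  "(\<integral>A. gaussian_matrix B A $ i $ j * gaussian_matrix B A $ k $ l \<partial>std_gauss) = B i j \<bullet> B k l"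
  unfolding gaussian_matrix_entry by (rule std_gauss_inner_sq_integrable_cov)

lemma gaussian_matrix_indep:
  fixes B :: "'n \<Rightarrow> 'n \<Rightarrow> real^'n^'n"
  assumes B: "\<And>i j. (i, j) \<in> I \<Longrightarrow> B i j = s i j *\<^sub>R matrix_unit i j"
  shows "prob_space.indep_vars std_gauss (\<lambda>_. borel) (\<lambda>(i, j) A. gaussian_matrix B A $ i $ j) I"
proof -
  interpret prob_space "std_gauss :: (real^'n^'n) measure" by (rule prob_space_std_gauss)
  have "indep_vars (\<lambda>_. borel) (\<lambda>p A. A \<bullet> (case p of (i, j) \<Rightarrow> matrix_unit i j)) I"
    by (rule std_gauss_indep[OF inj_on_matrix_unit]) (auto simp: matrix_unit_Basis)
  then have "indep_vars (\<lambda>_. borel) (\<lambda>p A. (case p of (i, j) \<Rightarrow> s i j) * (A \<bullet> (case p of (i, j) \<Rightarrow> matrix_unit i j))) I"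
    by (rule indep_vars_compose2) simp
  also have "?this \<longleftrightarrow> ?thesis"
    by (intro indep_vars_cong) (auto simp: gaussian_matrix_entry B fun_eq_iff)
  finally show ?thesis .
qed

lemma matrix_unit_distributed:
  "distributed std_gauss lborel (\<lambda>A. A \<bullet> matrix_unit i j) (\<lambda>x. ennreal (std_normal_density x))"
  by (rule std_gauss_coordinate[OF matrix_unit_Basis])

text \<open>Only the entries of the standard matrix on or above the diagonal are used, at the position
  \<open>(min i j, max i j)\<close>.  The factor \<open>sqrt 2\<close> gives the diagonal its variance 2.\<close>

definition GOE_weights :: "'n \<Rightarrow> 'n \<Rightarrow> real^'n::{finite,linorder}^'n::{finite,linorder}" where
  "GOE_weights i j = (if i = j then sqrt 2 else 1) *\<^sub>R matrix_unit (min i j) (max i j)"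

definition GSOE_weights :: "'n \<Rightarrow> 'n \<Rightarrow> real^'n::{finite,linorder}^'n::{finite,linorder}" where
  "GSOE_weights i j = (if i < j then 1 else if j < i then - 1 else 0) *\<^sub>R matrix_unit (min i j) (max i j)"

text \<open>An unordered pair is determined by its minimum and maximum.\<close>

lemma min_max_eq_iff:
  fixes i j k l :: "'a::linorder"
  shows "min i j = min k l \<and> max i j = max k l \<longleftrightarrow> (i = k \<and> j = l) \<or> (i = l \<and> j = k)"
  by (metis min_def max_def linorder_linear order_antisym)

lemma GOE_weights_inner: "GOE_weights i j \<bullet> GOE_weights k l
    = (if i = k \<and> j = l then 1 else 0) + (if i = l \<and> j = k then 1 else 0)"
proof -
  have eq: "GOE_weights i j \<bullet> GOE_weights k l = (if i = j then sqrt 2 else 1) * ((if k = l then sqrt 2 else 1)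
      * (if (i = k \<and> j = l) \<or> (i = l \<and> j = k) then 1 else 0))"
    unfolding GOE_weights_def inner_scaleR_left inner_scaleR_right matrix_unit_inner min_max_eq_iff
    by (rule mult.left_commute)
  consider "i = k" "j = l" | "i = l" "j = k" "k \<noteq> l" | "\<not> (i = k \<and> j = l)" "\<not> (i = l \<and> j = k)"
    by blast
  then show ?thesis
  proof cases
    case 1
    then show ?thesis unfolding eq by (cases "k = l") simp_all
  next
    case 2
    then show ?thesis unfolding eq by simp
  next
    case 3
    then show ?thesis unfolding eq by (simp only: simp_thms if_False mult_zero_right add_0_right)
  qed
qed

lemma GSOE_weights_inner:
  fixes i j k l :: "'a::{finite,linorder}"
  shows "GSOE_weights i j \<bullet> GSOE_weights k l
    = (if i = k \<and> j = l then 1 else 0) - (if i = l \<and> j = k then 1 else 0)"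
proof -
  define s :: "'a \<Rightarrow> 'a \<Rightarrow> real" where "s i j = (if i < j then 1 else if j < i then - 1 else 0)" for i j
  have eq: "GSOE_weights i j \<bullet> GSOE_weights k l =
      s i j * (s k l * (if (i = k \<and> j = l) \<or> (i = l \<and> j = k) then 1 else 0))"
    unfolding GSOE_weights_def inner_scaleR_left inner_scaleR_right matrix_unit_inner min_max_eq_iff s_def
    by (rule mult.left_commute)
  have s: "s i j * s i j = (if i = j then 0 else 1)" "s i j * s j i = (if i = j then 0 else - 1)" for i j
    by (cases i j rule: linorder_cases; simp add: s_def order_less_not_sym)+
  consider "i = k" "j = l" | "i = l" "j = k" "k \<noteq> l" | "\<not> (i = k \<and> j = l)" "\<not> (i = l \<and> j = k)"
    by blast
  then show ?thesis
  proof cases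
    case 1
    then show ?thesis unfolding eq by (cases "k = l") (simp_all add: s)
  next
    case 2
    then show ?thesis unfolding eq by (simp add: s)
  next
    case 3
    then show ?thesis unfolding eq by (simp only: simp_thms if_False mult_zero_right diff_0_right)
  qed
qed

lemma GOE_gaussian_matrix:
  "GOE std_gauss (gaussian_matrix GOE_weights ::
    real^'n::{finite,linorder}^'n::{finite,linorder} \<Rightarrow> _)"
  unfolding GOE_def
proof (intro conjI allI impI)
  interpret prob_space "std_gauss :: (real^'n::{finite,linorder}^'n::{finite,linorder}) measure"
    by (rule prob_space_std_gauss)
  show "prob_space (std_gauss :: (real^'n::{finite,linorder}^'n::{finite,linorder}) measure)"
    by (rule prob_space_std_gauss)
  show "gaussian_matrix GOE_weights \<in> borel_measurable std_gauss"
    by (rule gaussian_matrix_measurable)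
  show "AE A :: real^'n::{finite,linorder}^'n::{finite,linorder} in std_gauss. transpose (gaussian_matrix GOE_weights A) = gaussian_matrix GOE_weights A"
    by (simp add: vec_eq_iff transpose_def gaussian_matrix_entry GOE_weights_def min.commute max.commute eq_commute)
  show "indep_vars (\<lambda>_. borel) (\<lambda>(i :: 'n, j) A. gaussian_matrix GOE_weights A $ i $ j) {(i, j). i \<le> j}"
    by (rule gaussian_matrix_indep[where s = "\<lambda>i j. if i = j then sqrt 2 else 1"]) (auto simp: GOE_weights_def)
  show "distributed std_gauss lborel (\<lambda>A. gaussian_matrix GOE_weights A $ i $ i)
      (\<lambda>x. ennreal (normal_density 0 (sqrt 2) x))" for i :: 'n
    using normal_density_affine[OF matrix_unit_distributed[of i i], of "sqrt 2" 0]
    by (simp add: gaussian_matrix_entry GOE_weights_def)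
  show "distributed std_gauss lborel (\<lambda>A. gaussian_matrix GOE_weights A $ i $ j)
      (\<lambda>x. ennreal (std_normal_density x))" if "i < j" for i j :: 'n
    using that less_imp_neq[OF that] matrix_unit_distributed[of i j]
    by (simp add: gaussian_matrix_entry GOE_weights_def)
qed

lemma GSOE_gaussian_matrix:
  "GSOE std_gauss (gaussian_matrix GSOE_weights ::
    real^'n::{finite,linorder}^'n::{finite,linorder} \<Rightarrow> _)"
  unfolding GSOE_def
proof (intro conjI allI impI)
  interpret prob_space "std_gauss :: (real^'n::{finite,linorder}^'n::{finite,linorder}) measure"
    by (rule prob_space_std_gauss)
  show "prob_space (std_gauss :: (real^'n::{finite,linorder}^'n::{finite,linorder}) measure)"
    by (rule prob_space_std_gauss)
  show "gaussian_matrix GSOE_weights \<in> borel_measurable std_gauss"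
    by (rule gaussian_matrix_measurable)
  show "AE A :: real^'n::{finite,linorder}^'n::{finite,linorder} in std_gauss. (\<forall>i j. gaussian_matrix GSOE_weights A $ j $ i = - gaussian_matrix GSOE_weights A $ i $ j) \<and>
      (\<forall>i. gaussian_matrix GSOE_weights A $ i $ i = 0)"
    by (simp add: gaussian_matrix_entry GSOE_weights_def min.commute max.commute order_less_not_sym)
  show "indep_vars (\<lambda>_. borel) (\<lambda>(i :: 'n, j) A. gaussian_matrix GSOE_weights A $ i $ j) {(i, j). i < j}"
    by (rule gaussian_matrix_indep[where s = "\<lambda>i j. 1"]) (auto simp: GSOE_weights_def)
  show "distributed std_gauss lborel (\<lambda>A. gaussian_matrix GSOE_weights A $ i $ j)
      (\<lambda>x. ennreal (std_normal_density x))" if "i < j" for i j :: 'n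
    using that matrix_unit_distributed[of i j]
    by (simp add: gaussian_matrix_entry GSOE_weights_def)
qed

section \<open>Covariances of the derivatives of a block field\<close>

lemma swap_line: "prod.swap (x + t *\<^sub>R b) = prod.swap x + t *\<^sub>R prod.swap b"
  by (simp add: prod_eq_iff)

lemma swap_Basis:
  fixes b :: "'v::euclidean_space \<times> 'v"
  assumes "b \<in> Basis" shows "prod.swap b \<in> Basis"
  using assms by (auto simp: Basis_prod_def)

lemma swap_inner: "prod.swap a \<bullet> prod.swap b = a \<bullet> b" "prod.swap a \<bullet> b = a \<bullet> prod.swap b"
  by (simp_all add: inner_prod_def add.commute)

context prob_space
begin

context
  fixes u :: "'v::euclidean_space \<times> 'v \<Rightarrow> 'a \<Rightarrow> real" and \<phi> :: "'v \<times> 'v \<Rightarrow> real"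
  assumes u: "\<And>x. sq_integrable M (u x)"
    and cov: "\<And>x y. (\<integral>\<omega>. u x \<omega> * u y \<omega> \<partial>M) = \<phi> (x - y)"
    and C: "C_n 4 \<phi>"
begin

text \<open>By the chain rule, differentiating \<open>x \<mapsto> u (swap x)\<close> along \<open>b\<close> means differentiating \<open>u\<close> along
  \<open>swap b\<close> at \<open>swap x\<close>.\<close>

lemma block_field_ms_deriv:
  assumes b: "b \<in> Basis"
  shows "has_ms_deriv M (block_field u) b x
    (\<lambda>\<omega>. ms_deriv M u b x \<omega> - ms_deriv M u (prod.swap b) (prod.swap x) \<omega>)"
proof (rule has_ms_deriv_diff)
  show "has_ms_deriv M u b x (ms_deriv M u b x)"
    by (rule stationary_derivatives(1)[OF u cov C b b])
  show "has_ms_deriv M u (prod.swap b) (prod.swap x) (ms_deriv M u (prod.swap b) (prod.swap x))"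
    by (rule stationary_derivatives(1)[OF u cov C swap_Basis[OF b] swap_Basis[OF b]])
  show "block_field u (x + t *\<^sub>R b) =
      (\<lambda>\<omega>. u (x + t *\<^sub>R b) \<omega> - u (prod.swap x + t *\<^sub>R prod.swap b) \<omega>)" for t
    by (rule ext) (simp only: block_field_def swap_line)
qed

lemma block_field_ms_deriv2:
  assumes a: "a \<in> Basis" and b: "b \<in> Basis"
  shows "has_ms_deriv M (ms_deriv M (block_field u) b) a x
    (\<lambda>\<omega>. ms_deriv M (ms_deriv M u b) a x \<omega>
      - ms_deriv M (ms_deriv M u (prod.swap b)) (prod.swap a) (prod.swap x) \<omega>)"
proof (rule has_ms_deriv_cong_AE)
  let ?f' = "\<lambda>x \<omega>. ms_deriv M u b x \<omega> - ms_deriv M u (prod.swap b) (prod.swap x) \<omega>"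
  show "has_ms_deriv M ?f' a x (\<lambda>\<omega>. ms_deriv M (ms_deriv M u b) a x \<omega>
      - ms_deriv M (ms_deriv M u (prod.swap b)) (prod.swap a) (prod.swap x) \<omega>)"
  proof (rule has_ms_deriv_diff)
    show "has_ms_deriv M (ms_deriv M u b) a x (ms_deriv M (ms_deriv M u b) a x)"
      by (rule stationary_derivatives(2)[OF u cov C a b])
    show "has_ms_deriv M (ms_deriv M u (prod.swap b)) (prod.swap a) (prod.swap x)
        (ms_deriv M (ms_deriv M u (prod.swap b)) (prod.swap a) (prod.swap x))"
      by (rule stationary_derivatives(2)[OF u cov C swap_Basis[OF a] swap_Basis[OF b]])
  qed (simp only: swap_line)
  show "AE \<omega> in M. ?f' x \<omega> = ms_deriv M (block_field u) b x \<omega>" for x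
    by (rule has_ms_deriv_unique[OF block_field_ms_deriv[OF b] has_ms_deriv_ms_deriv[OF block_field_ms_deriv[OF b]]])
  show "ms_deriv M (block_field u) b x \<in> borel_measurable M" for x
    by (rule sq_integrableD(1)[OF has_ms_derivD(1)[OF has_ms_deriv_ms_deriv[OF block_field_ms_deriv[OF b]]]])
qed

text \<open>On the diagonal, where \<open>swap z = z\<close>, each derivative of the block field is a difference of two
  derivatives of \<open>u\<close> at the same point.  The covariance of two such differences has four terms, which
  agree in pairs because a swap of all directions preserves inner products.  Among the three pairings
  in the fourth derivatives, the one that joins the two directions of each second derivative cancels:
  this is the trace part, which the ensembles lack.\<close>

context
  fixes h h' h'' :: "real \<Rightarrow> real"
  assumes \<phi>: "\<And>w. \<phi> w = h ((norm w)\<^sup>2)"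
    and h: "\<forall>t\<ge>0. (h has_real_derivative h' t) (at t within {0..})"
    and h': "\<forall>t\<ge>0. (h' has_real_derivative h'' t) (at t within {0..})"
    and h''_cont: "continuous_on {0..} h''"
begin

lemma block_field_gradient_cov:
  assumes b: "b \<in> Basis" and c: "c \<in> Basis" and z: "prod.swap z = z"
  shows "(\<integral>\<omega>. ms_deriv M (block_field u) b z \<omega> * ms_deriv M (block_field u) c z \<omega> \<partial>M)
    = - 4 * h' 0 * (b \<bullet> c - b \<bullet> prod.swap c)"
proof -
  note D = block_field_ms_deriv[where x = z, unfolded z]
  note V = stationary_derivatives(1)[OF u cov C, THEN has_ms_derivD(1)]
  note K = stationary_derivatives(3)[OF u cov C, where x = z and y = z, unfolded diff_self]
  note P = radial_partial2[OF \<phi> C h h' h''_cont]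
  note s = swap_Basis
  have meas: "ms_deriv M (block_field u) b z \<in> borel_measurable M" if "b \<in> Basis" for b
    by (rule sq_integrableD(1)[OF has_ms_derivD(1)[OF has_ms_deriv_ms_deriv[OF D[OF that]]]])
  have AE: "AE \<omega> in M. ms_deriv M (block_field u) b z \<omega> = ms_deriv M u b z \<omega> - ms_deriv M u (prod.swap b) z \<omega>"
    if "b \<in> Basis" for b
    by (rule has_ms_deriv_unique[OF has_ms_deriv_ms_deriv[OF D[OF that]] D[OF that]])
  have cov0: "(\<integral>\<omega>. ms_deriv M u b z \<omega> * ms_deriv M u c z \<omega> \<partial>M) = - 2 * h' 0 * (b \<bullet> c)"
    if "b \<in> Basis" "c \<in> Basis" for b c
    using K[OF that] P[OF that] by simp
  show ?thesis
    unfolding integral_diff_mult_diff[OF V[OF b b] V[OF s[OF b] s[OF b]] V[OF c c] V[OF s[OF c] s[OF c]]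
        AE[OF b] meas[OF b] AE[OF c] meas[OF c]]
      cov0[OF b c] cov0[OF b s[OF c]] cov0[OF s[OF b] c] cov0[OF s[OF b] s[OF c]] swap_inner swap_swap
    by algebra
qed

lemma block_field_hessian_cov:
  assumes basis: "a \<in> Basis" "b \<in> Basis" "c \<in> Basis" "d \<in> Basis" and z: "prod.swap z = z"
  shows "(\<integral>\<omega>. ms_deriv M (ms_deriv M (block_field u) b) a z \<omega>
        * ms_deriv M (ms_deriv M (block_field u) d) c z \<omega> \<partial>M)
    = 8 * h'' 0 * ((a \<bullet> c) * (b \<bullet> d) + (a \<bullet> d) * (b \<bullet> c)
        - (a \<bullet> prod.swap c) * (b \<bullet> prod.swap d) - (a \<bullet> prod.swap d) * (b \<bullet> prod.swap c))"
proof -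
  note D = block_field_ms_deriv2[where x = z, unfolded z]
  note V = stationary_derivatives(2)[OF u cov C, THEN has_ms_derivD(1)]
  note K = stationary_derivatives(4)[OF u cov C, where x = z and y = z, unfolded diff_self]
  note P = radial_partial4[OF \<phi> C h h' h''_cont]
  note s = swap_Basis
  have meas: "ms_deriv M (ms_deriv M (block_field u) b) a z \<in> borel_measurable M"
    if "a \<in> Basis" "b \<in> Basis" for a b
    by (rule sq_integrableD(1)[OF has_ms_derivD(1)[OF has_ms_deriv_ms_deriv[OF D[OF that]]]])
  have AE: "AE \<omega> in M. ms_deriv M (ms_deriv M (block_field u) b) a z \<omega>
      = ms_deriv M (ms_deriv M u b) a z \<omega> - ms_deriv M (ms_deriv M u (prod.swap b)) (prod.swap a) z \<omega>"
    if "a \<in> Basis" "b \<in> Basis" for a b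
    by (rule has_ms_deriv_unique[OF has_ms_deriv_ms_deriv[OF D[OF that]] D[OF that]])
  have cov0: "(\<integral>\<omega>. ms_deriv M (ms_deriv M u b) a z \<omega> * ms_deriv M (ms_deriv M u d) c z \<omega> \<partial>M)
      = 4 * h'' 0 * ((a \<bullet> b) * (c \<bullet> d) + (a \<bullet> c) * (b \<bullet> d) + (a \<bullet> d) * (b \<bullet> c))"
    if "a \<in> Basis" "b \<in> Basis" "c \<in> Basis" "d \<in> Basis" for a b c d
    using K[OF that] P[OF that(2,1,4,3)] by (simp add: inner_commute algebra_simps)
  show ?thesis
    unfolding integral_diff_mult_diff[OF V[OF basis(1,2)] V[OF s[OF basis(1)] s[OF basis(2)]]
        V[OF basis(3,4)] V[OF s[OF basis(3)] s[OF basis(4)]]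
        AE[OF basis(1,2)] meas[OF basis(1,2)] AE[OF basis(3,4)] meas[OF basis(3,4)]]
      cov0[OF basis] cov0[OF basis(1,2) s[OF basis(3)] s[OF basis(4)]]
      cov0[OF s[OF basis(1)] s[OF basis(2)] basis(3,4)]
      cov0[OF s[OF basis(1)] s[OF basis(2)] s[OF basis(3)] s[OF basis(4)]] swap_inner swap_swap
    by algebra
qed

end

lemma block_field_gradient_gaussian:
  assumes b: "b \<in> Basis"
  shows "ms_deriv M (block_field u) b x \<in> ms_gaussian_space M u"
proof -
  have "(\<lambda>\<omega>. u x \<omega> + (- 1) * u (prod.swap x) \<omega>) \<in> ms_gaussian_space M u" for x
    by (intro ms_gaussian_space_add_scale ms_gaussian_space_base u)
  then have f: "block_field u x \<in> ms_gaussian_space M u" for x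
    by (simp add: block_field_def[abs_def])
  show ?thesis
    by (rule ms_gaussian_space_ms_deriv[OF u f has_ms_deriv_ms_deriv[OF block_field_ms_deriv[OF b]]])
qed

lemma block_field_hessian_gaussian:
  assumes a: "a \<in> Basis" and b: "b \<in> Basis"
  shows "ms_deriv M (ms_deriv M (block_field u) b) a x \<in> ms_gaussian_space M u"
  by (rule ms_gaussian_space_ms_deriv[OF u block_field_gradient_gaussian[OF b]
        has_ms_deriv_ms_deriv[OF block_field_ms_deriv2[OF a b]]])

end

end

section \<open>Gradient and Hessian blocks of a block isotropic field\<close>

lemma dir_Basis: "dir1 i \<in> Basis" "dir2 i \<in> Basis"
  by (auto simp: dir1_def dir2_def Basis_prod_def axis_in_Basis_iff)

lemma dir_inner:
  "dir1 i \<bullet> dir1 j = of_bool (i = j)" "dir2 i \<bullet> dir2 j = of_bool (i = j)"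
  "dir1 i \<bullet> dir2 j = 0" "dir2 i \<bullet> dir1 j = 0"
  by (simp_all add: dir1_def dir2_def inner_prod_def inner_axis_axis of_bool_def)

lemma swap_dir: "prod.swap (dir1 i) = dir2 i" "prod.swap (dir2 i) = dir1 i"
  by (simp_all add: dir1_def dir2_def)

text \<open>Products of indicator values match the covariances term by term, without case distinctions on the
  indices.\<close>

lemma if_conj_eq_of_bool: "(if P \<and> Q then 1 else (0::real)) = of_bool P * of_bool Q"
  by (cases P; cases Q) simp_all

theorem theorem23:
  fixes M :: "'w measure"
    and u :: "(real^'n::{finite,linorder}) \<times> (real^'n::{finite,linorder}) \<Rightarrow> 'w \<Rightarrow> real"
    and h :: "real \<Rightarrow> real"
    and z :: "real^'n::{finite,linorder}"
  assumes "prob_space M"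
    and "gaussian_field M u"
    and "\<And>x. (\<integral>\<omega>. u x \<omega> \<partial>M) = 0"
    and "\<And>x y. cov_fun M u x y = h ((norm (x - y))\<^sup>2)"
    and "C_n 4 (\<lambda>(x, y). cov_fun M u x y)"
    and "C2_half_line h"
  shows "\<exists>c1 c2 c3 :: real. 0 \<le> c1 \<and> 0 \<le> c2 \<and> 0 \<le> c3 \<and>
    (\<exists>(N :: (real^'n::{finite,linorder}) measure) X. std_gaussian_vector N X \<and>
       same_distr M (grad1 M (block_field u) (z, z)) N (\<lambda>\<omega>. c1 *\<^sub>R X \<omega>)) \<and>
    (\<exists>(N :: (real^'n::{finite,linorder}^'n::{finite,linorder}) measure) X. GOE N X \<and>
       same_distr M (hess11 M (block_field u) (z, z)) N (\<lambda>\<omega>. c2 *\<^sub>R X \<omega>)) \<and>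
    (\<exists>(N :: (real^'n::{finite,linorder}^'n::{finite,linorder}) measure) X. GSOE N X \<and>
       same_distr M (hess12 M (block_field u) (z, z)) N (\<lambda>\<omega>. c3 *\<^sub>R X \<omega>))"
proof -
  interpret prob_space M by fact
  note gauss = assms(2,3)
  define \<phi> :: "(real^'n::{finite,linorder}) \<times> (real^'n::{finite,linorder}) \<Rightarrow> real" where "\<phi> w = h ((norm w)\<^sup>2)" for w
  have sq: "sq_integrable M (u x)" for x by (rule gaussian_field_sq_integrable[OF gauss])
  have cov: "(\<integral>\<omega>. u x \<omega> * u y \<omega> \<partial>M) = \<phi> (x - y)" for x y
    using assms(4)[of x y] by (simp add: cov_fun_def assms(3) \<phi>_def)
  have C: "C_n 4 \<phi>"
    using C_n_slice[OF assms(5), of 0] by (simp add: assms(4) \<phi>_def[abs_def])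
  obtain h' h'' where h: "\<forall>t\<ge>0. (h has_real_derivative h' t) (at t within {0..})"
    and h': "\<forall>t\<ge>0. (h' has_real_derivative h'' t) (at t within {0..})"
    and h''_cont: "continuous_on {0..} h''"
    using assms(6) unfolding C2_half_line_def by blast
  have zz: "prod.swap (z, z) = (z, z)" by simp
  note grad_cov = block_field_gradient_cov[OF sq cov C \<phi>_def h h' h''_cont _ _ zz]
  note hess_cov = block_field_hessian_cov[OF sq cov C \<phi>_def h h' h''_cont _ _ _ _ zz]
  note gaussian = block_field_gradient_gaussian[OF sq cov C] block_field_hessian_gaussian[OF sq cov C]
  define i0 :: 'n where "i0 = undefined"

  \<comment> \<open>Both scales are square roots of variances, of a gradient entry and (up to the factor 2) of a diagonal entry of the first Hessian block.\<close>
  have "0 \<le> (\<integral>\<omega>. ms_deriv M (block_field u) (dir1 i0) (z, z) \<omega> * ms_deriv M (block_field u) (dir1 i0) (z, z) \<omega> \<partial>M)"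
    by simp
  then have c1: "0 \<le> - 4 * h' 0" by (simp add: grad_cov dir_Basis dir_inner swap_dir)
  have "0 \<le> (\<integral>\<omega>. ms_deriv M (ms_deriv M (block_field u) (dir1 i0)) (dir1 i0) (z, z) \<omega>
      * ms_deriv M (ms_deriv M (block_field u) (dir1 i0)) (dir1 i0) (z, z) \<omega> \<partial>M)"
    by simp
  then have c2: "0 \<le> 8 * h'' 0" by (simp add: hess_cov dir_Basis dir_inner swap_dir)

  have 1: "same_distr M (grad1 M (block_field u) (z, z)) std_gauss (\<lambda>A. sqrt (- 4 * h' 0) *\<^sub>R A)"
  proof (rule same_distr_scaled_gaussian[OF \<open>prob_space M\<close> prob_space_std_gauss _
        centered_gaussian_vector_std_gauss c1])
    show "centered_gaussian_vector M (grad1 M (block_field u) (z, z))"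
    proof (rule ms_gaussian_space_vector[OF gauss])
      fix b :: "real^'n::{finite,linorder}" assume "b \<in> Basis"
      then show "(\<lambda>\<omega>. grad1 M (block_field u) (z, z) \<omega> \<bullet> b) \<in> ms_gaussian_space M u"
        by (auto dest!: Basis_vecD simp: grad1_def inner_axis gaussian dir_Basis)
    qed
    fix b c :: "real^'n::{finite,linorder}" assume "b \<in> Basis" "c \<in> Basis"
    then obtain i j where bc: "b = axis i 1" "c = axis j 1"
      using Basis_vecD[of b] Basis_vecD[of c] by blast
    show "(\<integral>\<omega>. (grad1 M (block_field u) (z, z) \<omega> \<bullet> b) * (grad1 M (block_field u) (z, z) \<omega> \<bullet> c) \<partial>M)
        = - 4 * h' 0 * (\<integral>A. (A \<bullet> b) * (A \<bullet> c) \<partial>std_gauss)"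
      unfolding std_gauss_inner_sq_integrable_cov(2) bc inner_axis_axis
      by (simp add: grad1_def inner_axis grad_cov dir_Basis dir_inner swap_dir of_bool_def)
  qed

  have 2: "same_distr M (hess11 M (block_field u) (z, z)) std_gauss
      (\<lambda>A. sqrt (8 * h'' 0) *\<^sub>R gaussian_matrix GOE_weights A)"
  proof (rule same_distr_scaled_gaussian[OF \<open>prob_space M\<close> prob_space_std_gauss _
        centered_gaussian_vector_gaussian_matrix c2])
    show "centered_gaussian_vector M (hess11 M (block_field u) (z, z))"
    proof (rule ms_gaussian_space_vector[OF gauss])
      fix b :: "real^'n::{finite,linorder}^'n::{finite,linorder}" assume "b \<in> Basis"
      then show "(\<lambda>\<omega>. hess11 M (block_field u) (z, z) \<omega> \<bullet> b) \<in> ms_gaussian_space M u"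
        by (auto dest!: Basis_matrixD simp: hess11_def inner_axis gaussian dir_Basis)
    qed
    fix b c :: "real^'n::{finite,linorder}^'n::{finite,linorder}" assume "b \<in> Basis" "c \<in> Basis"
    then obtain i j k l where bc: "b = matrix_unit i j" "c = matrix_unit k l"
      using Basis_matrixD[of b] Basis_matrixD[of c] by blast
    show "(\<integral>\<omega>. (hess11 M (block_field u) (z, z) \<omega> \<bullet> b) * (hess11 M (block_field u) (z, z) \<omega> \<bullet> c) \<partial>M)
        = 8 * h'' 0 * (\<integral>A. (gaussian_matrix GOE_weights A \<bullet> b) * (gaussian_matrix GOE_weights A \<bullet> c) \<partial>std_gauss)"
      unfolding bc matrix_entry[symmetric] gaussian_matrix_cov GOE_weights_inner if_conj_eq_of_bool
      by (simp add: hess11_def hess_cov dir_Basis dir_inner swap_dir)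
  qed

  have 3: "same_distr M (hess12 M (block_field u) (z, z)) std_gauss
      (\<lambda>A. sqrt (8 * h'' 0) *\<^sub>R gaussian_matrix GSOE_weights A)"
  proof (rule same_distr_scaled_gaussian[OF \<open>prob_space M\<close> prob_space_std_gauss _
        centered_gaussian_vector_gaussian_matrix c2])
    show "centered_gaussian_vector M (hess12 M (block_field u) (z, z))"
    proof (rule ms_gaussian_space_vector[OF gauss])
      fix b :: "real^'n::{finite,linorder}^'n::{finite,linorder}" assume "b \<in> Basis"
      then show "(\<lambda>\<omega>. hess12 M (block_field u) (z, z) \<omega> \<bullet> b) \<in> ms_gaussian_space M u"
        by (auto dest!: Basis_matrixD simp: hess12_def inner_axis gaussian dir_Basis)
    qed
    fix b c :: "real^'n::{finite,linorder}^'n::{finite,linorder}" assume "b \<in> Basis" "c \<in> Basis"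
    then obtain i j k l where bc: "b = matrix_unit i j" "c = matrix_unit k l"
      using Basis_matrixD[of b] Basis_matrixD[of c] by blast
    show "(\<integral>\<omega>. (hess12 M (block_field u) (z, z) \<omega> \<bullet> b) * (hess12 M (block_field u) (z, z) \<omega> \<bullet> c) \<partial>M)
        = 8 * h'' 0 * (\<integral>A. (gaussian_matrix GSOE_weights A \<bullet> b) * (gaussian_matrix GSOE_weights A \<bullet> c) \<partial>std_gauss)"
      unfolding bc matrix_entry[symmetric] gaussian_matrix_cov GSOE_weights_inner if_conj_eq_of_bool
      by (simp add: hess12_def hess_cov dir_Basis dir_inner swap_dir)
  qed

  show ?thesis
    using 1 2 3 c1 c2 std_gaussian_vector_std_gauss GOE_gaussian_matrix GSOE_gaussian_matrix
    by (intro exI[of _ "sqrt (- 4 * h' 0)"] exI[of _ "sqrt (8 * h'' 0)"] conjI) (auto simp: real_sqrt_ge_0_iff)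
qed

end
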